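(* Let $x_0$ be a regular point of $\mathfrak S_\star$. Given any $\theta\in(0,\frac\pi2)$ there exists a radius $R_{\rm cone}(\theta,x_0)>0$ such that $$\mathfrak S_\star\cap D^2(x_0,r)\subset\mathcal C(x_0,\vec e_{x_0},\theta)\quad\text{for any }0<r\le R_{\rm cone}(\theta,x_0).$$
   Context: $\Omega\subset\mathbb R^2$ is a smooth bounded domain. $V:\mathbb R^k\to\mathbb R$ ($k\ge1$) is smooth with $\inf V=0$ and satisfies: (1) the zero set $\Sigma=\{V=0\}$ is finite with at least two elements; (2) $\nabla^2V(\sigma)$ is positive definite at each $\sigma\in\Sigma$; (3) there are $\alpha_\infty,R_\infty>0$ with $y\cdot\nabla V(y)\ge\alpha_\infty|y|^2$ if $|y|>R_\infty$, and $V(y)\to+\infty$ as $|y|\to+\infty$. Set $e_\varepsilon(u)=\varepsilon\frac{|\nabla u|^2}{2}+\frac1\varepsilon V(u)$ and $E_\varepsilon(u)=\int_\Omega e_\varepsilon(u)dx$. $D^2(x,r)$ is the open disk of center $x$ and radius $r$. Let $M_0>0$, $\varepsilon_n\in(0,1]$, $\varepsilon_n\to0$, and let $u_{\varepsilon_n}\in H^1(\Omega,\mathbb R^k)$ be solutions of $-\Delta u_{\varepsilon_n}=-\varepsilon_n^{-2}\nabla_uV(u_{\varepsilon_n})$ in $\Omega$ with $E_{\varepsilon_n}(u_{\varepsilon_n})\le M_0$, such that (after passing to a subsequence) $e_{\varepsilon_n}(u_{\varepsilon_n})dx\rightharpoonup\nu_\star$ weakly as measures on $\Omega$. Let $\eta_1>0$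 be a constant depending only on $V$ with the clearing-out property (such a constant exists): for every sequence $\tilde\varepsilon_n\in(0,1]$ with $\tilde\varepsilon_n\to0$, all solutions $v_n\in H^1(\Omega,\mathbb R^k)$ of $-\Delta v_n=-\tilde\varepsilon_n^{-2}\nabla_uV(v_n)$ in $\Omega$ with $\sup_nE_{\tilde\varepsilon_n}(v_n)<+\infty$, and every measure $\nu$ on $\Omega$ such that $e_{\tilde\varepsilon_n}(v_n)dx\rightharpoonup\nu$ weakly as measures on $\Omega$, if $D^2(x_0,r)\subset\Omega$ and $\nu(\overline{D^2(x_0,r)})<\eta_1r$, then $\nu(\overline{D^2(x_0,r/2)})=0$. The concentration set is $\mathfrak S_\star=\{x\in\Omega:\liminf_{r\to0}\nu_\star(\overline{D^2(x,r)})/r\ge\eta_1\}$; it is closed in $\Omega$, $1$-rectifiable and of finite $\mathcal H^1$ measure. (Closed disks are understood intersected with $\Omega$.) For a unit vector $\vec e$ and $\theta\in(0,\pi/2)$, $\mathcal C(x_0,\vec e,\theta)=\{y\in\mathbb R^2:|\vec e^{\perp}\cdot(y-x_0)|\le\tan\theta\,|\vec e\cdot(y-x_0)|\}$, with $\vec e^\perp$ a unit vector orthogonal to $\vec e$. A point $x_0\in\mathfrak S_\star$ is a regular point if $\lim_{r\to0}\frac{\mathcal H^1(\mathfrak S_\star\cap D^2(x_0,r))}{2r}=1$ and there is a unit vector $\vec e_{x_0}$ (tangent vector at $x_0$) such that for every $\theta\in(0,\pi/2)$, $\lim_{r\to0}\frac1r\mathcal H^1\big(\mathfrak S_\star\cap(D^2(x_0,r)\setminus\mathcal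 C(x_0,\vec e_{x_0},\theta))\big)=0$. *)

theory Defs
  imports "HOL-Analysis.Analysis"
begin

section \<open>Smooth functions, gradients, smooth domains\<close>

primrec Ck :: "nat \<Rightarrow> ('a::euclidean_space \<Rightarrow> 'b::real_normed_vector) \<Rightarrow> bool" where
  "Ck 0 f \<longleftrightarrow> continuous_on UNIV f"
| "Ck (Suc k) f \<longleftrightarrow> f differentiable_on UNIV \<and>
     (\<forall>b\<in>Basis. Ck k (\<lambda>x. frechet_derivative f (at x) b))"

definition smooth :: "('a::euclidean_space \<Rightarrow> 'b::real_normed_vector) \<Rightarrow> bool" where
  "smooth f \<longleftrightarrow> (\<forall>k. Ck k f)"

definition grad :: "('a::euclidean_space \<Rightarrow> real) \<Rightarrow> 'a \<Rightarrow> 'a" where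
  "grad f x = (THE D. GDERIV f x :> D)"

definition perp :: "real^2 \<Rightarrow> real^2" where
  "perp e = vector [- (e $ 2), e $ 1]"

text \<open>The boundary condition says that, near each boundary point and in suitable orthonormal
  coordinates, the domain is the region above the graph of a smooth function.\<close>

definition smooth_bounded_domain :: "(real^2) set \<Rightarrow> bool" where
  "smooth_bounded_domain \<Omega> \<longleftrightarrow> \<Omega> \<noteq> {} \<and> open \<Omega> \<and> connected \<Omega> \<and> bounded \<Omega> \<and>
     (\<forall>p\<in>frontier \<Omega>. \<exists>r>0. \<exists>e. \<exists>\<gamma>::real \<Rightarrow> real. norm e = 1 \<and> smooth \<gamma> \<and>
        \<Omega> \<inter> ball p r = {x \<in> ball p r. \<gamma> (e \<bullet> x) < perp e \<bullet> x})"

section \<open>The potential\<close>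

definition zero_set :: "(real^'k \<Rightarrow> real) \<Rightarrow> (real^'k) set" where
  "zero_set V = {y. V y = 0}"

definition admissible_potential :: "(real^'k \<Rightarrow> real) \<Rightarrow> bool" where
  "admissible_potential V \<longleftrightarrow>
     smooth V \<and> bdd_below (range V) \<and> (INF y. V y) = 0 \<and>
     finite (zero_set V) \<and> card (zero_set V) \<ge> 2 \<and>
     (\<forall>\<sigma>\<in>zero_set V. \<forall>h. h \<noteq> 0 \<longrightarrow> h \<bullet> frechet_derivative (grad V) (at \<sigma>) h > 0) \<and>
     (\<exists>\<alpha>>0. \<exists>R>0. \<forall>y. norm y > R \<longrightarrow> y \<bullet> grad V y \<ge> \<alpha> * (norm y)\<^sup>2) \<and>
     filterlim V at_top at_infinity"

section \<open>The Sobolev space, the energy and weak solutions\<close>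

definition locally_integrable :: "(real^2) set \<Rightarrow> (real^2 \<Rightarrow> 'b::euclidean_space) \<Rightarrow> bool" where
  "locally_integrable \<Omega> f \<longleftrightarrow> (\<forall>K. compact K \<and> K \<subseteq> \<Omega> \<longrightarrow> set_integrable lebesgue K f)"

definition square_integrable :: "(real^2) set \<Rightarrow> (real^2 \<Rightarrow> 'b::euclidean_space) \<Rightarrow> bool" where
  "square_integrable \<Omega> f \<longleftrightarrow> f \<in> borel_measurable (lebesgue_on \<Omega>) \<and>
     integrable (lebesgue_on \<Omega>) (\<lambda>x. (norm (f x))\<^sup>2)"

definition compact_support_in :: "(real^2) set \<Rightarrow> (real^2 \<Rightarrow> real) \<Rightarrow> bool" where
  "compact_support_in \<Omega> \<phi> \<longleftrightarrow>
     compact (closure {x. \<phi> x \<noteq> 0}) \<and> closure {x. \<phi> x \<noteq> 0} \<subseteq> \<Omega>"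

definition test_function :: "(real^2) set \<Rightarrow> (real^2 \<Rightarrow> real) \<Rightarrow> bool" where
  "test_function \<Omega> \<phi> \<longleftrightarrow> smooth \<phi> \<and> compact_support_in \<Omega> \<phi>"

text \<open>Row \<open>i\<close> of the matrix \<open>G x\<close> is the gradient of the component \<open>u\<^sub>i\<close> at \<open>x\<close>; the norm on
  \<^typ>\<open>real^2^'k\<close> is the Euclidean (Frobenius) one.\<close>

definition has_weak_gradient ::
    "(real^2) set \<Rightarrow> (real^2 \<Rightarrow> real^'k) \<Rightarrow> (real^2 \<Rightarrow> real^2^'k) \<Rightarrow> bool" where
  "has_weak_gradient \<Omega> u G \<longleftrightarrow> locally_integrable \<Omega> u \<and> locally_integrable \<Omega> G \<and>
     (\<forall>\<phi> i. test_function \<Omega> \<phi> \<longrightarrow>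
        (LINT x|lebesgue_on \<Omega>. (u x $ i) *\<^sub>R grad \<phi> x)
        = - (LINT x|lebesgue_on \<Omega>. \<phi> x *\<^sub>R (G x $ i)))"

text \<open>Weak gradients are unique up to null sets; the choice of representative is immaterial below.\<close>

definition weak_gradient ::
    "(real^2) set \<Rightarrow> (real^2 \<Rightarrow> real^'k) \<Rightarrow> real^2 \<Rightarrow> real^2^'k" where
  "weak_gradient \<Omega> u = (SOME G. has_weak_gradient \<Omega> u G)"

definition sobolev_H1 :: "(real^2) set \<Rightarrow> (real^2 \<Rightarrow> real^'k) set" where
  "sobolev_H1 \<Omega> = {u. square_integrable \<Omega> u \<and>
     (\<exists>G. has_weak_gradient \<Omega> u G \<and> square_integrable \<Omega> G)}"

definition energy_density ::
    "(real^2) set \<Rightarrow> (real^'k \<Rightarrow> real) \<Rightarrow> real \<Rightarrow> (real^2 \<Rightarrow> real^'k) \<Rightarrow> real^2 \<Rightarrow> real" where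
  "energy_density \<Omega> V \<epsilon> u x =
     \<epsilon> * ((norm (weak_gradient \<Omega> u x))\<^sup>2 / 2) + (1 / \<epsilon>) * V (u x)"

definition energy ::
    "(real^2) set \<Rightarrow> (real^'k \<Rightarrow> real) \<Rightarrow> real \<Rightarrow> (real^2 \<Rightarrow> real^'k) \<Rightarrow> ennreal" where
  "energy \<Omega> V \<epsilon> u = (\<integral>\<^sup>+ x. ennreal (energy_density \<Omega> V \<epsilon> u x) \<partial>lebesgue_on \<Omega>)"

text \<open>The equation \<open>- \<Delta> u = - \<epsilon>\<^sup>-\<^sup>2 \<nabla>V(u)\<close> in the sense of distributions, component by component.
  Local integrability of \<open>\<nabla>V(u)\<close> is what makes its right-hand side a distribution.\<close>

definition weak_solution ::
    "(real^2) set \<Rightarrow> (real^'k \<Rightarrow> real) \<Rightarrow> real \<Rightarrow> (real^2 \<Rightarrow> real^'k) \<Rightarrow> bool" where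
  "weak_solution \<Omega> V \<epsilon> u \<longleftrightarrow> u \<in> sobolev_H1 \<Omega> \<and>
     locally_integrable \<Omega> (\<lambda>x. grad V (u x)) \<and>
     (\<forall>\<phi> i. test_function \<Omega> \<phi> \<longrightarrow>
        (LINT x|lebesgue_on \<Omega>. (weak_gradient \<Omega> u x $ i) \<bullet> grad \<phi> x)
        = - (1 / \<epsilon>\<^sup>2) * (LINT x|lebesgue_on \<Omega>. (grad V (u x) $ i) * \<phi> x))"

section \<open>Weak convergence of measures, clearing-out, concentration set\<close>

text \<open>Measures on \<open>\<Omega>\<close> have \<open>\<Omega>\<close> itself as underlying space and are Radon; convergence is tested
  against continuous functions with compact support in \<open>\<Omega>\<close>. Without the finiteness on
  compact sets the Bochner integrals on the right would be meaningless.\<close>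

definition radon_measure_on :: "(real^2) set \<Rightarrow> (real^2) measure \<Rightarrow> bool" where
  "radon_measure_on \<Omega> \<nu> \<longleftrightarrow> sets \<nu> = sets (restrict_space borel \<Omega>) \<and>
     (\<forall>K. compact K \<and> K \<subseteq> \<Omega> \<longrightarrow> emeasure \<nu> K < \<infinity>)"

definition densities_converge_weakly ::
    "(real^2) set \<Rightarrow> (nat \<Rightarrow> real^2 \<Rightarrow> real) \<Rightarrow> (real^2) measure \<Rightarrow> bool" where
  "densities_converge_weakly \<Omega> f \<nu> \<longleftrightarrow> radon_measure_on \<Omega> \<nu> \<and>
     (\<forall>\<phi>. continuous_on UNIV \<phi> \<and> compact_support_in \<Omega> \<phi> \<longrightarrow>
        (\<lambda>n. LINT x|lebesgue_on \<Omega>. \<phi> x * f n x) \<longlonglongrightarrow> (LINT x|\<nu>. \<phi> x))"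

definition clearing_out_constant ::
    "(real^2) set \<Rightarrow> (real^'k \<Rightarrow> real) \<Rightarrow> real \<Rightarrow> bool" where
  "clearing_out_constant \<Omega> V \<eta> \<longleftrightarrow> \<eta> > 0 \<and>
     (\<forall>\<epsilon> v \<nu> x\<^sub>0 r.
        (\<forall>n. 0 < \<epsilon> n \<and> \<epsilon> n \<le> 1) \<and> \<epsilon> \<longlonglongrightarrow> 0 \<and>
        (\<forall>n::nat. weak_solution \<Omega> V (\<epsilon> n) (v n)) \<and>
        (SUP n. energy \<Omega> V (\<epsilon> n) (v n)) < \<infinity> \<and>
        densities_converge_weakly \<Omega> (\<lambda>n. energy_density \<Omega> V (\<epsilon> n) (v n)) \<nu> \<and>
        r > 0 \<and> ball x\<^sub>0 r \<subseteq> \<Omega> \<and> emeasure \<nu> (cball x\<^sub>0 r \<inter> \<Omega>) < ennreal (\<eta> * r)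
        \<longrightarrow> emeasure \<nu> (cball x\<^sub>0 (r / 2) \<inter> \<Omega>) = 0)"

definition concentration_set ::
    "(real^2) set \<Rightarrow> (real^2) measure \<Rightarrow> real \<Rightarrow> (real^2) set" where
  "concentration_set \<Omega> \<nu> \<eta> = {x \<in> \<Omega>.
     Liminf (at_right 0) (\<lambda>r. emeasure \<nu> (cball x r \<inter> \<Omega>) / ennreal r) \<ge> ennreal \<eta>}"

section \<open>One-dimensional Hausdorff measure and regular points\<close>

text \<open>The covering sets are required to be bounded because \<^const>\<open>diameter\<close> is unspecified on
  unbounded sets. In dimension one the usual normalising constant is 1.\<close>

definition hausdorff1_pre :: "real \<Rightarrow> 'a::metric_space set \<Rightarrow> ennreal" where
  "hausdorff1_pre \<delta> A =
     (INF U\<in>{U::nat \<Rightarrow> 'a set. (\<forall>i. bounded (U i) \<and> diameter (U i) \<le> \<delta>) \<and> A \<subseteq> (\<Union>i. U i)}.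
        \<Sum>i. ennreal (diameter (U i)))"

definition hausdorff1 :: "'a::metric_space set \<Rightarrow> ennreal" where
  "hausdorff1 A = (SUP \<delta>\<in>{0<..}. hausdorff1_pre \<delta> A)"

definition double_cone :: "real^2 \<Rightarrow> real^2 \<Rightarrow> real \<Rightarrow> (real^2) set" where
  "double_cone x\<^sub>0 e \<theta> = {y. \<bar>perp e \<bullet> (y - x\<^sub>0)\<bar> \<le> tan \<theta> * \<bar>e \<bullet> (y - x\<^sub>0)\<bar>}"

definition tangent_vector :: "(real^2) set \<Rightarrow> real^2 \<Rightarrow> real^2 \<Rightarrow> bool" where
  "tangent_vector S x\<^sub>0 e \<longleftrightarrow> norm e = 1 \<and>
     (\<forall>\<theta>\<in>{0<..<pi/2}.
        ((\<lambda>r. hausdorff1 (S \<inter> (ball x\<^sub>0 r - double_cone x\<^sub>0 e \<theta>)) / ennreal r) \<longlongrightarrow> 0) (at_right 0))"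

definition regular_point :: "(real^2) set \<Rightarrow> real^2 \<Rightarrow> bool" where
  "regular_point S x\<^sub>0 \<longleftrightarrow> x\<^sub>0 \<in> S \<and>
     ((\<lambda>r. hausdorff1 (S \<inter> ball x\<^sub>0 r) / ennreal (2 * r)) \<longlongrightarrow> 1) (at_right 0) \<and>
     (\<exists>e. tangent_vector S x\<^sub>0 e)"

end

(* A point y of the concentration set S outside the cone, close to x0, has a disc of radius
   comparable to |y - x0| that avoids a narrower cone. The tangent condition makes the H^1-measure
   of S in this disc so small that some circle around y misses S, and by clearing-out and
   compactness nu vanishes on an annulus around that circle. It remains to see that an energy
   isolated by such an annulus is zero, since then y would not lie in S. Testing the equation with
   X . grad u, where X is a cut-off radial field (Pohozaev), bounds the integral of V(u)/eps inside
   by the energy in the annulus. Testing it with grad V(u) then bounds the gradient part by the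
   potential part: the Hessian of V is positive near the wells, and away from them |grad u| <= C/eps
   together with V >= c does the job.

   Both tests need interior regularity of weak solutions, uniformly in eps: |u| <= K (Kato's
   inequality for a convex function of |u|, the growth condition on V, and the mean value
   inequality) and |grad u| <= C/eps. All computations are carried out on mollifications of u,
   which solve a Poisson equation in the classical sense, and passed to the limit. *)

theory Submission
  imports Defs
begin

section \<open>Reduction to the vanishing of isolated energy\<close>

text \<open>The concentration set is not known to be connected, so a point of it outside the cone
  may have very little length of the set around it, and small length does not by itself make \<nu>
  small there. Only isolation can be exploited: the distance to y is 1-Lipschitz, so the radii whose
  circles meet the set have Lebesgue measure at most the H^1 measure of the set in the disc, and a
  free radius remains. The order of the two tests reflects dimension two. Dilations leave the
  Dirichlet integral invariant, so the Pohozaev multiplier sees only the potential inside the disc,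
  and the gradient part needs a second multiplier. The annulus term of that second test carries a
  factor sqrt eps, which disappears in the limit. Constants may depend on the disc, the annulus and
  the energy bound, but not on eps. This is why the gradient is bounded at scale eps, where the size
  of u and the size of its Laplacian contribute equally.\<close>

lemma hausdorff1_mono:
  assumes "A \<subseteq> B" shows "hausdorff1 A \<le> hausdorff1 B"
  unfolding hausdorff1_def hausdorff1_pre_def
  by (intro SUP_mono' INF_superset_mono) (use assms in auto)

text \<open>The interval from \<open>Inf U\<close> to \<open>Sup U\<close> is measurable even if
  \<open>U\<close> is not, and it is no longer than the diameter. This lets arbitrary Hausdorff
  coverings compete with Lebesgue measure on the line.\<close>

lemma emeasure_lborel_le_diameter:
  fixes U :: "real set"
  assumes "bounded U" "U \<noteq> {}"
  shows "\<exists>J. U \<subseteq> J \<and> J \<in> sets borel \<and> emeasure lborel J \<le> ennreal (diameter U)"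
proof (intro exI conjI)
  have b: "bdd_below U" "bdd_above U" using assms by (auto simp: bounded_imp_bdd_below bounded_imp_bdd_above)
  show "U \<subseteq> {Inf U..Sup U}" using b by (auto intro: cInf_lower cSup_upper)
  show "{Inf U..Sup U} \<in> sets borel" by simp
  have "Sup U - Inf U \<le> diameter U"
  proof -
    have "x \<le> Inf U + diameter U" if "x \<in> U" for x
    proof -
      have "x - diameter U \<le> Inf U"
      proof (rule cInf_greatest[OF assms(2)])
        fix y assume "y \<in> U"
        then show "x - diameter U \<le> y"
          using diameter_bounded_bound[OF assms(1) that, of y] by (auto simp: dist_real_def)
      qed
      then show ?thesis by simp
    qed
    then have "Sup U \<le> Inf U + diameter U" using assms(2) by (intro cSup_least) auto
    then show ?thesis by simp
  qed
  moreover have "Inf U \<le> Sup U" using assms b by (meson cInf_le_cSup)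
  ultimately show "emeasure lborel {Inf U..Sup U} \<le> ennreal (diameter U)" by (simp add: ennreal_leI)
qed

text \<open>If every radius below \<open>c\<close> were attained, the images of a covering under the
  1-Lipschitz map \<open>dist p\<close> would cover an interval of length \<open>c\<close>, although
  the diameters in the covering sum to less than \<open>c\<close>.\<close>

lemma circle_avoiding_set:
  fixes S :: "(real^2) set"
  assumes "hausdorff1 (S \<inter> ball p c) < ennreal c" "c > 0"
  shows "\<exists>s. 0 < s \<and> s < c \<and> (\<forall>y\<in>S. dist p y \<noteq> s)"
proof (rule ccontr)
  assume "\<not> ?thesis"
  then have ex: "\<exists>y\<in>S. dist p y = s" if "0 < s" "s < c" for s using that by blast
  \<comment> \<open>Every pre-measure lies below the Hausdorff measure, so the covering scale is
    arbitrary; 1 is as good as any.\<close>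
  have "hausdorff1_pre 1 (S \<inter> ball p c) < ennreal c"
    using assms(1) unfolding hausdorff1_def
    by (rule le_less_trans[rotated]) (rule SUP_upper, simp)
  then obtain U where U: "\<And>i::nat. bounded (U i)" "S \<inter> ball p c \<subseteq> (\<Union>i. U i)"
    and sum: "(\<Sum>i. ennreal (diameter (U i))) < ennreal c"
    unfolding hausdorff1_pre_def INF_less_iff by auto
  have "\<exists>J. dist p ` U i \<subseteq> J \<and> J \<in> sets borel \<and> emeasure lborel J \<le> ennreal (diameter (U i))" for i
  proof (cases "U i = {}")
    case True then show ?thesis by (intro exI[of _ "{}"]) auto
  next
    case False
    have bd: "bounded (dist p ` U i)"
    proof -
      obtain R where "\<forall>y\<in>U i. dist p y \<le> R" using U(1)[of i] bounded_any_center by blast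
      then show ?thesis by (intro boundedI[of _ R]) auto
    qed
    have "diameter (dist p ` U i) \<le> diameter (U i)"
    proof (rule diameter_le)
      show "dist p ` U i \<noteq> {} \<or> 0 \<le> diameter (U i)" using False by simp
      fix x y assume "x \<in> dist p ` U i" "y \<in> dist p ` U i"
      then obtain a b where ab: "a \<in> U i" "b \<in> U i" "x = dist p a" "y = dist p b" by auto
      have "norm (x - y) \<le> dist a b" unfolding ab real_norm_def
        by (metis abs_dist_diff_le dist_commute)
      also have "\<dots> \<le> diameter (U i)" using diameter_bounded_bound[OF U(1) ab(1,2)] .
      finally show "norm (x - y) \<le> diameter (U i)" .
    qed
    then show ?thesis using emeasure_lborel_le_diameter[OF bd] False
      by (meson ennreal_leI image_is_empty order_trans)
  qed
  then obtain J where J: "\<And>i. dist p ` U i \<subseteq> J i" "\<And>i. J i \<in> sets borel"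
    "\<And>i. emeasure lborel (J i) \<le> ennreal (diameter (U i))" by metis
  have "{0<..<c} \<subseteq> (\<Union>i. J i)"
  proof
    fix s assume "s \<in> {0<..<c}"
    with ex obtain y where "y \<in> S" "dist p y = s" "s < c" by auto
    then have "y \<in> S \<inter> ball p c" by auto
    with U(2) obtain i where "y \<in> U i" by blast
    then show "s \<in> (\<Union>i. J i)" using J(1)[of i] \<open>dist p y = s\<close> by auto
  qed
  then have "emeasure lborel {0<..<c} \<le> emeasure lborel (\<Union>i. J i)"
    by (intro emeasure_mono) (use J in auto)
  also have "\<dots> \<le> (\<Sum>i. emeasure lborel (J i))"
    by (intro emeasure_subadditive_countably) (use J in auto)
  also have "\<dots> \<le> (\<Sum>i. ennreal (diameter (U i)))"
    by (intro suminf_le J) auto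
  finally show False using sum assms(2) by simp
qed

text \<open>The two-squares identity, with \<open>e\<close> and \<open>perp e\<close> as an
  orthonormal frame.\<close>

lemma inner_perp_sq:
  assumes "norm e = 1"
  shows "(norm v)\<^sup>2 = (e \<bullet> v)\<^sup>2 + (perp e \<bullet> v)\<^sup>2"
proof -
  have "(e$1)\<^sup>2 + (e$2)\<^sup>2 = 1" using assms by (simp add: norm_eq_1 inner_vec_def sum_2 power2_eq_square)
  then have "((e$1)\<^sup>2 + (e$2)\<^sup>2) * ((v$1)\<^sup>2 + (v$2)\<^sup>2) = (v$1)\<^sup>2 + (v$2)\<^sup>2" by simp
  then show ?thesis
    unfolding power2_norm_eq_inner
    by (simp add: inner_vec_def sum_2 perp_def power2_eq_square algebra_simps)
qed

text \<open>The constant \<open>c\<close> comes from comparing the slopes \<open>tan \<theta>\<close> and \<open>tan (\<theta>/2)\<close>.\<close>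

lemma ball_outside_cone:
  assumes e: "norm e = 1" and th: "0 < \<theta>" "\<theta> < pi/2"
  obtains c where "0 < c" "c \<le> 1"
    "\<And>x y. y \<notin> double_cone x e \<theta> \<Longrightarrow>
       ball y (c * dist x y) \<subseteq> ball x (2 * dist x y) - double_cone x e (\<theta>/2)"
proof
  define t where "t = tan \<theta>"
  define t' where "t' = tan (\<theta>/2)"
  have t': "0 < t'" unfolding t'_def using th by (intro tan_gt_zero) auto
  have tt: "t' < t" unfolding t'_def t_def using th by (intro tan_monotone) auto
  define c where "c = (t - t') / ((1 + t) * (1 + t'))"
  show c0: "0 < c" unfolding c_def using t' tt by auto
  show c1: "c \<le> 1" unfolding c_def using t' tt by (simp add: divide_simps algebra_simps)
  fix x y assume "y \<notin> double_cone x e \<theta>"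
  then have out: "\<bar>perp e \<bullet> (y - x)\<bar> > t * \<bar>e \<bullet> (y - x)\<bar>" by (simp add: double_cone_def t_def)
  define r where "r = dist x y"
  define P where "P = \<bar>perp e \<bullet> (y - x)\<bar>"
  define Q where "Q = \<bar>e \<bullet> (y - x)\<bar>"
  have rPQ: "r\<^sup>2 = Q\<^sup>2 + P\<^sup>2" unfolding r_def P_def Q_def
    using inner_perp_sq[OF e, of "y - x"] by (simp add: dist_norm norm_minus_commute)
  have "0 \<le> P" "0 \<le> Q" by (auto simp: P_def Q_def)
  have "r \<le> P + Q"
    by (rule power2_le_imp_le) (use \<open>0 \<le> P\<close> \<open>0 \<le> Q\<close> in \<open>auto simp: rPQ power2_sum\<close>)
  have PQ: "P > t * Q" using out by (simp add: P_def Q_def)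
  \<comment> \<open>Outside the cone the component \<open>P\<close> across the axis exceeds a fixed
    fraction of the distance \<open>r\<close>.\<close>
  have Pr: "t * r < (1 + t) * P"
  proof -
    have "t * r \<le> t * P + t * Q" using \<open>r \<le> P + Q\<close> t' tt
      by (metis distrib_left dual_order.strict_trans less_imp_le mult_left_mono)
    also have "\<dots> < (1 + t) * P" using PQ by (simp add: algebra_simps)
    finally show ?thesis .
  qed
  show "ball y (c * dist x y) \<subseteq> ball x (2 * dist x y) - double_cone x e (\<theta>/2)"
  proof
    fix z assume z: "z \<in> ball y (c * dist x y)"
    then have zy: "norm (z - y) < c * r" by (simp add: r_def dist_norm norm_minus_commute)
    have "c * r \<le> r" using c1 c0 unfolding r_def by (simp add: mult_left_le_one_le)
    have "dist x z \<le> r + dist y z" unfolding r_def by (rule dist_triangle)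
    then have in2: "z \<in> ball x (2 * dist x y)" using zy \<open>c * r \<le> r\<close>
      unfolding mem_ball r_def[symmetric] by (simp add: dist_norm[of y z] norm_minus_commute)
    have ez: "\<bar>e \<bullet> (z - x)\<bar> \<le> Q + norm (z - y)" "P - norm (z - y) \<le> \<bar>perp e \<bullet> (z - x)\<bar>"
    proof -
      have n: "\<bar>e \<bullet> (z - y)\<bar> \<le> norm (z - y)" using Cauchy_Schwarz_ineq2[of e "z - y"] e by simp
      have n2: "\<bar>perp e \<bullet> (z - y)\<bar> \<le> norm (z - y)"
      proof -
        have "(perp e \<bullet> (z - y))\<^sup>2 \<le> (norm (z - y))\<^sup>2"
          unfolding inner_perp_sq[OF e] by simp
        then show ?thesis using abs_le_square_iff[of "perp e \<bullet> (z - y)" "norm (z - y)"] by simp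
      qed
      have i: "v \<bullet> (z - x) = v \<bullet> (z - y) + v \<bullet> (y - x)" for v by (simp add: inner_diff_right)
      show "\<bar>e \<bullet> (z - x)\<bar> \<le> Q + norm (z - y)" using n i[of e] unfolding Q_def by linarith
      show "P - norm (z - y) \<le> \<bar>perp e \<bullet> (z - x)\<bar>" using n2 i[of "perp e"] unfolding P_def by linarith
    qed
    have "t' * Q \<le> t' * (P / t)"
      using PQ t' tt by (intro mult_left_mono) (auto simp: divide_simps mult.commute)
    \<comment> \<open>Replacing \<open>y\<close> by \<open>z\<close> changes \<open>P\<close> and
      \<open>Q\<close> by less than \<open>c * r\<close> each, hence \<open>P - t' * Q\<close> by
      less than \<open>(1 + t') * (c * r)\<close>. This margin keeps \<open>z\<close> outside the
      narrower cone.\<close>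
    have key: "(1 + t') * (c * r) \<le> P - t' * Q"
    proof -
      have "(1 + t') * (c * r) = (t - t') * r / (1 + t)"
        unfolding c_def using t' tt by (simp add: divide_simps)
      also have "\<dots> = (t - t') / t * (t * r / (1 + t))" using t' tt by (simp add: divide_simps)
      also have "\<dots> \<le> (t - t') / t * P"
        using Pr t' tt by (intro mult_left_mono) (auto simp: divide_simps algebra_simps)
      also have "\<dots> = P - t' * (P / t)" using t' tt by (simp add: divide_simps algebra_simps)
      also have "\<dots> \<le> P - t' * Q" using \<open>t' * Q \<le> _\<close> by simp
      finally show ?thesis .
    qed
    have "t' * \<bar>e \<bullet> (z - x)\<bar> \<le> t' * (Q + norm (z - y))" using ez t' by (intro mult_left_mono) auto
    also have "\<dots> < t' * Q + t' * (c * r)" using zy t' by (simp add: algebra_simps)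
    also have "\<dots> \<le> P - c * r" using key by (simp add: algebra_simps)
    also have "\<dots> < \<bar>perp e \<bullet> (z - x)\<bar>" using ez zy by linarith
    finally have "z \<notin> double_cone x e (\<theta>/2)" by (simp add: double_cone_def t'_def)
    with in2 show "z \<in> ball x (2 * dist x y) - double_cone x e (\<theta>/2)" by simp
  qed
qed


section \<open>Mass near concentration points, null discs elsewhere, and the cone argument\<close>

lemma cball_Int_in_sets:
  assumes "sets \<nu> = sets (restrict_space borel \<Omega>)"
  shows "cball x a \<inter> \<Omega> \<in> sets \<nu>"
  unfolding assms sets_restrict_space by (auto simp: image_iff intro!: bexI[of _ "cball x a"])

text \<open>A positive lower density forces positive mass in some disc of radius below
  \<open>a\<close>, and monotonicity passes it on to radius \<open>a\<close>.\<close>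

lemma concentration_set_positive:
  assumes "\<eta> > 0" "sets \<nu> = sets (restrict_space borel \<Omega>)"
    and "x \<in> concentration_set \<Omega> \<nu> \<eta>" "a > 0"
  shows "emeasure \<nu> (cball x a \<inter> \<Omega>) > 0"
proof (rule ccontr)
  assume "\<not> ?thesis"
  then have z: "emeasure \<nu> (cball x a \<inter> \<Omega>) = 0" by simp
  have L: "ennreal \<eta> \<le> Liminf (at_right 0) (\<lambda>r. emeasure \<nu> (cball x r \<inter> \<Omega>) / ennreal r)"
    using assms(3) by (auto simp: concentration_set_def)
  have "\<forall>\<^sub>F r in at_right 0. 0 < emeasure \<nu> (cball x r \<inter> \<Omega>) / ennreal r"
    using L assms(1) unfolding le_Liminf_iff by (meson ennreal_less_zero_iff)
  moreover have "\<forall>\<^sub>F r in at_right 0. r \<in> {0<..<a}" using assms(4) by (rule eventually_at_right_real)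
  ultimately have "\<forall>\<^sub>F r in at_right (0::real). 0 < emeasure \<nu> (cball x r \<inter> \<Omega>) / ennreal r
      \<and> r \<in> {0<..<a}" by (rule eventually_conj)
  then obtain r where r: "0 < emeasure \<nu> (cball x r \<inter> \<Omega>) / ennreal r" "r \<in> {0<..<a}"
    using eventually_happens[of _ "at_right (0::real)"] trivial_limit_at_right_real by blast
  have "emeasure \<nu> (cball x r \<inter> \<Omega>) \<le> emeasure \<nu> (cball x a \<inter> \<Omega>)"
    using r by (intro emeasure_mono cball_Int_in_sets assms) auto
  then show False using r z by simp
qed

text \<open>A liminf below \<open>\<eta>\<close> supplies a radius, as small as desired, with too
  little mass; clearing-out then empties the disc of half that radius. A single radius
  suffices.\<close>

lemma not_concentrated_null_ball:
  assumes "\<eta> > 0" "open \<Omega>"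
    and clear: "\<And>y r. r > 0 \<Longrightarrow> ball y r \<subseteq> \<Omega> \<Longrightarrow> emeasure \<nu> (cball y r \<inter> \<Omega>) < ennreal (\<eta> * r) \<Longrightarrow>
       emeasure \<nu> (cball y (r / 2) \<inter> \<Omega>) = 0"
    and "y \<in> \<Omega>" "y \<notin> concentration_set \<Omega> \<nu> \<eta>"
  obtains r where "r > 0" "cball y r \<subseteq> \<Omega>" "emeasure \<nu> (cball y r) = 0"
proof -
  let ?f = "\<lambda>r. emeasure \<nu> (cball y r \<inter> \<Omega>) / ennreal r"
  obtain d where d: "d > 0" "ball y d \<subseteq> \<Omega>" using assms(2,4) openE by blast
  have "\<exists>r\<in>{0<..<d}. ?f r < ennreal \<eta>"
  proof (rule ccontr)
    assume "\<not> ?thesis"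
    then have "\<forall>r\<in>{0<..<d}. ennreal \<eta> \<le> ?f r" by (auto simp: not_less)
    moreover have "\<forall>\<^sub>F r in at_right 0. r \<in> {0<..<d}" using d(1) by (rule eventually_at_right_real)
    ultimately have "\<forall>\<^sub>F r in at_right 0. ennreal \<eta> \<le> ?f r" by (auto elim: eventually_mono)
    then have "ennreal \<eta> \<le> Liminf (at_right 0) ?f" by (rule Liminf_bounded)
    then show False using assms(4,5) by (simp add: concentration_set_def)
  qed
  then obtain r where r: "0 < r" "r < d" "?f r < ennreal \<eta>" by auto
  have "emeasure \<nu> (cball y r \<inter> \<Omega>) = ?f r * ennreal r"
    using r by (simp add: ennreal_divide_times ennreal_mult_divide_eq)
  also have "\<dots> < ennreal \<eta> * ennreal r"
    using r by (intro ennreal_mult_strict_right_mono) auto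
  finally have "emeasure \<nu> (cball y r \<inter> \<Omega>) < ennreal (\<eta> * r)"
    using assms(1) r by (simp add: ennreal_mult)
  moreover have "ball y r \<subseteq> \<Omega>" using d r by (auto intro: subset_trans)
  ultimately have "emeasure \<nu> (cball y (r / 2) \<inter> \<Omega>) = 0" using clear r by blast
  moreover have "cball y (r/2) \<subseteq> \<Omega>" using d r by (force simp: subset_iff)
  ultimately show ?thesis using that[of "r/2"] r by (simp add: Int_absorb2)
qed

text \<open>The differential equation enters only through \<open>clear\<close>, the clearing-out
  property, and \<open>iso\<close>, the vanishing of energy surrounded by a null annulus. What
  remains is plane geometry and measure theory.\<close>

lemma cone_containment:
  fixes \<nu> :: "(real^2) measure"
  assumes eta: "\<eta> > 0" and op: "open \<Omega>" and sets: "sets \<nu> = sets (restrict_space borel \<Omega>)"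
    and clear: "\<And>y r. r > 0 \<Longrightarrow> ball y r \<subseteq> \<Omega> \<Longrightarrow> emeasure \<nu> (cball y r \<inter> \<Omega>) < ennreal (\<eta> * r) \<Longrightarrow>
       emeasure \<nu> (cball y (r / 2) \<inter> \<Omega>) = 0"
    and iso: "\<And>p a b. 0 < a \<Longrightarrow> a < b \<Longrightarrow> cball p b \<subseteq> \<Omega> \<Longrightarrow> emeasure \<nu> (cball p b - ball p a) = 0 \<Longrightarrow>
       emeasure \<nu> (ball p a) = 0"
    and tang: "tangent_vector (concentration_set \<Omega> \<nu> \<eta>) x\<^sub>0 e"
    and x0: "x\<^sub>0 \<in> \<Omega>" and th: "0 < \<theta>" "\<theta> < pi / 2"
  shows "\<exists>R>0. \<forall>r. 0 < r \<and> r \<le> R \<longrightarrow> concentration_set \<Omega> \<nu> \<eta> \<inter> ball x\<^sub>0 r \<subseteq> double_cone x\<^sub>0 e \<theta>"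
proof -
  let ?S = "concentration_set \<Omega> \<nu> \<eta>"
  have null: "\<exists>r>0. cball z r \<subseteq> \<Omega> \<and> emeasure \<nu> (cball z r) = 0" if "z \<in> \<Omega>" "z \<notin> ?S" for z
  proof (rule not_concentrated_null_ball[OF eta op _ that])
    show "emeasure \<nu> (cball y (r / 2) \<inter> \<Omega>) = 0"
      if "0 < r" "ball y r \<subseteq> \<Omega>" "emeasure \<nu> (cball y r \<inter> \<Omega>) < ennreal (\<eta> * r)" for y r
      using clear that by blast
  qed blast
  have e: "norm e = 1" using tang by (simp add: tangent_vector_def)
  obtain c where c: "0 < c" "c \<le> 1" and cone: "\<And>x y. y \<notin> double_cone x e \<theta> \<Longrightarrow>
       ball y (c * dist x y) \<subseteq> ball x (2 * dist x y) - double_cone x e (\<theta>/2)"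
    using ball_outside_cone[OF e th] by blast
  \<comment> \<open>A null disc contains no concentration point in its interior, because such a
    point has mass in every disc around it. Hence the concentration set is relatively closed in
    \<open>\<Omega>\<close>.\<close>
  have opc: "open (\<Omega> - ?S)"
  proof (rule openI)
    fix y assume y: "y \<in> \<Omega> - ?S"
    then obtain r where r: "r > 0" "cball y r \<subseteq> \<Omega>" "emeasure \<nu> (cball y r) = 0" using null by blast
    have "z \<notin> ?S" if "z \<in> ball y r" for z
    proof
      assume z: "z \<in> ?S"
      define d where "d = (r - dist y z)/2"
      have d: "d > 0" using that by (simp add: d_def)
      have sub: "cball z d \<subseteq> cball y r"
      proof
        fix w assume "w \<in> cball z d"
        then have "dist y z + 2 * dist z w \<le> r" by (simp add: d_def field_simps)
        then show "w \<in> cball y r"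
          unfolding mem_cball using dist_triangle[of y w z] zero_le_dist[of z w] by linarith
      qed
      have "emeasure \<nu> (cball z d \<inter> \<Omega>) \<le> emeasure \<nu> (cball y r \<inter> \<Omega>)"
        using sub by (intro emeasure_mono cball_Int_in_sets sets) auto
      then show False using concentration_set_positive[OF eta sets z d] r by (simp add: Int_absorb2)
    qed
    then show "\<exists>e>0. ball y e \<subseteq> \<Omega> - ?S" using r by (intro exI[of _ r]) auto
  qed
  \<comment> \<open>The tangent condition is taken at half the angle, so that the disc given by
    \<open>cone\<close> lies in the region whose length is controlled. The threshold
    \<open>c/2\<close> below, at radius \<open>2 * \<rho>\<close>, yields the length bound
    \<open>c * \<rho>\<close>, which is the radius of that disc.\<close>
  have lim: "((\<lambda>r. hausdorff1 (?S \<inter> (ball x\<^sub>0 r - double_cone x\<^sub>0 e (\<theta>/2))) / ennreal r) \<longlongrightarrow> 0) (at_right 0)"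
    using tang th unfolding tangent_vector_def by auto
  then have "\<forall>\<^sub>F r in at_right 0.
      hausdorff1 (?S \<inter> (ball x\<^sub>0 r - double_cone x\<^sub>0 e (\<theta>/2))) / ennreal r < ennreal (c/2)"
    using c by (intro order_tendstoD(2)) auto
  then obtain b where b: "b > 0" "\<And>r. 0 < r \<Longrightarrow> r < b \<Longrightarrow>
      hausdorff1 (?S \<inter> (ball x\<^sub>0 r - double_cone x\<^sub>0 e (\<theta>/2))) / ennreal r < ennreal (c/2)"
    unfolding eventually_at_right_field by auto
  obtain d where d: "d > 0" "ball x\<^sub>0 d \<subseteq> \<Omega>" using op x0 openE by blast
  \<comment> \<open>The disc about \<open>x\<^sub>0\<close> whose radius is twice the distance of
    \<open>y\<close> must stay in the range of both \<open>b\<close> and \<open>d\<close>.\<close>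
  define R where "R = min b d / 2"
  have R: "R > 0" using b d by (simp add: R_def)
  have "y \<in> double_cone x\<^sub>0 e \<theta>" if y: "y \<in> ?S" "y \<in> ball x\<^sub>0 R" for y
  proof (rule ccontr)
    assume out: "y \<notin> double_cone x\<^sub>0 e \<theta>"
    define \<rho> where "\<rho> = dist x\<^sub>0 y"
    have "y \<noteq> x\<^sub>0" using out by (auto simp: double_cone_def)
    then have \<rho>: "\<rho> > 0" "2 * \<rho> < b" "2 * \<rho> < d" using y unfolding \<rho>_def R_def by auto
    note cn = cone[OF out, folded \<rho>_def]
    have "hausdorff1 (?S \<inter> ball y (c * \<rho>)) \<le> hausdorff1 (?S \<inter> (ball x\<^sub>0 (2*\<rho>) - double_cone x\<^sub>0 e (\<theta>/2)))"
      using cn by (intro hausdorff1_mono) auto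
    also have "\<dots> = hausdorff1 (?S \<inter> (ball x\<^sub>0 (2*\<rho>) - double_cone x\<^sub>0 e (\<theta>/2))) / ennreal (2*\<rho>) * ennreal (2*\<rho>)"
      using \<rho> by (simp add: ennreal_divide_times ennreal_mult_divide_eq)
    also have "\<dots> < ennreal (c/2) * ennreal (2*\<rho>)"
      using \<rho> by (intro ennreal_mult_strict_right_mono b(2)) auto
    also have "\<dots> = ennreal (c * \<rho>)" using c \<rho> by (simp add: ennreal_mult[symmetric])
    finally obtain s where s: "0 < s" "s < c * \<rho>" "\<And>z. z \<in> ?S \<Longrightarrow> dist y z \<noteq> s"
      using circle_avoiding_set[of ?S y "c * \<rho>"] c \<rho> by auto
    have inO: "ball y (c * \<rho>) \<subseteq> \<Omega>" using cn d \<rho> by (auto simp: subset_iff)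
    have sph: "sphere y s \<subseteq> \<Omega> - ?S" using s inO by (auto simp: subset_iff)
    \<comment> \<open>A compact circle has positive distance from the closed complement of
      \<open>\<Omega> - ?S\<close>, so the free circle thickens to a free annulus. Points of the
      annulus are compared with their radial projections to the circle.\<close>
    have "\<exists>a b. 0 < a \<and> a < b \<and> cball y b \<subseteq> \<Omega> \<and> cball y b - ball y a \<subseteq> \<Omega> - ?S"
    proof -
      have "closed (-(\<Omega> - ?S))" "sphere y s \<inter> -(\<Omega> - ?S) = {}" 
        using closed_Compl[OF opc] sph by blast+
      then obtain h where h: "h > 0" "\<And>v z. v \<in> sphere y s \<Longrightarrow> z \<in> -(\<Omega> - ?S) \<Longrightarrow> h \<le> dist v z"
        using separate_compact_closed[OF compact_sphere, of "-(\<Omega> - ?S)" y s] by metis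
      define k where "k = min h (min s (c * \<rho> - s)) / 2"
      have k: "0 < k" "k < h" "k < s" "s + k < c * \<rho>" using h s by (auto simp: k_def min_def field_simps)
      have "z \<in> \<Omega> - ?S" if "z \<in> cball y (s + k) - ball y (s - k)" for z
      proof (rule ccontr)
        assume z: "z \<notin> \<Omega> - ?S"
        define n where "n = norm (z - y)"
        have n: "s - k \<le> n" "n \<le> s + k" "n > 0"
          using that k by (auto simp: n_def dist_norm norm_minus_commute)
        define v where "v = y + (s / n) *\<^sub>R (z - y)"
        have "v \<in> sphere y s" using n s by (simp add: v_def dist_norm n_def)
        moreover have "dist v z < h"
        proof -
          have "v - z = (s / n - 1) *\<^sub>R (z - y)" by (simp add: v_def algebra_simps)
          then have "dist v z = \<bar>s / n - 1\<bar> * n" by (simp add: dist_norm n_def)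
          also have "\<dots> = \<bar>(s / n - 1) * n\<bar>" using n by (simp add: abs_mult)
          also have "(s / n - 1) * n = s - n" using n by (simp add: field_simps)
          finally show ?thesis using n k by auto
        qed
        ultimately show False using h(2)[of v z] z by auto
      qed
      then show ?thesis using k inO
        by (intro exI[of _ "s - k"] exI[of _ "s + k"]) (auto simp: subset_iff)
    qed
    then obtain a b where ab: "0 < a" "a < b" "cball y b \<subseteq> \<Omega>" "cball y b - ball y a \<subseteq> \<Omega> - ?S" by blast
    have "emeasure \<nu> (cball y b - ball y a) = 0"
    proof -
      let ?K = "cball y b - ball y a"
      have "\<exists>r. r > 0 \<and> cball z r \<subseteq> \<Omega> \<and> emeasure \<nu> (cball z r) = 0" if "z \<in> ?K" for z
      proof -
        have "z \<in> \<Omega>" "z \<notin> ?S" using subsetD[OF ab(4) that] by simp_all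
        then show ?thesis by (rule null)
      qed
      then obtain r where r: "\<And>z. z \<in> ?K \<Longrightarrow> r z > 0 \<and> cball z (r z) \<subseteq> \<Omega> \<and> emeasure \<nu> (cball z (r z)) = 0"
        by metis
      have "compact ?K" by (simp add: compact_diff)
      then obtain T where T: "T \<subseteq> ?K" "finite T" "?K \<subseteq> (\<Union>z\<in>T. ball z (r z))"
        by (rule compactE_image[of _ ?K "\<lambda>z. ball z (r z)"]) (use r in force)+
      have nullz: "cball z (r z) \<in> null_sets \<nu>" if "z \<in> ?K" for z
        using r[OF that] cball_Int_in_sets[OF sets, of z "r z"] by (auto simp: null_sets_def Int_absorb2)
      have "(\<Union>z\<in>T. cball z (r z)) \<in> null_sets \<nu>"
        using T nullz by (intro null_sets_UN' countable_finite) auto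
      moreover have "?K \<subseteq> (\<Union>z\<in>T. cball z (r z))" using T(3) by (rule order_trans) (intro UN_mono ball_subset_cball order_refl)
      ultimately have "emeasure \<nu> ?K \<le> 0"
        using emeasure_mono[of ?K "\<Union>z\<in>T. cball z (r z)" \<nu>] by (simp add: null_sets_def)
      then show ?thesis by simp
    qed
    then have z: "emeasure \<nu> (ball y a) = 0" using iso ab by blast
    have "emeasure \<nu> (cball y (a/2) \<inter> \<Omega>) \<le> emeasure \<nu> (ball y a)"
    proof (rule emeasure_mono)
      show "cball y (a/2) \<inter> \<Omega> \<subseteq> ball y a" using ab by auto
      have "ball y a \<subseteq> \<Omega>" using ab by (meson ball_subset_cball less_imp_le subset_ball subset_trans)
      then show "ball y a \<in> sets \<nu>" unfolding sets sets_restrict_space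
        by (auto simp: image_iff intro!: bexI[of _ "ball y a"])
    qed
    then show False using concentration_set_positive[OF eta sets y(1), of "a/2"] ab z by simp
  qed
  then show ?thesis using R by (intro exI[of _ R]) (auto dest: subset_ball)
qed

section \<open>A smooth bump and integration by parts in the plane\<close>

text \<open>The index \<open>m\<close> is there to close the family under differentiation;
  \<open>m = 0\<close> is the classical function exp(-1/t), extended by zero.\<close>

definition bumpg :: "nat \<Rightarrow> real \<Rightarrow> real" where
  "bumpg m t = (if 0 < t then exp (- (1 / t)) / t ^ m else 0)"

text \<open>Keeping the single term of degree \<open>m + 2\<close> of the exponential series at
  \<open>1 / t\<close> gives more than continuity at zero: the quadratic decay also makes the
  derivative vanish there.\<close>

lemma bumpg_bound: "\<bar>bumpg m t\<bar> \<le> fact (m + 2) * t\<^sup>2"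
proof (cases "0 < t")
  case True
  define N :: real where "N = fact (m + 2)"
  have N: "N > 0" by (simp add: N_def)
  have "(1 / t) ^ (m + 2) / N \<le> exp (1 / t)"
  proof -
    have "(1 / t) ^ (m + 2) / fact (m + 2) = (\<Sum>n\<in>{m + 2}. (1 / t) ^ n / fact n)" by simp
    also have "\<dots> \<le> (\<Sum>n. (1 / t) ^ n / fact n)"
      using summable_exp[of "1/t"] True by (intro sum_le_suminf) (auto simp: field_simps)
    also have "\<dots> = exp (1 / t)" by (simp add: exp_def field_simps)
    finally show ?thesis unfolding N_def .
  qed
  then have "(1 / t) ^ (m + 2) \<le> N * exp (1 / t)"
    using N by (simp only: pos_divide_le_eq mult.commute)
  then have "1 \<le> N * exp (1 / t) * t ^ (m + 2)"
    using True by (simp add: power_divide pos_divide_le_eq del: power_add power_Suc)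
  then have "1 * exp (- (1 / t)) \<le> N * exp (1 / t) * t ^ (m + 2) * exp (- (1 / t))"
    by (intro mult_right_mono) auto
  moreover have "N * exp (1 / t) * t ^ (m + 2) * exp (- (1 / t)) = N * t ^ (m + 2) * (exp (1 / t) * exp (- (1 / t)))"
    by (simp only: mult_ac)
  moreover have "exp (1 / t) * exp (- (1 / t)) = 1" by (simp add: exp_minus)
  ultimately have "exp (- (1 / t)) \<le> N * t ^ (m + 2)"
    by (simp only: mult_1 mult_1_right)
  then have "exp (- (1 / t)) / t ^ m \<le> N * t\<^sup>2"
    using True by (simp add: pos_divide_le_eq power_add power2_eq_square mult_ac)
  then show ?thesis using True by (simp add: bumpg_def N_def del: fact_Suc)
qed (simp add: bumpg_def)

lemma DERIV_bumpg: "(bumpg m has_real_derivative bumpg (m + 2) t - m * bumpg (m + 1) t) (at t)"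
proof -
  consider "t > 0" | "t < 0" | "t = 0" by linarith
  then show ?thesis
  proof cases
    case 1
    have "((\<lambda>t. exp (- (1 / t)) / t ^ m) has_real_derivative bumpg (m + 2) t - m * bumpg (m + 1) t) (at t)"
    proof -
      have "((\<lambda>t. exp (- (1 / t))) has_real_derivative exp (- (1 / t)) / t\<^sup>2) (at t)"
        using 1 by (auto intro!: derivative_eq_intros simp: field_simps power2_eq_square)
      from DERIV_divide[OF this DERIV_pow[of m t]] 1
      have "((\<lambda>t. exp (- (1 / t)) / t ^ m) has_real_derivative
          (exp (- (1 / t)) / t\<^sup>2 * t ^ m - exp (- (1 / t)) * (m * t ^ (m - Suc 0))) / (t ^ m * t ^ m)) (at t)"
        by simp
      then show ?thesis
        by (rule DERIV_cong) (use 1 in \<open>cases m; simp add: bumpg_def divide_simps power2_eq_square; simp add: algebra_simps\<close>)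
    qed
    moreover have "\<forall>\<^sub>F x in nhds t. x > 0" using 1 eventually_nhds_in_open[of "{0<..}" t] by simp
    ultimately show ?thesis
      by (subst DERIV_cong_ev[OF refl _ refl, where g="\<lambda>t. exp (- (1 / t)) / t ^ m"])
        (auto elim!: eventually_mono simp: bumpg_def)
  next
    case 2
    have ev: "\<forall>\<^sub>F x in nhds t. x < 0" using 2 eventually_nhds_in_open[of "{..<0}" t] by simp
    show ?thesis
      by (subst DERIV_cong_ev[OF refl _ refl, where g="\<lambda>t. 0"])
        (use ev 2 in \<open>auto elim!: eventually_mono simp: bumpg_def\<close>)
  next
    case 3
    have "((\<lambda>h. (bumpg m h - 0) / h) \<longlongrightarrow> 0) (at 0)"
    proof (rule Lim_null_comparison)
      show "\<forall>\<^sub>F h in at 0. norm ((bumpg m h - 0) / h) \<le> fact (m + 2) * \<bar>h\<bar>"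
      proof (rule eventually_mono[OF eventually_neq_at_within])
        fix h :: real assume "h \<noteq> 0"
        then show "norm ((bumpg m h - 0) / h) \<le> fact (m + 2) * \<bar>h\<bar>"
          using bumpg_bound[of m h] by (simp add: divide_simps power2_eq_square abs_mult_self_eq mult.assoc)
      qed
      show "((\<lambda>h::real. fact (m + 2) * \<bar>h\<bar>) \<longlongrightarrow> 0) (at 0)"
        by (auto intro!: tendsto_eq_intros)
    qed
    then have "(bumpg m has_real_derivative 0) (at 0)"
      by (simp add: has_field_derivative_iff bumpg_def)
    then show ?thesis unfolding 3 by (simp add: bumpg_def)
  qed
qed

text \<open>\<open>smooth\<close> asks for all iterated derivatives. A class that contains the
  kernels and is closed under directional derivatives delivers them by one induction on the order;
  sums, products and coordinates are in the class because the chain and product rules produce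
  them.\<close>

inductive bump_alg :: "('a::euclidean_space \<Rightarrow> real) \<Rightarrow> bool" where
  const: "bump_alg (\<lambda>x. c)"
| coord: "bump_alg (\<lambda>x. x \<bullet> b)"
| bump: "bump_alg (\<lambda>x. bumpg m (d - (x - a) \<bullet> (x - a)))"
| add: "bump_alg f \<Longrightarrow> bump_alg g \<Longrightarrow> bump_alg (\<lambda>x. f x + g x)"
| mult: "bump_alg f \<Longrightarrow> bump_alg g \<Longrightarrow> bump_alg (\<lambda>x. f x * g x)"

lemma bump_alg_derivative:
  "bump_alg f \<Longrightarrow> \<exists>f'. \<forall>x. (f has_derivative f' x) (at x) \<and> (\<forall>h. bump_alg (\<lambda>x. f' x h))"
proof (induction rule: bump_alg.induct)
  case (const c)
  show ?case by (intro exI[of _ "\<lambda>x h. 0"]) (auto intro: bump_alg.const)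
next
  case (coord b)
  show ?case
    by (intro exI[of _ "\<lambda>x h. h \<bullet> b"]) (auto intro!: bump_alg.const derivative_eq_intros)
next
  case (bump m d a)
  let ?g = "\<lambda>m x. bumpg m (d - (x - a) \<bullet> (x - a))"
  let ?f = "\<lambda>x h. (?g (m + 2) x + (- real m) * ?g (m + 1) x) * ((- 2) * (x \<bullet> h + - (a \<bullet> h)))"
  have D: "(?g m has_derivative ?f x) (at x)" for x
  proof -
    have "((\<lambda>x. d - (x - a) \<bullet> (x - a)) has_derivative (\<lambda>h. - 2 * ((x - a) \<bullet> h))) (at x)"
      by (auto intro!: derivative_eq_intros simp: inner_commute)
    from this DERIV_bumpg[of m "d - (x - a) \<bullet> (x - a)"]
    have "(?g m has_derivative (\<lambda>h. - 2 * ((x - a) \<bullet> h) * (?g (m + 2) x - m * ?g (m + 1) x))) (at x)"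
      unfolding has_field_derivative_def
      by (rule has_derivative_compose[THEN has_derivative_eq_rhs]) auto
    then show ?thesis
      by (rule has_derivative_eq_rhs) (auto simp: algebra_simps inner_diff_left)
  qed
  have "bump_alg (\<lambda>x. ?f x h)" for h
    by (intro bump_alg.mult bump_alg.add bump_alg.bump bump_alg.const bump_alg.coord)
  with D show ?case by (intro exI[of _ ?f]) blast
next
  case (add f g)
  then obtain f' g' where D: "\<And>x. (f has_derivative f' x) (at x)" "\<And>x. (g has_derivative g' x) (at x)"
    "\<And>h. bump_alg (\<lambda>x. f' x h)" "\<And>h. bump_alg (\<lambda>x. g' x h)" by blast
  show ?case
    by (intro exI[of _ "\<lambda>x h. f' x h + g' x h"])
      (auto intro!: D bump_alg.intros has_derivative_add)
next
  case (mult f g)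
  then obtain f' g' where D: "\<And>x. (f has_derivative f' x) (at x)" "\<And>x. (g has_derivative g' x) (at x)"
    "\<And>h. bump_alg (\<lambda>x. f' x h)" "\<And>h. bump_alg (\<lambda>x. g' x h)" by blast
  show ?case
    by (intro exI[of _ "\<lambda>x h. f x * g' x h + f' x h * g x"])
      (auto intro!: D bump_alg.intros mult has_derivative_mult)
qed

lemma bump_alg_smooth:
  assumes "bump_alg f" shows "smooth f"
proof -
  have "Ck k f" for k using assms
  proof (induction k arbitrary: f)
    case 0
    then obtain f' where "\<And>x. (f has_derivative f' x) (at x)" using bump_alg_derivative by blast
    then show ?case by (auto intro!: continuous_at_imp_continuous_on has_derivative_continuous)
  next
    case (Suc k)
    then obtain f' where D: "\<And>x. (f has_derivative f' x) (at x)" "\<And>h. bump_alg (\<lambda>x. f' x h)"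
      using bump_alg_derivative by blast
    have "frechet_derivative f (at x) = f' x" for x using D(1) frechet_derivative_at by metis
    then show ?case using D Suc.IH by (auto simp: differentiable_on_def differentiable_def)
  qed
  then show ?thesis by (simp add: smooth_def)
qed

section \<open>Functions on the plane with named partial derivatives, and integration by
  parts\<close>

text \<open>Total differentiability is stated, but the partial derivatives are carried along as
  data. Second-order expressions can then be written by applying the predicate once more to each
  \<open>f' i\<close>.\<close>

definition has_partials :: "(real^2 \<Rightarrow> 'b::real_normed_vector) \<Rightarrow> (2 \<Rightarrow> real^2 \<Rightarrow> 'b) \<Rightarrow> bool" where
  "has_partials f f' \<longleftrightarrow> (\<forall>x. (f has_derivative (\<lambda>h. h$1 *\<^sub>R f' 1 x + h$2 *\<^sub>R f' 2 x)) (at x))"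

lemma has_partialsD:
  "has_partials f f' \<Longrightarrow> (f has_derivative (\<lambda>h. h$1 *\<^sub>R f' 1 x + h$2 *\<^sub>R f' 2 x)) (at x)"
  by (simp add: has_partials_def)

lemma has_partials_continuous: "has_partials f f' \<Longrightarrow> continuous_on A f"
  unfolding has_partials_def
  by (auto intro!: continuous_at_imp_continuous_on has_derivative_continuous)

lemma has_partials_along_axis:
  assumes "has_partials f f'"
  shows "((\<lambda>t. f (x + t *\<^sub>R axis i 1)) has_vector_derivative f' i (x + t *\<^sub>R axis i 1)) (at t)"
proof -
  have "((\<lambda>t. x + t *\<^sub>R axis i 1) has_derivative (\<lambda>s. s *\<^sub>R axis i 1)) (at t)"
    by (auto intro!: derivative_eq_intros)
  from has_derivative_compose[OF this has_partialsD[OF assms]]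
  have "((\<lambda>t. f (x + t *\<^sub>R axis i 1)) has_derivative
     (\<lambda>s. (s *\<^sub>R axis i 1)$1 *\<^sub>R f' 1 (x + t *\<^sub>R axis i 1) + (s *\<^sub>R axis i 1)$2 *\<^sub>R f' 2 (x + t *\<^sub>R axis i 1))) (at t)" .
  then show ?thesis unfolding has_vector_derivative_def
    by (rule has_derivative_eq_rhs) (use exhaust_2[of i] in \<open>auto simp: axis_def\<close>)
qed

lemma integrable_compact_support:
  fixes f :: "'a::euclidean_space \<Rightarrow> 'b::{banach, second_countable_topology}"
  assumes "continuous_on UNIV f" "\<And>x. x \<notin> cball p R \<Longrightarrow> f x = 0"
  shows "integrable lborel f"
proof -
  have "integrable lborel (\<lambda>x. indicator (cball p R) x *\<^sub>R f x)"
    using borel_integrable_compact[of "cball p R" f] assms(1) continuous_on_subset by auto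
  also have "(\<lambda>x. indicator (cball p R) x *\<^sub>R f x) = f"
    using assms(2) by (auto simp: indicator_def fun_eq_iff)
  finally show ?thesis .
qed

lemma bounded_compact_support:
  fixes f :: "'a::euclidean_space \<Rightarrow> 'b::real_normed_vector"
  assumes "continuous_on UNIV f" "\<And>x. x \<notin> cball p R \<Longrightarrow> f x = 0"
  obtains B where "\<And>x. norm (f x) \<le> B" "B \<ge> 0"
proof -
  have "bounded (f ` cball p R)"
    using assms(1) by (intro compact_imp_bounded compact_continuous_image) (auto intro: continuous_on_subset)
  then obtain B where "\<forall>y\<in>f ` cball p R. norm y \<le> B" unfolding bounded_iff by blast
  then have "norm (f x) \<le> max B 0" for x
    using assms(2)[of x] by (cases "x \<in> cball p R") (auto simp: le_max_iff_disj)
  then show ?thesis using that[of "max B 0"] by simp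
qed

lemma integral_translate:
  fixes f :: "'a::euclidean_space \<Rightarrow> 'b::{banach, second_countable_topology}"
  assumes [measurable]: "f \<in> borel_measurable borel"
  shows "(LINT x|lborel. f (x + a)) = (LINT x|lborel. f x)"
proof -
  have "(LINT x|lborel. f x) = (LINT x|distr lborel borel ((+) a). f x)" by (simp add: lborel_distr_plus)
  also have "\<dots> = (LINT x|lborel. f (a + x))" by (subst integral_distr) auto
  finally show ?thesis by (simp add: add.commute)
qed

lemma partials_support:
  fixes Z :: "real^2 \<Rightarrow> 'b::real_normed_vector"
  assumes Z: "has_partials Z Z'" and supp: "\<And>x. x \<notin> cball p R \<Longrightarrow> Z x = 0" and x: "x \<notin> cball p R"
  shows "Z' i x = 0"
proof -
  have "open (- cball p R)" by (simp add: open_Compl)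
  have "\<forall>\<^sub>F y in nhds x. y \<in> - cball p R" using x by (intro eventually_nhds_in_open) auto
  then have ev: "\<forall>\<^sub>F y in nhds x. Z y = (\<lambda>_. 0) y" by eventually_elim (use supp in auto)
  have "((\<lambda>_. 0) has_derivative (\<lambda>h. h$1 *\<^sub>R Z' 1 x + h$2 *\<^sub>R Z' 2 x)) (at x)"
    using has_partialsD[OF Z, of x] ev x supp
    by (intro has_derivative_transform_eventually[OF has_partialsD[OF Z, of x]])
      (auto simp: eventually_at_filter elim: eventually_mono)
  then have "(\<lambda>h::real^2. h$1 *\<^sub>R Z' 1 x + h$2 *\<^sub>R Z' 2 x) = (\<lambda>h. 0)"
    by (rule has_derivative_unique[OF _ has_derivative_const])
  from fun_cong[OF this, of "axis i 1"] show ?thesis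
    using exhaust_2[of i] by (auto simp: axis_def)
qed

text \<open>Difference quotients of \<open>Z\<close> integrate to zero by translation invariance. By
  the mean value theorem they are values of \<open>Z' i\<close>, hence bounded, and dominated
  convergence applies. All integral identities below rest on this form of the divergence
  theorem.\<close>

lemma integral_partial_zero:
  fixes Z :: "real^2 \<Rightarrow> real"
  assumes Z: "has_partials Z Z'" and c: "continuous_on UNIV (Z' i)"
    and supp: "\<And>x. x \<notin> cball p R \<Longrightarrow> Z x = 0"
  shows "(LINT x|lborel. Z' i x) = 0"
proof -
  have cZ: "continuous_on UNIV Z" using Z by (rule has_partials_continuous)
  have [measurable]: "Z \<in> borel_measurable borel" using cZ by (rule borel_measurable_continuous_onI)
  have [measurable]: "Z' i \<in> borel_measurable borel" using c by (rule borel_measurable_continuous_onI)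
  have iZ: "integrable lborel Z" using integrable_compact_support[OF cZ supp] .
  have supp': "Z' i x = 0" if "x \<notin> cball p R" for x
    by (rule partials_support[OF Z _ that]) (fact supp)
  obtain B where B: "\<And>x. norm (Z' i x) \<le> B" "B \<ge> 0"
    using bounded_compact_support[OF c supp'] by blast
  \<comment> \<open>Steps of length at most 1 keep all difference quotients supported in the disc of
    radius \<open>R + 1\<close>.\<close>
  define h where "h n = 1 / real (Suc n)" for n
  have h: "0 < h n" "h n \<le> 1" for n by (auto simp: h_def)
  have hne: "h n \<noteq> 0" for n using h(1)[of n] by simp
  have h0: "h \<longlonglongrightarrow> 0" unfolding h_def using LIMSEQ_inverse_real_of_nat by (simp add: inverse_eq_divide)
  define q where "q n x = (Z (x + h n *\<^sub>R axis i 1) - Z x) / h n" for n x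
  have "(\<lambda>n. LINT x|lborel. q n x) \<longlonglongrightarrow> (LINT x|lborel. Z' i x)"
  proof (rule integral_dominated_convergence)
    show "integrable lborel (\<lambda>x. indicator (cball p (R + 1)) x *\<^sub>R B)"
      by (intro integrable_real_indicator integrable_scaleR_left) 
        (use emeasure_bounded_finite[OF bounded_cball, of p "R + 1"] in auto)
    show "Z' i \<in> borel_measurable lborel" "\<And>n. q n \<in> borel_measurable lborel"
      unfolding q_def by measurable
    show "AE x in lborel. (\<lambda>n. q n x) \<longlonglongrightarrow> Z' i x"
    proof (rule AE_I2)
      fix x
      have "((\<lambda>t. Z (x + t *\<^sub>R axis i 1)) has_real_derivative Z' i x) (at 0)"
        using has_partials_along_axis[OF Z, of x i 0]
        by (simp add: has_real_derivative_iff_has_vector_derivative)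
      then have "((\<lambda>t. (Z (x + t *\<^sub>R axis i 1) - Z x) / t) \<longlongrightarrow> Z' i x) (at 0)"
        by (simp add: has_field_derivative_iff)
      from filterlim_compose[OF this, of h sequentially] show "(\<lambda>n. q n x) \<longlonglongrightarrow> Z' i x"
        using h0 hne unfolding q_def by (simp add: filterlim_at)
    qed
    show "AE x in lborel. norm (q n x) \<le> indicator (cball p (R + 1)) x *\<^sub>R B" for n
    proof (rule AE_I2)
      fix x
      show "norm (q n x) \<le> indicator (cball p (R + 1)) x *\<^sub>R B"
      proof (cases "x \<in> cball p (R + 1)")
        case True
        obtain t where "Z (x + h n *\<^sub>R axis i 1) - Z (x + 0 *\<^sub>R axis i 1) = (h n - 0) * Z' i (x + t *\<^sub>R axis i 1)"
          using MVT2[of 0 "h n" "\<lambda>t. Z (x + t *\<^sub>R axis i 1)" "\<lambda>t. Z' i (x + t *\<^sub>R axis i 1)"] h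
            has_partials_along_axis[OF Z] by (auto simp: has_real_derivative_iff_has_vector_derivative)
        then have "q n x = Z' i (x + t *\<^sub>R axis i 1)" using h[of n] unfolding q_def by simp
        then show ?thesis using B True by simp
      next
        case False
        have "dist p x \<le> dist p (x + h n *\<^sub>R axis i 1) + h n"
          using dist_triangle[of p x "x + h n *\<^sub>R axis i 1"] h[of n] by (simp add: dist_norm)
        then have "x + h n *\<^sub>R axis i 1 \<notin> cball p R" "x \<notin> cball p R" using False h[of n] by auto
        then show ?thesis using supp B(2) by (simp add: q_def)
      qed
    qed
  qed
  moreover have "(LINT x|lborel. q n x) = 0" for n
  proof -
    have i2: "integrable lborel (\<lambda>x. Z (x + h n *\<^sub>R axis i 1))"
    proof (rule integrable_compact_support[of _ p "R + 1"])
      show "continuous_on UNIV (\<lambda>x. Z (x + h n *\<^sub>R axis i 1))"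
        by (intro continuous_on_compose2[OF cZ] continuous_intros) auto
      fix x assume False: "x \<notin> cball p (R + 1)"
      have "dist p x \<le> dist p (x + h n *\<^sub>R axis i 1) + h n"
        using dist_triangle[of p x "x + h n *\<^sub>R axis i 1"] h[of n] by (simp add: dist_norm)
      then have "x + h n *\<^sub>R axis i 1 \<notin> cball p R" "x \<notin> cball p R" using False h[of n] by auto
      then show "Z (x + h n *\<^sub>R axis i 1) = 0" using supp by simp
    qed
    show ?thesis unfolding q_def using i2 iZ integral_translate[of Z "h n *\<^sub>R axis i 1"] by simp
  qed
  ultimately show ?thesis by (simp add: LIMSEQ_const_iff)
qed

text \<open>With \<open>F' 0 = 0\<close> the function continues to the left of zero as a constant
  without losing its derivative. Cut-offs of limited, but sufficient, smoothness are built this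
  way.\<close>

lemma DERIV_comp_max0:
  fixes F :: "real \<Rightarrow> real"
  assumes F: "\<And>t. t \<ge> 0 \<Longrightarrow> (F has_real_derivative F' t) (at t)" and "F' 0 = 0"
  shows "((\<lambda>t. F (max 0 t)) has_real_derivative F' (max 0 t)) (at t)"
proof -
  consider "t > 0" | "t < 0" | "t = 0" by linarith
  then show ?thesis
  proof cases
    case 1
    have ev: "\<forall>\<^sub>F x in nhds t. x > 0" using 1 eventually_nhds_in_open[of "{0<..}" t] by simp
    show ?thesis
      by (subst DERIV_cong_ev[OF refl _ refl, where g=F]) (use ev F[of t] 1 in \<open>auto elim!: eventually_mono\<close>)
  next
    case 2
    have ev: "\<forall>\<^sub>F x in nhds t. x < 0" using 2 eventually_nhds_in_open[of "{..<0}" t] by simp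
    show ?thesis
      by (subst DERIV_cong_ev[OF refl _ refl, where g="\<lambda>_. F 0"])
         (use ev assms(2) 2 in \<open>auto elim!: eventually_mono\<close>)
  next
    case 3
    have "((\<lambda>h. (F h - F 0) / h) \<longlongrightarrow> 0) (at 0)"
      using F[of 0] assms(2) by (simp add: has_field_derivative_iff)
    from tendsto_rabs_zero[OF this]
    have "((\<lambda>h. (F (max 0 h) - F 0) / h) \<longlongrightarrow> 0) (at 0)"
      by (rule Lim_null_comparison[rotated]) (auto simp: max_def divide_le_0_iff intro!: always_eventually)
    then show ?thesis using 3 assms(2) by (simp add: has_field_derivative_iff)
  qed
qed

section \<open>Mollification\<close>

definition ker_mass :: "real \<Rightarrow> real" where
  "ker_mass d = (LINT x|lborel. bumpg 0 (d\<^sup>2 - (x::real^2) \<bullet> x))"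

definition ker :: "real \<Rightarrow> real^2 \<Rightarrow> real" where
  "ker d x = bumpg 0 (d\<^sup>2 - x \<bullet> x) / ker_mass d"

text \<open>The partial derivatives of \<open>ker\<close>, written out with
  \<open>DERIV_bumpg\<close>: index 0 of the bump becomes 2, and index 2 becomes index 4 minus twice
  index 3. The explicit second-order formula makes the symmetry of the mixed derivatives
  visible.\<close>

definition ker' :: "real \<Rightarrow> 2 \<Rightarrow> real^2 \<Rightarrow> real" where
  "ker' d i x = - 2 * x$i * bumpg 2 (d\<^sup>2 - x \<bullet> x) / ker_mass d"

definition ker'' :: "real \<Rightarrow> 2 \<Rightarrow> 2 \<Rightarrow> real^2 \<Rightarrow> real" where
  "ker'' d i j x = (4 * x$i * x$j * (bumpg 4 (d\<^sup>2 - x \<bullet> x) - 2 * bumpg 3 (d\<^sup>2 - x \<bullet> x))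
      - (if i = j then 2 * bumpg 2 (d\<^sup>2 - x \<bullet> x) else 0)) / ker_mass d"

lemma continuous_on_bumpg [continuous_intros]:
  "continuous_on A f \<Longrightarrow> continuous_on A (\<lambda>x. bumpg m (f x))"
  by (rule continuous_on_compose2[of UNIV "bumpg m"])
    (auto intro!: continuous_at_imp_continuous_on DERIV_isCont[OF DERIV_bumpg])

lemma bumpg_nonneg: "0 \<le> bumpg m t" by (simp add: bumpg_def)

lemma bumpg_outside:
  assumes "(x::'a::real_inner) \<notin> ball 0 d" "d > 0" shows "bumpg m (d\<^sup>2 - x \<bullet> x) = 0"
proof -
  have "d\<^sup>2 \<le> (norm x)\<^sup>2" using assms by (intro power_mono) auto
  then show ?thesis by (simp add: bumpg_def power2_norm_eq_inner)
qed

lemma has_derivative_bumpg_inner: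
  "((\<lambda>x. bumpg m (d - (x::'a::real_inner) \<bullet> x)) has_derivative
     (\<lambda>h. (bumpg (m + 2) (d - x \<bullet> x) - m * bumpg (m + 1) (d - x \<bullet> x)) * (- 2 * (x \<bullet> h)))) (at x)"
proof -
  have "((\<lambda>x. d - x \<bullet> x) has_derivative (\<lambda>h. - 2 * (x \<bullet> h))) (at x)"
    by (auto intro!: derivative_eq_intros simp: inner_commute)
  from has_derivative_compose[OF this DERIV_bumpg[of m "d - x \<bullet> x", unfolded has_field_derivative_def]]
  show ?thesis by simp
qed

lemma inner_real2: "(x::real^2) \<bullet> h = x$1 * h$1 + x$2 * h$2"
  by (simp add: inner_vec_def sum_2)

lemma has_derivative_vec_nth': "((\<lambda>x::real^2. x$i) has_derivative (\<lambda>h. h$i)) (at x)"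
  by (rule bounded_linear_imp_has_derivative) (rule bounded_linear_vec_nth)

lemma has_partials_ker: "has_partials (ker d) (ker' d)"
  unfolding has_partials_def
proof
  fix x :: "real^2"
  have "((\<lambda>x. inverse (ker_mass d) * bumpg 0 (d\<^sup>2 - x \<bullet> x)) has_derivative (\<lambda>h. inverse (ker_mass d) *
     ((bumpg (0 + 2) (d\<^sup>2 - x \<bullet> x) - real 0 * bumpg (0 + 1) (d\<^sup>2 - x \<bullet> x)) * (- 2 * (x \<bullet> h))))) (at x)"
    by (intro has_derivative_mult_right has_derivative_bumpg_inner)
  then have "(ker d has_derivative (\<lambda>h. inverse (ker_mass d) *
     ((bumpg (0 + 2) (d\<^sup>2 - x \<bullet> x) - real 0 * bumpg (0 + 1) (d\<^sup>2 - x \<bullet> x)) * (- 2 * (x \<bullet> h))))) (at x)"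
    unfolding ker_def divide_inverse by (simp add: mult.commute)
  then show "(ker d has_derivative (\<lambda>h. h$1 *\<^sub>R ker' d 1 x + h$2 *\<^sub>R ker' d 2 x)) (at x)"
    by (rule has_derivative_eq_rhs)
      (auto simp: fun_eq_iff inner_real2 divide_inverse algebra_simps ker'_def numeral_eq_Suc)
qed

lemma has_partials_ker': "has_partials (ker' d i) (ker'' d i)"
  unfolding has_partials_def
proof
  fix x :: "real^2"
  let ?c = "-2 / ker_mass d"
  have "((\<lambda>x. ?c * (x$i * bumpg 2 (d\<^sup>2 - x \<bullet> x))) has_derivative (\<lambda>h. ?c * (x$i *
     ((bumpg (2 + 2) (d\<^sup>2 - x \<bullet> x) - real 2 * bumpg (2 + 1) (d\<^sup>2 - x \<bullet> x)) * (- 2 * (x \<bullet> h))) + h$i * bumpg 2 (d\<^sup>2 - x \<bullet> x)))) (at x)"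
    by (intro has_derivative_mult_right has_derivative_mult has_derivative_bumpg_inner has_derivative_vec_nth')
  then have "(ker' d i has_derivative (\<lambda>h. ?c * (x$i *
     ((bumpg (2 + 2) (d\<^sup>2 - x \<bullet> x) - real 2 * bumpg (2 + 1) (d\<^sup>2 - x \<bullet> x)) * (- 2 * (x \<bullet> h))) + h$i * bumpg 2 (d\<^sup>2 - x \<bullet> x)))) (at x)"
    unfolding ker'_def[abs_def] divide_inverse by (simp add: algebra_simps)
  then show "(ker' d i has_derivative (\<lambda>h. h$1 *\<^sub>R ker'' d i 1 x + h$2 *\<^sub>R ker'' d i 2 x)) (at x)"
    by (rule has_derivative_eq_rhs)
      (use exhaust_2[of i] in \<open>auto simp: fun_eq_iff inner_real2 divide_inverse algebra_simps ker''_def eval_nat_numeral\<close>)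
qed

lemma ker''_sym: "ker'' d i j = ker'' d j i"
  by (auto simp: ker''_def fun_eq_iff)

lemma continuous_ker:
  "continuous_on A (ker d)" "continuous_on A (ker' d i)" "continuous_on A (ker'' d i j)"
proof -
  show "continuous_on A (ker d)" by (rule has_partials_continuous[OF has_partials_ker])
  show "continuous_on A (ker' d i)" by (rule has_partials_continuous[OF has_partials_ker'])
  show "continuous_on A (ker'' d i j)"
    unfolding ker''_def divide_inverse by (cases "i = j"; simp; intro continuous_intros)
qed

lemma ker_outside:
  assumes "d > 0" "x \<notin> ball 0 d"
  shows "ker d x = 0" "ker' d i x = 0" "ker'' d i j x = 0"
  using bumpg_outside[OF assms(2,1)] by (auto simp: ker_def ker'_def ker''_def)

lemma ball_not_AE_avoided:
  assumes "d > 0" shows "\<not> (AE x in lborel. x \<notin> ball (0::'a::euclidean_space) d)"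
proof
  assume "AE x in lborel. x \<notin> ball (0::'a) d"
  then have "ball (0::'a) d \<in> null_sets lborel"
    by (subst (asm) AE_iff_null_sets[symmetric]) auto
  then have "negligible (ball (0::'a) d)"
    by (simp add: negligible_iff_null_sets null_sets_completionI)
  then show False using open_not_negligible[OF open_ball, of "0::'a" d] assms by auto
qed

lemma ker_mass_pos:
  assumes "d > 0" shows "ker_mass d > 0"
proof -
  let ?f = "\<lambda>x::real^2. bumpg 0 (d\<^sup>2 - x \<bullet> x)"
  have c: "continuous_on UNIV ?f" by (intro continuous_intros)
  have i: "integrable lborel ?f"
    by (rule integrable_compact_support[OF c, of 0 d]) (use assms in \<open>auto intro!: bumpg_outside\<close>)
  have "ker_mass d \<noteq> 0"
  proof
    assume "ker_mass d = 0"
    then have "AE x in lborel. ?f x = 0"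
      unfolding ker_mass_def by (subst (asm) integral_nonneg_eq_0_iff_AE[OF i]) (auto simp: bumpg_nonneg)
    then have "AE x in lborel. x \<notin> ball (0::real^2) d"
    proof eventually_elim
      case (elim x)
      have "\<not> x \<bullet> x < d\<^sup>2" using elim by (auto simp: bumpg_def split: if_splits)
      then have "d\<^sup>2 \<le> (norm x)\<^sup>2" by (simp add: power2_norm_eq_inner)
      then show ?case using assms by (simp add: abs_le_square_iff[symmetric])
    qed
    then show False using ball_not_AE_avoided[OF assms] by blast
  qed
  moreover have "ker_mass d \<ge> 0" unfolding ker_mass_def by (intro integral_nonneg_AE) (auto simp: bumpg_nonneg)
  ultimately show ?thesis by simp
qed

lemma ker_nonneg: "d > 0 \<Longrightarrow> ker d x \<ge> 0"
  using ker_mass_pos[of d] by (simp add: ker_def bumpg_nonneg)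

lemma integral_ker: "d > 0 \<Longrightarrow> (LINT x|lborel. ker d x) = 1"
  using ker_mass_pos[of d] unfolding ker_def by (simp add: ker_mass_def)

text \<open>Recentring the bump at \<open>x\<close> puts the translate into \<open>bump_alg\<close>.
  This is the smoothness that the weak formulations ask of a test function.\<close>

lemma smooth_ker_translate: "smooth (\<lambda>y. ker d (x - y))"
proof -
  have "bump_alg (\<lambda>y. inverse (ker_mass d) * bumpg 0 (d\<^sup>2 - (y - x) \<bullet> (y - x)))"
    by (intro bump_alg.intros)
  moreover have "(\<lambda>y. inverse (ker_mass d) * bumpg 0 (d\<^sup>2 - (y - x) \<bullet> (y - x))) = (\<lambda>y. ker d (x - y))"
    by (auto simp: ker_def fun_eq_iff divide_inverse inner_diff_left inner_diff_right algebra_simps)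
  ultimately show ?thesis using bump_alg_smooth by metis
qed

section \<open>Convolution with compactly supported kernels\<close>

definition conv :: "(real^2 \<Rightarrow> real) \<Rightarrow> (real^2 \<Rightarrow> 'b::euclidean_space) \<Rightarrow> real^2 \<Rightarrow> 'b" where
  "conv k g x = (LINT y|lborel. k (x - y) *\<^sub>R g y)"

lemma integrable_bounded_scaleR:
  fixes g :: "'a \<Rightarrow> 'b::{banach, second_countable_topology}"
  assumes "integrable M g" "k \<in> borel_measurable M" "\<And>x. \<bar>k x\<bar> \<le> B"
  shows "integrable M (\<lambda>x. k x *\<^sub>R g x)"
proof (rule Bochner_Integration.integrable_bound)
  show "integrable M (\<lambda>x. B *\<^sub>R norm (g x))" using assms(1) by (intro integrable_scaleR_right integrable_norm)
  show "(\<lambda>x. k x *\<^sub>R g x) \<in> borel_measurable M" using assms(1,2) by measurable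
  show "AE x in M. norm (k x *\<^sub>R g x) \<le> norm (B *\<^sub>R norm (g x))"
  proof (rule AE_I2)
    fix x
    have "\<bar>k x\<bar> * norm (g x) \<le> B * norm (g x)" using assms(3)[of x] by (rule mult_right_mono) simp
    also have "\<dots> \<le> \<bar>B * norm (g x)\<bar>" by simp
    finally show "norm (k x *\<^sub>R g x) \<le> norm (B *\<^sub>R norm (g x))" by simp
  qed
qed

lemma integrable_conv_kernel:
  fixes g :: "real^2 \<Rightarrow> 'b::euclidean_space"
  assumes "integrable lborel g" "continuous_on UNIV k" "\<And>z. z \<notin> cball 0 R \<Longrightarrow> k z = 0"
  shows "integrable lborel (\<lambda>y. k (x - y) *\<^sub>R g y)"
proof -
  obtain B where B: "\<And>x. norm (k x) \<le> B" using bounded_compact_support[OF assms(2,3)] by blast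
  have [measurable]: "k \<in> borel_measurable borel" using assms(2) by (rule borel_measurable_continuous_onI)
  show ?thesis by (rule integrable_bounded_scaleR[OF assms(1), of _ B]) (use B in auto)
qed

lemma scaleR_combine:
  "a *\<^sub>R g - b *\<^sub>R g - (s *\<^sub>R (c *\<^sub>R g) + t *\<^sub>R (d *\<^sub>R g)) = (a - b - (s * c + t * d)) *\<^sub>R (g::'a::real_vector)"
  by (simp add: scaleR_diff_left scaleR_add_left)

text \<open>All derivatives fall on the kernel. Its first-order remainder, divided by the length of
  the increment, tends to zero pointwise and is bounded through the Lipschitz constant
  \<open>L\<close>, so dominated convergence works with \<open>g\<close> merely integrable.\<close>

lemma conv_has_partials:
  fixes g :: "real^2 \<Rightarrow> 'b::euclidean_space"
  assumes k: "has_partials k k'" and c: "\<And>i. continuous_on UNIV (k' i)"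
    and supp: "\<And>z. z \<notin> cball 0 R \<Longrightarrow> k z = 0" and g: "integrable lborel g"
  shows "has_partials (conv k g) (\<lambda>i. conv (k' i) g)"
  unfolding has_partials_def
proof
  fix x :: "real^2"
  have supp': "k' i x = 0" if "x \<notin> cball 0 R" for x i
    by (rule partials_support[OF k _ that]) (fact supp)
  have ck: "continuous_on UNIV k" using k by (rule has_partials_continuous)
  have [measurable]: "k \<in> borel_measurable borel" using ck by (rule borel_measurable_continuous_onI)
  have [measurable]: "k' i \<in> borel_measurable borel" for i using c by (rule borel_measurable_continuous_onI)
  have ik: "integrable lborel (\<lambda>y. k (x - y) *\<^sub>R g y)" for x
    by (rule integrable_conv_kernel[OF g ck]) (fact supp)
  have ik': "integrable lborel (\<lambda>y. k' i (x - y) *\<^sub>R g y)" for x i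
    by (rule integrable_conv_kernel[OF g c]) (fact supp')
  obtain B1 B2 where B: "\<And>x. norm (k' 1 x) \<le> B1" "B1 \<ge> 0" "\<And>x. norm (k' 2 x) \<le> B2" "B2 \<ge> 0"
    using bounded_compact_support[OF c supp'] by metis
  define L where "L = B1 + B2"
  have lin: "\<bar>h$1 * k' 1 z + h$2 * k' 2 z\<bar> \<le> L * norm h" for h :: "real^2" and z
  proof -
    have "\<bar>h$1 * k' 1 z + h$2 * k' 2 z\<bar> \<le> \<bar>h$1\<bar> * \<bar>k' 1 z\<bar> + \<bar>h$2\<bar> * \<bar>k' 2 z\<bar>"
      by (metis abs_mult abs_triangle_ineq)
    also have "\<dots> \<le> norm h * B1 + norm h * B2"
      using B component_le_norm_cart[of h] by (intro add_mono mult_mono) auto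
    finally show ?thesis by (simp add: L_def algebra_simps)
  qed
  have Lip: "\<bar>k (z + h) - k z\<bar> \<le> L * norm h" for z h
  proof -
    have "norm (k (z + h) - k z) \<le> L * norm (z + h - z)"
      by (rule differentiable_bound[OF convex_UNIV, of k "\<lambda>z h. h$1 *\<^sub>R k' 1 z + h$2 *\<^sub>R k' 2 z"])
        (use has_partialsD[OF k] lin in \<open>auto intro!: onorm_le\<close>)
    then show ?thesis by simp
  qed
  let ?D = "\<lambda>h. h$1 *\<^sub>R conv (k' 1) g x + h$2 *\<^sub>R conv (k' 2) g x"
  show "(conv k g has_derivative ?D) (at x)"
    unfolding has_derivative_at
  proof
    show "bounded_linear ?D"
      by (intro bounded_linear_add bounded_linear_scaleR_const bounded_linear_vec_nth)
    show "((\<lambda>h. norm (conv k g (x + h) - conv k g x - ?D h) / norm h) \<longlongrightarrow> 0) (at 0)"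
      unfolding tendsto_at_iff_sequentially
    proof (intro allI impI)
      fix X :: "nat \<Rightarrow> real^2" assume X: "\<forall>i. X i \<in> UNIV - {0}" "X \<longlonglongrightarrow> 0"
      define Q where "Q n y = (k (x + X n - y) - k (x - y) - (X n$1 * k' 1 (x - y) + X n$2 * k' 2 (x - y))) / norm (X n)" for n y
      have eq: "(conv k g (x + X n) - conv k g x - ?D (X n)) /\<^sub>R norm (X n) = (LINT y|lborel. Q n y *\<^sub>R g y)" for n
      proof -
        have "conv k g (x + X n) - conv k g x - ?D (X n) = (LINT y|lborel. k (x + X n - y) *\<^sub>R g y - k (x - y) *\<^sub>R g y
            - (X n$1 *\<^sub>R (k' 1 (x - y) *\<^sub>R g y) + X n$2 *\<^sub>R (k' 2 (x - y) *\<^sub>R g y)))"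
          unfolding conv_def
          by (subst Bochner_Integration.integral_diff Bochner_Integration.integral_add integral_scaleR_right;
              (intro Bochner_Integration.integrable_diff Bochner_Integration.integrable_add integrable_scaleR_right ik ik')?)+ simp
        then have "(conv k g (x + X n) - conv k g x - ?D (X n)) /\<^sub>R norm (X n) =
            (LINT y|lborel. inverse (norm (X n)) *\<^sub>R (k (x + X n - y) *\<^sub>R g y - k (x - y) *\<^sub>R g y
            - (X n$1 *\<^sub>R (k' 1 (x - y) *\<^sub>R g y) + X n$2 *\<^sub>R (k' 2 (x - y) *\<^sub>R g y))))"
          by (simp only: integral_scaleR_right)
        also have "\<dots> = (LINT y|lborel. Q n y *\<^sub>R g y)"
          unfolding scaleR_combine Q_def by (simp only: scaleR_scaleR divide_inverse mult.commute)
        finally show ?thesis .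
      qed
      have "(\<lambda>n. LINT y|lborel. Q n y *\<^sub>R g y) \<longlonglongrightarrow> (LINT y|(lborel :: (real^2) measure). (0::'b))"
      proof (rule integral_dominated_convergence[where f="\<lambda>_. 0" and s="\<lambda>n y. Q n y *\<^sub>R g y" and w="\<lambda>y. (2 * L) *\<^sub>R norm (g y)"])
        show "(\<lambda>y. 0) \<in> borel_measurable lborel" by simp
        show "(\<lambda>y. Q n y *\<^sub>R g y) \<in> borel_measurable lborel" for n
          using g unfolding Q_def by measurable
        show "integrable lborel (\<lambda>y. (2 * L) *\<^sub>R norm (g y))" using g by (intro integrable_scaleR_right integrable_norm)
        show "AE y in lborel. norm (Q n y *\<^sub>R g y) \<le> (2 * L) *\<^sub>R norm (g y)" for n
        proof (rule AE_I2)
          fix y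
          have "\<bar>k (x + X n - y) - k (x - y) - (X n$1 * k' 1 (x - y) + X n$2 * k' 2 (x - y))\<bar> \<le> (2 * L) * norm (X n)"
            using Lip[of "x - y" "X n"] lin[of "X n" "x - y"] by (simp add: algebra_simps)
          then have "\<bar>Q n y\<bar> \<le> 2 * L" using X(1) unfolding Q_def by (simp add: pos_divide_le_eq)
          then show "norm (Q n y *\<^sub>R g y) \<le> (2 * L) *\<^sub>R norm (g y)" by (simp add: mult_right_mono)
        qed
        show "AE y in lborel. (\<lambda>n. Q n y *\<^sub>R g y) \<longlonglongrightarrow> 0"
        proof (rule AE_I2)
          fix y
          have "((\<lambda>h. norm (k ((x - y) + h) - k (x - y) - (h$1 *\<^sub>R k' 1 (x - y) + h$2 *\<^sub>R k' 2 (x - y))) / norm h) \<longlongrightarrow> 0) (at 0)"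
            using has_partialsD[OF k, of "x - y"] unfolding has_derivative_at by blast
          then have "(\<lambda>n. norm (k ((x - y) + X n) - k (x - y) - (X n$1 *\<^sub>R k' 1 (x - y) + X n$2 *\<^sub>R k' 2 (x - y))) / norm (X n)) \<longlonglongrightarrow> 0"
            using X unfolding tendsto_at_iff_sequentially comp_def by blast
          then have "(\<lambda>n. \<bar>Q n y\<bar>) \<longlonglongrightarrow> 0" unfolding Q_def by (simp add: algebra_simps abs_divide)
          then have "(\<lambda>n. Q n y) \<longlonglongrightarrow> 0" by (simp add: tendsto_rabs_zero_iff)
          then show "(\<lambda>n. Q n y *\<^sub>R g y) \<longlonglongrightarrow> 0" by (auto intro!: tendsto_eq_intros)
        qed
      qed
      then have "(\<lambda>n. norm ((conv k g (x + X n) - conv k g x - ?D (X n)) /\<^sub>R norm (X n))) \<longlonglongrightarrow> 0"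
        unfolding eq by (simp add: tendsto_norm_zero)
      then show "((\<lambda>h. norm (conv k g (x + h) - conv k g x - ?D h) / norm h) \<circ> X) \<longlonglongrightarrow> 0"
        by (simp add: comp_def divide_inverse mult.commute)
    qed
  qed
qed


lemma lborel_reflect: "lborel = distr lborel borel ((-) (x::'a::euclidean_space))"
  using lborel_affine[of "-1" x] by (simp add: density_1)

lemma integral_reflect:
  fixes f :: "real^2 \<Rightarrow> 'b::{banach, second_countable_topology}"
  assumes [measurable]: "f \<in> borel_measurable borel"
  shows "(LINT y|lborel. f (x - y)) = (LINT y|lborel. f y)"
proof -
  have "(LINT y|lborel. f y) = (LINT y|distr lborel borel ((-) x). f y)"
    by (simp flip: lborel_reflect)
  also have "\<dots> = (LINT y|lborel. f (x - y))"
    by (simp add: integral_distr)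
  finally show ?thesis by simp
qed

lemma integrable_reflect:
  fixes f :: "real^2 \<Rightarrow> 'b::{banach, second_countable_topology}"
  assumes "integrable lborel f"
  shows "integrable lborel (\<lambda>y. f (x - y))"
proof -
  have [measurable]: "f \<in> borel_measurable borel" using assms by auto
  have "integrable (distr lborel borel ((-) x)) f"
    using assms by (simp flip: lborel_reflect)
  then show ?thesis by (simp add: integrable_distr_eq)
qed

definition mollifier :: "real \<Rightarrow> (real^2 \<Rightarrow> real) \<Rightarrow> bool" where
  "mollifier d k \<longleftrightarrow> (\<forall>z. k z \<ge> 0) \<and> (LINT z|lborel. k z) = 1 \<and> continuous_on UNIV k \<and>
     (\<forall>z. z \<notin> cball 0 d \<longrightarrow> k z = 0)"

lemma mollifier_ker: "d > 0 \<Longrightarrow> mollifier d (ker d)"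
  unfolding mollifier_def
  by (auto simp: ker_nonneg integral_ker continuous_ker intro!: ker_outside)

text \<open>The convolution is an average of values of \<open>g\<close> over
  \<open>cball x d\<close>. An almost everywhere bound on \<open>g\<close> thus becomes a bound at
  the given point.\<close>

lemma norm_conv_le:
  assumes m: "mollifier d k" and g: "integrable lborel g"
    and b: "AE y in lborel. y \<in> cball x d \<longrightarrow> norm (g y) \<le> K" and K: "0 \<le> K"
  shows "norm (conv k g x) \<le> K"
proof -
  have k: "\<And>z. k z \<ge> 0" "(LINT z|lborel. k z) = 1" "continuous_on UNIV k" "\<And>z. z \<notin> cball 0 d \<Longrightarrow> k z = 0"
    using m unfolding mollifier_def by blast+
  have [measurable]: "k \<in> borel_measurable borel" using k(3) by (rule borel_measurable_continuous_onI)
  have i1: "integrable lborel (\<lambda>y. k (x - y))"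
    by (rule integrable_reflect[OF integrable_compact_support[OF k(3)]]) (fact k(4))
  have "norm (conv k g x) \<le> (LINT y|lborel. norm (k (x - y) *\<^sub>R g y))"
    unfolding conv_def by (rule integral_norm_bound)
  also have "\<dots> \<le> (LINT y|lborel. k (x - y) * K)"
  proof (rule integral_mono_AE)
    show "integrable lborel (\<lambda>y. norm (k (x - y) *\<^sub>R g y))"
      by (intro integrable_norm integrable_conv_kernel[OF g k(3)]) (fact k(4))
    show "integrable lborel (\<lambda>y. k (x - y) * K)" using i1 by simp
    show "AE y in lborel. norm (k (x - y) *\<^sub>R g y) \<le> k (x - y) * K"
      using b
    proof eventually_elim
      case (elim y)
      show ?case
      proof (cases "y \<in> cball x d")
        case True
        then show ?thesis using elim k(1) by (simp add: mult_left_mono)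
      next
        case False
        then have "k (x - y) = 0" by (intro k(4)) (simp add: dist_norm norm_minus_commute)
        then show ?thesis by simp
      qed
    qed
  qed
  also have "\<dots> = K" using k(2) integral_reflect[of k x] by simp
  finally show ?thesis .
qed

section \<open>Continuity of translations and convergence of mollifications in L^1\<close>

lemma nn_integral_translate:
  assumes [measurable]: "f \<in> borel_measurable borel"
  shows "(\<integral>\<^sup>+x. f (x - h) \<partial>lborel) = (\<integral>\<^sup>+x. f (x::'a::euclidean_space) \<partial>lborel)"
proof -
  have "(\<integral>\<^sup>+x. f x \<partial>lborel) = (\<integral>\<^sup>+x. f x \<partial>distr lborel borel ((+) (-h)))" by (simp add: lborel_distr_plus)
  also have "\<dots> = (\<integral>\<^sup>+x. f (x - h) \<partial>lborel)" by (simp add: nn_integral_distr)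
  finally show ?thesis by simp
qed

text \<open>Induction over integrable functions. An indicator is squeezed between a compact and an
  open set, and a small shift does not carry the compact set out of the open one. Sums and L^1
  limits preserve the property by the triangle inequality.\<close>

lemma translation_continuous_L1:
  fixes g :: "'a::euclidean_space \<Rightarrow> 'b::{banach, second_countable_topology}"
  assumes "integrable lborel g"
  shows "\<forall>e>0. \<exists>d>0. \<forall>h. norm h < d \<longrightarrow> (\<integral>\<^sup>+x. norm (g (x - h) - g x) \<partial>lborel) \<le> ennreal e"
  using assms
proof (induction rule: integrable_induct)
  case (base A c)
  show ?case
  proof (intro allI impI)
    fix e :: real assume e: "e > 0"
    \<comment> \<open>The factor 6 pays for two copies of the function \<open>B\<close> below, each
      of integral at most \<open>3 * e'\<close>; the added 1 avoids division by zero.\<close>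
    define e' where "e' = e / (norm c + 1) / 6"
    have e': "e' > 0" using e by (simp add: e'_def add_nonneg_pos)
    have Ab: "A \<in> sets lebesgue" "A \<in> sets borel" using base by auto
    obtain T where T: "open T" "A \<subseteq> T" "emeasure lebesgue (T - A) < ennreal e'"
      using sets_lebesgue_outer_open[OF Ab(1) e'] by metis
    obtain C where C: "closed C" "C \<subseteq> A" "emeasure lebesgue (A - C) < ennreal e'"
      using sets_lebesgue_inner_closed[OF Ab(1) e'] by metis
    have TA: "emeasure lborel (T - A) \<le> ennreal e'" "emeasure lborel (A - C) \<le> ennreal e'"
      using T C Ab by auto
    \<comment> \<open>Inner regularity has produced a closed set; cutting off at a large radius
      makes it compact.\<close>
    obtain R where R: "emeasure lborel (A - cball 0 R) \<le> ennreal e'"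
    proof -
      have "(\<lambda>n. emeasure lborel (A - cball 0 (real n))) \<longlonglongrightarrow> emeasure lborel (\<Inter>n. A - cball 0 (real n))"
      proof (rule Lim_emeasure_decseq)
        show "range (\<lambda>n. A - cball 0 (real n)) \<subseteq> sets lborel" using Ab by auto
        show "decseq (\<lambda>n. A - cball 0 (real n))" by (force simp: decseq_def)
        show "emeasure lborel (A - cball 0 (real n)) \<noteq> \<infinity>" for n
          using emeasure_mono[of "A - cball 0 (real n)" A lborel] base by auto
      qed
      moreover have "(\<Inter>n. A - cball 0 (real n)) = {}"
      proof -
        have "\<exists>n. x \<in> cball 0 (real n)" for x :: 'a using real_arch_simple[of "norm x"] by auto
        then show ?thesis by blast
      qed
      ultimately have "(\<lambda>n. emeasure lborel (A - cball 0 (real n))) \<longlonglongrightarrow> 0" by (simp only: emeasure_empty)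
      then have "\<forall>\<^sub>F n in sequentially. emeasure lborel (A - cball 0 (real n)) < ennreal e'"
        using e' by (intro order_tendstoD(2)) auto
      then obtain n where "emeasure lborel (A - cball 0 (real n)) < ennreal e'"
        using eventually_happens' sequentially_bot by blast
      then show ?thesis using that less_imp_le by blast
    qed
    define K where "K = C \<inter> cball 0 R"
    have "compact K" "K \<subseteq> A" "K \<subseteq> T" using C T by (auto simp: K_def closed_Int_compact)
    have Kb: "K \<in> sets borel" using \<open>compact K\<close> by (simp add: borel_compact)
    have AK: "emeasure lborel (A - K) \<le> ennreal (2 * e')"
    proof -
      have "emeasure lborel (A - K) \<le> emeasure lborel ((A - C) \<union> (A - cball 0 R))"
        using Ab C by (intro emeasure_mono) (auto simp: K_def)
      also have "\<dots> \<le> emeasure lborel (A - C) + emeasure lborel (A - cball 0 R)"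
        using Ab C by (intro emeasure_subadditive) auto
      also have "\<dots> \<le> ennreal e' + ennreal e'" by (intro add_mono TA R)
      finally show ?thesis using e' by (simp flip: ennreal_plus)
    qed
    obtain d where d: "d > 0" "(\<Union>x\<in>K. ball x d) \<subseteq> T"
      using compact_subset_open_imp_ball_epsilon_subset[OF \<open>compact K\<close> T(1) \<open>K \<subseteq> T\<close>] by blast
    show "\<exists>d>0. \<forall>h. norm h < d \<longrightarrow> (\<integral>\<^sup>+x. norm (indicator A (x - h) *\<^sub>R c - indicator A x *\<^sub>R c) \<partial>lborel) \<le> ennreal e"
    proof (intro exI[of _ d] conjI d(1) allI impI)
      fix h :: 'a assume h: "norm h < d"
      text \<open>Where the two indicators differ, one of \<open>x\<close>, \<open>x - h\<close> lies in \<open>T - A\<close> or in \<open>A - K\<close>.\<close>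
      define B where "B z = (indicator (T - A) z + indicator (A - K) z :: ennreal)" for z
      have TAs: "T - A \<in> sets borel" "A - K \<in> sets borel"
        using sets.Diff[OF borel_open[OF T(1)] Ab(2)] sets.Diff[OF Ab(2) Kb] by auto
      have Bm[measurable]: "B \<in> borel_measurable borel" unfolding B_def
        by (intro borel_measurable_add borel_measurable_indicator) (use TAs in auto)
      have intB: "(\<integral>\<^sup>+x. B x \<partial>lborel) \<le> ennreal (3 * e')"
      proof -
        have "(\<integral>\<^sup>+x. B x \<partial>lborel) = emeasure lborel (T - A) + emeasure lborel (A - K)"
          unfolding B_def using TAs by (simp add: nn_integral_add)
        also have "\<dots> \<le> ennreal e' + ennreal (2 * e')" by (intro add_mono TA AK)
        finally show ?thesis using e' by (simp flip: ennreal_plus)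
      qed
      have "ennreal (norm (indicator A (x - h) *\<^sub>R c - indicator A x *\<^sub>R c)) \<le> ennreal (norm c) * (B (x - h) + B x)" for x
      proof -
        have "x \<in> ball (x - h) d" "x - h \<in> ball x d" using h by (auto simp: dist_norm)
        then have *: "x - h \<in> K \<Longrightarrow> x \<in> T" "x \<in> K \<Longrightarrow> x - h \<in> T"
          using d(2) by blast+
        have "1 \<le> B (x - h) + B x" if "(x - h \<in> A) \<noteq> (x \<in> A)"
        proof -
          have "1 \<le> B x \<or> 1 \<le> B (x - h)"
            using that * \<open>K \<subseteq> A\<close> unfolding B_def indicator_def by (auto split: if_splits)
          then show ?thesis by (metis add_increasing add_increasing2 zero_le)
        qed
        then have "ennreal (norm c) * 1 \<le> ennreal (norm c) * (B (x - h) + B x)" if "(x - h \<in> A) \<noteq> (x \<in> A)"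
          using that by (intro mult_left_mono) auto
        then show ?thesis by (cases "x - h \<in> A"; cases "x \<in> A") auto
      qed
      then have "(\<integral>\<^sup>+x. norm (indicator A (x - h) *\<^sub>R c - indicator A x *\<^sub>R c) \<partial>lborel)
          \<le> (\<integral>\<^sup>+x. ennreal (norm c) * (B (x - h) + B x) \<partial>lborel)"
        by (intro nn_integral_mono) auto
      also have "\<dots> = ennreal (norm c) * ((\<integral>\<^sup>+x. B (x - h) \<partial>lborel) + (\<integral>\<^sup>+x. B x \<partial>lborel))"
        by (simp add: nn_integral_cmult nn_integral_add)
      also have "\<dots> \<le> ennreal (norm c) * (ennreal (3 * e') + ennreal (3 * e'))"
        unfolding nn_integral_translate[OF Bm] by (intro mult_left_mono add_mono intB) auto
      also have "\<dots> = ennreal (norm c * (6 * e'))"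
      proof -
        have "ennreal (3 * e') + ennreal (3 * e') = ennreal (6 * e')"
          using e' by (subst ennreal_plus[symmetric]) auto
        then show ?thesis using e' by (simp only: ennreal_mult norm_ge_zero)
      qed
      also have "\<dots> \<le> ennreal e"
      proof (rule ennreal_leI)
        define q where "q = e / (norm c + 1)"
        have pos: "norm c + 1 > 0" by (simp add: add_nonneg_pos)
        then have q: "q * (norm c + 1) = e" "q > 0" using e by (simp_all add: q_def)
        have "norm c * (6 * e') = norm c * q" unfolding e'_def q_def[symmetric] by simp
        also have "\<dots> \<le> q * (norm c + 1)" using q(2) by (simp add: algebra_simps)
        finally show "norm c * (6 * e') \<le> e" unfolding q(1) .
      qed
      finally show "(\<integral>\<^sup>+x. norm (indicator A (x - h) *\<^sub>R c - indicator A x *\<^sub>R c) \<partial>lborel) \<le> ennreal e" .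
    qed
  qed
next
  case (add f g)
  have [measurable]: "f \<in> borel_measurable borel" "g \<in> borel_measurable borel" using add.hyps by auto
  show ?case
  proof (intro allI impI)
    fix e :: real assume "e > 0"
    then have "0 < e/2" by simp
    obtain d1 where d1: "d1 > 0" "\<And>h. norm h < d1 \<Longrightarrow> (\<integral>\<^sup>+x. norm (f (x - h) - f x) \<partial>lborel) \<le> ennreal (e/2)"
      using add.IH(1)[rule_format, OF \<open>0 < e/2\<close>] by blast
    obtain d2 where d2: "d2 > 0" "\<And>h. norm h < d2 \<Longrightarrow> (\<integral>\<^sup>+x. norm (g (x - h) - g x) \<partial>lborel) \<le> ennreal (e/2)"
      using add.IH(2)[rule_format, OF \<open>0 < e/2\<close>] by blast
    show "\<exists>d>0. \<forall>h. norm h < d \<longrightarrow> (\<integral>\<^sup>+x. norm (f (x - h) + g (x - h) - (f x + g x)) \<partial>lborel) \<le> ennreal e"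
    proof (intro exI[of _ "min d1 d2"] conjI allI impI)
      fix h :: 'a assume h: "norm h < min d1 d2"
      have "(\<integral>\<^sup>+x. norm (f (x - h) + g (x - h) - (f x + g x)) \<partial>lborel)
        \<le> (\<integral>\<^sup>+x. ennreal (norm (f (x - h) - f x)) + ennreal (norm (g (x - h) - g x)) \<partial>lborel)"
        by (intro nn_integral_mono) (simp add: norm_diff_triangle_ineq flip: ennreal_plus)
      also have "\<dots> = (\<integral>\<^sup>+x. norm (f (x - h) - f x) \<partial>lborel) + (\<integral>\<^sup>+x. norm (g (x - h) - g x) \<partial>lborel)"
        by (subst nn_integral_add) auto
      also have "\<dots> \<le> ennreal (e/2) + ennreal (e/2)" using h by (intro add_mono d1 d2) auto
      finally show "(\<integral>\<^sup>+x. norm (f (x - h) + g (x - h) - (f x + g x)) \<partial>lborel) \<le> ennreal e"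
        using \<open>e > 0\<close> by (simp flip: ennreal_plus)
    qed (use d1 d2 in auto)
  qed
next
  case (lim f s)
  have [measurable]: "f \<in> borel_measurable borel" "s i \<in> borel_measurable borel" for i using lim.hyps by auto
  show ?case
  proof (intro allI impI)
    fix e :: real assume e: "e > 0"
    have "(\<lambda>i. (\<integral>\<^sup>+x. norm (f x - s i x) \<partial>lborel)) \<longlonglongrightarrow> 0"
    proof (rule nn_integral_dominated_convergence_norm[where w="\<lambda>x. 2 * norm (f x)"])
      show "(\<integral>\<^sup>+x. ennreal (2 * norm (f x)) \<partial>lborel) < \<infinity>"
        using lim.hyps(4) by (simp add: ennreal_mult nn_integral_cmult integrable_iff_bounded ennreal_mult_less_top)
    qed (use lim.hyps in auto)
    then have "\<forall>\<^sub>F i in sequentially. (\<integral>\<^sup>+x. norm (f x - s i x) \<partial>lborel) < ennreal (e/3)"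
      using e by (intro order_tendstoD(2)) auto
    then obtain i where i: "(\<integral>\<^sup>+x. norm (f x - s i x) \<partial>lborel) < ennreal (e/3)"
      using eventually_happens' sequentially_bot by blast
    obtain d where d: "d > 0" "\<And>h. norm h < d \<Longrightarrow> (\<integral>\<^sup>+x. norm (s i (x - h) - s i x) \<partial>lborel) \<le> ennreal (e/3)"
      using lim.IH[of i, rule_format, of "e/3"] e by auto
    show "\<exists>d>0. \<forall>h. norm h < d \<longrightarrow> (\<integral>\<^sup>+x. norm (f (x - h) - f x) \<partial>lborel) \<le> ennreal e"
    proof (intro exI[of _ d] conjI allI impI d(1))
      fix h :: 'a assume h: "norm h < d"
      \<comment> \<open>The middle term is left to the induction hypothesis; the outer two have
        equal integrals by translation invariance.\<close>
      have tri: "norm (f (x - h) - f x) \<le> norm (f (x - h) - s i (x - h)) + norm (s i (x - h) - s i x) + norm (f x - s i x)" for x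
        by norm
      have "(\<integral>\<^sup>+x. norm (f (x - h) - f x) \<partial>lborel)
        \<le> (\<integral>\<^sup>+x. ennreal (norm (f (x - h) - s i (x - h))) + ennreal (norm (s i (x - h) - s i x)) + ennreal (norm (f x - s i x)) \<partial>lborel)"
        by (intro nn_integral_mono) (use tri in \<open>simp flip: ennreal_plus\<close>)
      also have "\<dots> = (\<integral>\<^sup>+x. norm (f (x - h) - s i (x - h)) \<partial>lborel) + (\<integral>\<^sup>+x. norm (s i (x - h) - s i x) \<partial>lborel)
           + (\<integral>\<^sup>+x. norm (f x - s i x) \<partial>lborel)"
        by (simp add: nn_integral_add)
      also have "(\<integral>\<^sup>+x. norm (f (x - h) - s i (x - h)) \<partial>lborel) = (\<integral>\<^sup>+x. norm (f x - s i x) \<partial>lborel)"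
        by (rule nn_integral_translate[of "\<lambda>x. ennreal (norm (f x - s i x))"]) simp
      also have "(\<integral>\<^sup>+x. norm (f x - s i x) \<partial>lborel) + (\<integral>\<^sup>+x. norm (s i (x - h) - s i x) \<partial>lborel)
           + (\<integral>\<^sup>+x. norm (f x - s i x) \<partial>lborel) \<le> ennreal (e/3) + ennreal (e/3) + ennreal (e/3)"
        using h i by (intro add_mono d) auto
      also have "\<dots> = ennreal e" using e by (simp flip: ennreal_plus)
      finally show "(\<integral>\<^sup>+x. norm (f (x - h) - f x) \<partial>lborel) \<le> ennreal e" .
    qed
  qed
qed

lemma conv_eq:
  fixes g :: "real^2 \<Rightarrow> 'b::euclidean_space"
  assumes [measurable]: "k \<in> borel_measurable borel" "g \<in> borel_measurable borel"
  shows "conv k g x = (LINT h|lborel. k h *\<^sub>R g (x - h))"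
  unfolding conv_def using integral_reflect[of "\<lambda>y. k (x - y) *\<^sub>R g y" x] by simp

text \<open>\<open>conv k g - g\<close> is an average, with weights \<open>k h\<close>, of the
  differences between the shifts of \<open>g\<close> and \<open>g\<close> itself. Tonelli moves the
  L^1 norm inside that average.\<close>

lemma conv_L1_close:
  fixes g :: "real^2 \<Rightarrow> 'b::euclidean_space"
  assumes m: "mollifier d k" and g: "integrable lborel g" and cg: "continuous_on UNIV (conv k g)"
    and close: "\<And>h. norm h \<le> d \<Longrightarrow> (\<integral>\<^sup>+x. norm (g (x - h) - g x) \<partial>lborel) \<le> ennreal e" and e: "e > 0"
  shows "integrable lborel (\<lambda>x. conv k g x - g x)" "(LINT x|lborel. norm (conv k g x - g x)) \<le> e"
proof -
  have k: "\<And>z. k z \<ge> 0" "(LINT z|lborel. k z) = 1" "continuous_on UNIV k" "\<And>z. z \<notin> cball 0 d \<Longrightarrow> k z = 0"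
    using m unfolding mollifier_def by blast+
  have [measurable]: "k \<in> borel_measurable borel" using k(3) by (rule borel_measurable_continuous_onI)
  have [measurable]: "g \<in> borel_measurable borel" using g by auto
  have cm[measurable]: "conv k g \<in> borel_measurable borel" using cg by (rule borel_measurable_continuous_onI)
  have ki: "integrable lborel k" by (rule integrable_compact_support[OF k(3)]) (fact k(4))
  have pt: "ennreal (norm (conv k g x - g x)) \<le> (\<integral>\<^sup>+h. ennreal (k h) * ennreal (norm (g (x - h) - g x)) \<partial>lborel)" for x
  proof -
    have i1: "integrable lborel (\<lambda>h. k h *\<^sub>R g (x - h))"
      using integrable_reflect[OF integrable_conv_kernel[OF g k(3), of d x], of x] k(4) by simp
    have i2: "integrable lborel (\<lambda>h. k h *\<^sub>R g x)" using ki by simp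
    have "conv k g x - g x = (LINT h|lborel. k h *\<^sub>R g (x - h)) - (LINT h|lborel. k h *\<^sub>R g x)"
      using k(2) ki by (simp add: conv_eq)
    also have "\<dots> = (LINT h|lborel. k h *\<^sub>R (g (x - h) - g x))"
      using i1 i2 by (simp add: scaleR_diff_right)
    finally have eq: "conv k g x - g x = (LINT h|lborel. k h *\<^sub>R (g (x - h) - g x))" .
    have "ennreal (norm (conv k g x - g x)) \<le> (\<integral>\<^sup>+h. norm (k h *\<^sub>R (g (x - h) - g x)) \<partial>lborel)"
      unfolding eq using i1 i2 by (intro integral_norm_bound_ennreal) (simp add: scaleR_diff_right)
    also have "\<dots> = (\<integral>\<^sup>+h. ennreal (k h) * ennreal (norm (g (x - h) - g x)) \<partial>lborel)"
      using k(1) by (intro nn_integral_cong) (simp add: ennreal_mult)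
    finally show ?thesis .
  qed
  have "(\<integral>\<^sup>+x. norm (conv k g x - g x) \<partial>lborel)
     \<le> (\<integral>\<^sup>+x. (\<integral>\<^sup>+h. ennreal (k h) * ennreal (norm (g (x - h) - g x)) \<partial>lborel) \<partial>lborel)"
    by (intro nn_integral_mono pt)
  also have "\<dots> = (\<integral>\<^sup>+h. (\<integral>\<^sup>+x. ennreal (k h) * ennreal (norm (g (x - h) - g x)) \<partial>lborel) \<partial>lborel)"
    by (rule lborel_pair.Fubini'[symmetric]) measurable
  also have "\<dots> = (\<integral>\<^sup>+h. ennreal (k h) * (\<integral>\<^sup>+x. ennreal (norm (g (x - h) - g x)) \<partial>lborel) \<partial>lborel)"
    by (intro nn_integral_cong nn_integral_cmult) measurable
  also have "\<dots> \<le> (\<integral>\<^sup>+h. ennreal (k h) * ennreal e \<partial>lborel)"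
  proof (intro nn_integral_mono)
    fix h
    show "ennreal (k h) * (\<integral>\<^sup>+x. ennreal (norm (g (x - h) - g x)) \<partial>lborel) \<le> ennreal (k h) * ennreal e"
      using close[of h] k(4)[of h] by (cases "norm h \<le> d") (auto intro: mult_left_mono)
  qed
  also have "\<dots> = (\<integral>\<^sup>+h. ennreal (k h) \<partial>lborel) * ennreal e" by (simp add: nn_integral_multc)
  also have "\<dots> = ennreal e" using k(1,2) ki by (simp add: nn_integral_eq_integral)
  finally have fin: "(\<integral>\<^sup>+x. norm (conv k g x - g x) \<partial>lborel) \<le> ennreal e" .
  show int: "integrable lborel (\<lambda>x. conv k g x - g x)"
    unfolding integrable_iff_bounded using fin by (auto intro: le_less_trans)
  show "(LINT x|lborel. norm (conv k g x - g x)) \<le> e"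
    using fin nn_integral_eq_integral[OF integrable_norm[OF int]] e by simp
qed

lemma conv_ker_has_partials:
  fixes g :: "real^2 \<Rightarrow> 'b::euclidean_space"
  assumes d: "d > 0" and g: "integrable lborel g"
  shows "has_partials (conv (ker d) g) (\<lambda>i. conv (ker' d i) g)"
    "has_partials (conv (ker' d i) g) (\<lambda>j. conv (ker'' d i j) g)"
proof -
  have s: "z \<notin> cball 0 d \<Longrightarrow> z \<notin> ball (0::real^2) d" for z by auto
  show "has_partials (conv (ker d) g) (\<lambda>i. conv (ker' d i) g)"
    by (rule conv_has_partials[OF has_partials_ker continuous_ker(2) _ g]) (use ker_outside[OF d s] in blast)
  show "has_partials (conv (ker' d i) g) (\<lambda>j. conv (ker'' d i j) g)"
    by (rule conv_has_partials[OF has_partials_ker' continuous_ker(3) _ g]) (use ker_outside[OF d s] in blast)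
qed

lemma isCont_conv:
  fixes g :: "real^2 \<Rightarrow> 'b::euclidean_space"
  assumes k: "continuous_on UNIV k" "\<And>z. z \<notin> cball 0 R \<Longrightarrow> k z = 0" and g: "integrable lborel g"
  shows "isCont (conv k g) x"
  unfolding continuous_at_sequentially
proof (intro allI impI)
  fix X :: "nat \<Rightarrow> real^2" assume X: "X \<longlonglongrightarrow> x"
  obtain B where B: "\<And>x. norm (k x) \<le> B" using bounded_compact_support[OF k] by blast
  have [measurable]: "k \<in> borel_measurable borel" using k(1) by (rule borel_measurable_continuous_onI)
  have [measurable]: "g \<in> borel_measurable borel" using g by auto
  show "(conv k g \<circ> X) \<longlonglongrightarrow> conv k g x"
    unfolding conv_def comp_def
  proof (rule integral_dominated_convergence[where w="\<lambda>y. B * norm (g y)"])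
    show "AE y in lborel. (\<lambda>n. k (X n - y) *\<^sub>R g y) \<longlonglongrightarrow> k (x - y) *\<^sub>R g y"
    proof (rule AE_I2)
      fix y
      have "isCont k (x - y)" using k(1) by (simp add: continuous_on_eq_continuous_at)
      then have "(\<lambda>n. k (X n - y)) \<longlonglongrightarrow> k (x - y)"
        by (rule isCont_tendsto_compose) (intro tendsto_intros X)
      then show "(\<lambda>n. k (X n - y) *\<^sub>R g y) \<longlonglongrightarrow> k (x - y) *\<^sub>R g y" by (intro tendsto_intros)
    qed
    show "integrable lborel (\<lambda>y. B * norm (g y))" using g by simp
    show "AE y in lborel. norm (k (X n - y) *\<^sub>R g y) \<le> B * norm (g y)" for n
      using B by (intro AE_I2) (simp add: mult_right_mono)
  qed measurable
qed

lemma continuous_conv_ker'':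
  fixes g :: "real^2 \<Rightarrow> 'b::euclidean_space"
  assumes d: "d > 0" and g: "integrable lborel g"
  shows "continuous_on A (conv (ker'' d i j) g)"
proof -
  have s: "z \<notin> cball 0 d \<Longrightarrow> z \<notin> ball (0::real^2) d" for z by auto
  show ?thesis
    by (intro continuous_at_imp_continuous_on ballI isCont_conv[OF continuous_ker(3) _ g])
      (use ker_outside[OF d s] in blast)
qed

text \<open>Integrability of the difference is obtained together with the closeness estimate, once
  \<open>d n\<close> is small; this is why the first claim is stated eventually.\<close>

lemma mollify_L1:
  fixes g :: "real^2 \<Rightarrow> 'b::euclidean_space"
  assumes g: "integrable lborel g" and d: "\<And>n. d n > 0" "d \<longlonglongrightarrow> 0"
  shows "eventually (\<lambda>n. integrable lborel (\<lambda>x. conv (ker (d n)) g x - g x)) sequentially"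
    "(\<lambda>n. LINT x|lborel. norm (conv (ker (d n)) g x - g x)) \<longlonglongrightarrow> 0"
proof -
  have ev: "\<forall>\<^sub>F n in sequentially. integrable lborel (\<lambda>x. conv (ker (d n)) g x - g x) \<and>
      (LINT x|lborel. norm (conv (ker (d n)) g x - g x)) \<le> e" if e: "e > 0" for e
  proof -
    obtain c where c: "c > 0" "\<And>h. norm h < c \<Longrightarrow> (\<integral>\<^sup>+x. norm (g (x - h) - g x) \<partial>lborel) \<le> ennreal e"
      using translation_continuous_L1[OF g] e by blast
    have "\<forall>\<^sub>F n in sequentially. d n < c" using d(2) c(1) by (rule order_tendstoD(2))
    then show ?thesis
    proof eventually_elim
      case (elim n)
      have cl: "norm h \<le> d n \<Longrightarrow> (\<integral>\<^sup>+x. norm (g (x - h) - g x) \<partial>lborel) \<le> ennreal e" for h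
        using c(2) elim by auto
      note conv_L1_close[OF mollifier_ker[OF d(1)] g has_partials_continuous[OF conv_ker_has_partials(1)[OF d(1) g]] cl e]
      then show ?case by blast
    qed
  qed
  show "\<forall>\<^sub>F n in sequentially. integrable lborel (\<lambda>x. conv (ker (d n)) g x - g x)"
    using ev[of 1] by (auto elim: eventually_mono)
  show "(\<lambda>n. LINT x|lborel. norm (conv (ker (d n)) g x - g x)) \<longlonglongrightarrow> 0"
    unfolding tendsto_iff
  proof (intro allI impI)
    fix e :: real assume "e > 0"
    then show "\<forall>\<^sub>F n in sequentially. dist (LINT x|lborel. norm (conv (ker (d n)) g x - g x)) 0 < e"
      using ev[of "e/2"] by (auto elim!: eventually_mono intro: le_less_trans)
  qed
qed

lemma mollify_AE_subseq:
  fixes g :: "real^2 \<Rightarrow> 'b::euclidean_space"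
  assumes g: "integrable lborel g" and c: "c > 0"
  obtains d where "\<And>n. 0 < d n" "\<And>n::nat. d n < c" "d \<longlonglongrightarrow> 0"
    "AE x in lborel. (\<lambda>n. conv (ker (d n)) g x) \<longlonglongrightarrow> g x"
proof -
  \<comment> \<open>The offset 2 keeps every radius strictly below \<open>c\<close>, already for
    \<open>n = 0\<close>.\<close>
  define d0 where "d0 n = c / real (n + 2)" for n
  have d0: "\<And>n. d0 n > 0" "\<And>n. d0 n < c" using c by (auto simp: d0_def divide_simps)
  have d0l: "d0 \<longlonglongrightarrow> 0" unfolding d0_def
    using LIMSEQ_ignore_initial_segment[OF lim_const_over_n[of c], of 2] by simp
  obtain N where N: "\<And>n. n \<ge> N \<Longrightarrow> integrable lborel (\<lambda>x. conv (ker (d0 n)) g x - g x)"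
    using mollify_L1(1)[OF g d0(1) d0l] unfolding eventually_sequentially by blast
  have "\<exists>r. strict_mono r \<and> (AE x in lborel. (\<lambda>n. conv (ker (d0 (r n + N))) g x - g x) \<longlonglongrightarrow> 0)"
    by (rule tendsto_L1_AE_subseq[of lborel "\<lambda>n x. conv (ker (d0 (n + N))) g x - g x"])
      (use N LIMSEQ_ignore_initial_segment[OF mollify_L1(2)[OF g d0(1) d0l], of N] in auto)
  then obtain r where r: "strict_mono r" "AE x in lborel. (\<lambda>n. conv (ker (d0 (r n + N))) g x - g x) \<longlonglongrightarrow> 0"
    by blast
  show ?thesis
  proof (rule that[of "\<lambda>n. d0 (r n + N)"])
    show "(\<lambda>n. d0 (r n + N)) \<longlonglongrightarrow> 0"
      using LIMSEQ_subseq_LIMSEQ[OF LIMSEQ_ignore_initial_segment[OF d0l, of N] r(1)] by (simp add: comp_def)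
    show "AE x in lborel. (\<lambda>n. conv (ker (d0 (r n + N))) g x) \<longlonglongrightarrow> g x"
      using r(2) by (simp add: LIM_zero_iff)
  qed (use d0 in auto)
qed

section \<open>Mean value inequality and gradient estimate\<close>

lemma has_partials_const: "has_partials (\<lambda>x. c) (\<lambda>i x. 0)"
  unfolding has_partials_def by (auto intro!: derivative_eq_intros)

lemma has_partials_nth: "has_partials (\<lambda>x. x$k) (\<lambda>i x. if i = k then 1 else (0::real))"
  unfolding has_partials_def
proof
  fix x
  show "((\<lambda>x. x$k) has_derivative (\<lambda>h. h$1 *\<^sub>R (if 1 = k then 1 else (0::real)) + h$2 *\<^sub>R (if 2 = k then 1 else 0))) (at x)"
    by (rule has_derivative_vec_nth'[THEN has_derivative_eq_rhs]) (use exhaust_2[of k] in auto)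
qed

lemma has_partials_add:
  "has_partials f f' \<Longrightarrow> has_partials g g' \<Longrightarrow> has_partials (\<lambda>x. f x + g x) (\<lambda>i x. f' i x + g' i x)"
  unfolding has_partials_def
  by (auto intro!: has_derivative_add[THEN has_derivative_eq_rhs] simp: algebra_simps)

lemma has_partials_diff:
  "has_partials f f' \<Longrightarrow> has_partials g g' \<Longrightarrow> has_partials (\<lambda>x. f x - g x) (\<lambda>i x. f' i x - g' i x)"
  unfolding has_partials_def
  by (auto intro!: has_derivative_diff[THEN has_derivative_eq_rhs] simp: algebra_simps)

lemma has_partials_bilinear:
  assumes "bounded_bilinear pr" "has_partials f f'" "has_partials g g'"
  shows "has_partials (\<lambda>x. pr (f x) (g x)) (\<lambda>i x. pr (f' i x) (g x) + pr (f x) (g' i x))"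
  unfolding has_partials_def
proof
  fix x
  interpret bounded_bilinear pr by fact
  show "((\<lambda>x. pr (f x) (g x)) has_derivative (\<lambda>h. h$1 *\<^sub>R (pr (f' 1 x) (g x) + pr (f x) (g' 1 x))
      + h$2 *\<^sub>R (pr (f' 2 x) (g x) + pr (f x) (g' 2 x)))) (at x)"
    by (rule FDERIV[OF has_partialsD[OF assms(2)] has_partialsD[OF assms(3)], THEN has_derivative_eq_rhs])
      (simp add: fun_eq_iff add_left add_right scaleR_left scaleR_right algebra_simps)
qed

lemmas has_partials_mult = has_partials_bilinear[OF bounded_bilinear_mult]
lemmas has_partials_inner = has_partials_bilinear[OF bounded_bilinear_inner]
lemmas has_partials_scaleR = has_partials_bilinear[OF bounded_bilinear_scaleR]

lemma has_partials_compose: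
  assumes "has_partials f f'" "\<And>x. (F has_derivative D (f x)) (at (f x))"
  shows "has_partials (\<lambda>x. F (f x)) (\<lambda>i x. D (f x) (f' i x))"
  unfolding has_partials_def
proof
  fix x
  have "bounded_linear (D (f x))" using assms(2) by (rule has_derivative_bounded_linear)
  then interpret bounded_linear "D (f x)" .
  show "((\<lambda>x. F (f x)) has_derivative (\<lambda>h. h$1 *\<^sub>R D (f x) (f' 1 x) + h$2 *\<^sub>R D (f x) (f' 2 x))) (at x)"
    by (rule has_derivative_compose[OF has_partialsD[OF assms(1)] assms(2), THEN has_derivative_eq_rhs])
      (simp add: fun_eq_iff add scaleR)
qed

lemma has_partials_compose_real:
  assumes "has_partials f f'" "\<And>t. (F has_real_derivative F' t) (at t)"
  shows "has_partials (\<lambda>x. F (f x)) (\<lambda>i x. F' (f x) * f' i x)"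
  using has_partials_compose[OF assms(1), of F "\<lambda>t. (*) (F' t)"] assms(2)
  by (simp add: has_field_derivative_def)

lemma has_partials_affine:
  assumes "has_partials f f'"
  shows "has_partials (\<lambda>z. f (x + s *\<^sub>R z)) (\<lambda>i z. s *\<^sub>R f' i (x + s *\<^sub>R z))"
  unfolding has_partials_def
proof
  fix z
  have "((\<lambda>z. x + s *\<^sub>R z) has_derivative (\<lambda>h. s *\<^sub>R h)) (at z)"
    by (auto intro!: derivative_eq_intros)
  from has_derivative_compose[OF this has_partialsD[OF assms]]
  show "((\<lambda>z. f (x + s *\<^sub>R z)) has_derivative (\<lambda>h. h$1 *\<^sub>R s *\<^sub>R f' 1 (x + s *\<^sub>R z) + h$2 *\<^sub>R s *\<^sub>R f' 2 (x + s *\<^sub>R z))) (at z)"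
    by (rule has_derivative_eq_rhs) (simp add: fun_eq_iff mult.commute)
qed

lemma has_partials_along:
  fixes f :: "real^2 \<Rightarrow> real"
  assumes "has_partials f f'"
  shows "((\<lambda>s. f (x + s *\<^sub>R z)) has_real_derivative z$1 * f' 1 (x + s *\<^sub>R z) + z$2 * f' 2 (x + s *\<^sub>R z)) (at s)"
proof -
  have "((\<lambda>s. x + s *\<^sub>R z) has_derivative (\<lambda>r. r *\<^sub>R z)) (at s)"
    by (auto intro!: derivative_eq_intros)
  from has_derivative_compose[OF this has_partialsD[OF assms]]
  show ?thesis unfolding has_field_derivative_def
    by (rule has_derivative_eq_rhs) (simp add: fun_eq_iff algebra_simps)
qed

section \<open>Averages over dilates of a radial weight\<close>

lemma integral_cbox_compact_support:
  fixes f :: "'a::euclidean_space \<Rightarrow> real"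
  assumes c: "continuous_on UNIV f" and s: "\<And>z. z \<notin> cball 0 1 \<Longrightarrow> f z = 0"
  shows "(LINT z|lborel. f z) = integral (cbox (- One) One) f"
proof -
  have sub: "cball 0 1 \<subseteq> cbox (- One) (One::'a)"
  proof
    fix z :: 'a assume "z \<in> cball 0 1"
    then have "norm z \<le> 1" by simp
    then have "\<bar>z \<bullet> b\<bar> \<le> 1" if "b \<in> Basis" for b using Basis_le_norm[OF that, of z] by linarith
    then show "z \<in> cbox (- One) One" by (force simp: mem_box abs_le_iff)
  qed
  have "(LINT z|lborel. f z) = (LINT z|lborel. indicator (cbox (- One) One) z *\<^sub>R f z)"
  proof (intro Bochner_Integration.integral_cong refl)
    fix z
    show "f z = indicator (cbox (- One) One) z *\<^sub>R f z"
      using s[of z] subsetD[OF sub, of z] by (cases "z \<in> cbox (- One) One"; cases "z \<in> cball 0 1") (simp_all del: mem_cball_0 mem_cball)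
  qed
  also have "\<dots> = integral (cbox (- One) One) f"
    using set_borel_integral_eq_integral(2)[of "cbox (- One) (One::'a)" f]
      borel_integrable_compact[OF compact_cbox, of "- One" "One::'a" f] continuous_on_subset[OF c]
    by (simp add: set_integrable_def set_lebesgue_integral_def)
  finally show ?thesis .
qed

text \<open>Nothing is integrated outside the unit ball, so the Leibniz rule on the box from
  \<open>- One\<close> to \<open>One\<close> gives the derivative.\<close>

lemma DERIV_integral_compact_support:
  fixes F :: "real \<Rightarrow> 'a::euclidean_space \<Rightarrow> real"
  assumes D: "\<And>s z. ((\<lambda>s. F s z) has_real_derivative F' s z) (at s)"
    and c: "\<And>s. continuous_on UNIV (F s)" and c': "continuous_on UNIV (\<lambda>(s, z). F' s z)"
    and supp: "\<And>s z. z \<notin> cball 0 1 \<Longrightarrow> F s z = 0" "\<And>s z. z \<notin> cball 0 1 \<Longrightarrow> F' s z = 0"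
  shows "((\<lambda>s. LINT z|lborel. F s z) has_real_derivative (LINT z|lborel. F' s z)) (at s)"
proof -
  have c'': "continuous_on UNIV (F' s)" for s
  proof -
    have "continuous_on UNIV (\<lambda>z::'a. (s, z))" by (intro continuous_intros)
    from continuous_on_compose2[OF c' this] show ?thesis by simp
  qed
  have e1: "(LINT z|lborel. F s z) = integral (cbox (- One) One) (F s)" for s
    by (rule integral_cbox_compact_support[OF c]) (fact supp(1))
  have e2: "(LINT z|lborel. F' s z) = integral (cbox (- One) One) (F' s)" for s
    by (rule integral_cbox_compact_support[OF c'']) (fact supp(2))
  have "((\<lambda>s. integral (cbox (- One) One) (F s)) has_vector_derivative integral (cbox (- One) One) (F' s)) (at s within UNIV)"
  proof (rule leibniz_rule_vector_derivative)
    show "((\<lambda>x. F x t) has_vector_derivative F' x t) (at x within UNIV)" for x t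
      using D by (simp add: has_real_derivative_iff_has_vector_derivative)
    show "F x integrable_on cbox (- One) One" for x
      by (intro integrable_continuous continuous_on_subset[OF c]) auto
    show "continuous_on (UNIV \<times> cbox (- One) One) (\<lambda>(x, t). F' x t)"
      by (rule continuous_on_subset[OF c']) auto
  qed auto
  then show ?thesis
    unfolding e1 e2 by (simp add: has_real_derivative_iff_has_vector_derivative)
qed

text \<open>Averages over dilates of the radial weight \<open>\<eta>\<close> replace averages over discs; since
  \<open>\<nabla>H = - z \<eta>\<close>, the dilation derivative of such an average is an integral of the Laplacian.\<close>

definition mcut :: "real^2 \<Rightarrow> real" where "mcut z = max 0 (1 - z \<bullet> z)"

lemma mcut_bounds: "0 \<le> mcut z" "mcut z \<le> 1" by (auto simp: mcut_def)

lemma mcut_outside: "z \<notin> cball 0 1 \<Longrightarrow> mcut z = 0"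
proof -
  assume "z \<notin> cball 0 1"
  then have "1\<^sup>2 \<le> (norm z)\<^sup>2" by (intro power_mono) auto
  then show ?thesis by (simp add: mcut_def power2_norm_eq_inner)
qed

lemma continuous_mcut [continuous_intros]: "continuous_on A mcut"
  unfolding mcut_def by (intro continuous_intros)

lemma has_partials_inner_self: "has_partials (\<lambda>z. z \<bullet> z) (\<lambda>i z. 2 * z$i)"
  unfolding has_partials_def
proof
  fix z :: "real^2"
  have "((\<lambda>z. z \<bullet> z) has_derivative (\<lambda>h. z \<bullet> h + h \<bullet> z)) (at z)"
    by (auto intro!: derivative_eq_intros)
  then show "((\<lambda>z. z \<bullet> z) has_derivative (\<lambda>h. h$1 *\<^sub>R (2 * z$1) + h$2 *\<^sub>R (2 * z$2))) (at z)"
    by (rule has_derivative_eq_rhs) (simp add: inner_real2 fun_eq_iff algebra_simps)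
qed

text \<open>Powers from 2 on are C^1 across the unit circle, although \<open>mcut\<close> itself has
  a kink there.\<close>

lemma has_partials_mcut_power: "has_partials (\<lambda>z. mcut z ^ (n + 2)) (\<lambda>i z. - 2 * (n + 2) * z$i * mcut z ^ (n + 1))"
proof -
  have "((\<lambda>t. (max 0 t) ^ (n + 2)) has_real_derivative (real n + 2) * (max 0 t) ^ (n + 1)) (at t)" for t :: real
    by (rule DERIV_comp_max0[of "\<lambda>t. t ^ (n + 2)" "\<lambda>t. (real n + 2) * t ^ (n + 1)"])
      (auto intro!: DERIV_cong[OF DERIV_pow] simp del: power_Suc)
  from has_partials_compose_real[OF has_partials_diff[OF has_partials_const has_partials_inner_self], of _ _ 1, OF this]
  show ?thesis unfolding mcut_def by (rule back_subst[of "has_partials _"]) (auto simp: fun_eq_iff algebra_simps)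
qed

lemma has_partials_eta: "has_partials (\<lambda>z. (mcut z)\<^sup>2) (\<lambda>i z. - 4 * z$i * mcut z)"
  unfolding power2_eq_square using has_partials_mcut_power[of 0] by (simp add: mult.assoc)

lemma has_partials_H: "has_partials (\<lambda>z. mcut z ^ 3 / 6) (\<lambda>i z. - z$i * (mcut z)\<^sup>2)"
proof -
  show ?thesis
    using has_partials_mult[OF has_partials_const[of "1/6"] has_partials_mcut_power[of 1]]
    by (simp add: eval_nat_numeral)
qed

definition eta_mass :: real where "eta_mass = (LINT z|lborel. (mcut z)\<^sup>2)"
definition mcut_mass :: real where "mcut_mass = (LINT z|lborel. mcut z)"

lemma integrable_mcut: "integrable lborel mcut" "integrable lborel (\<lambda>z. (mcut z)\<^sup>2)"
  by (rule integrable_compact_support[of _ 0 1]; (intro continuous_intros)?; simp add: mcut_outside)+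

lemma eta_mass_pos: "eta_mass > 0"
proof -
  have "eta_mass \<noteq> 0"
  proof
    assume "eta_mass = 0"
    then have "AE z in lborel. (mcut z)\<^sup>2 = 0"
      unfolding eta_mass_def by (subst (asm) integral_nonneg_eq_0_iff_AE[OF integrable_mcut(2)]) auto
    then have "AE x in lborel. x \<notin> ball (0::real^2) 1"
    proof eventually_elim
      case (elim x)
      then have "1\<^sup>2 \<le> (norm x)\<^sup>2" by (simp add: mcut_def power2_norm_eq_inner)
      then have "1 \<le> norm x" by (rule power2_le_imp_le) simp
      then show ?case by simp
    qed
    then show False using ball_not_AE_avoided[of 1] by auto
  qed
  moreover have "eta_mass \<ge> 0" unfolding eta_mass_def by (intro integral_nonneg_AE) auto
  ultimately show ?thesis by simp
qed

text \<open>The average \<open>W\<close> over the dilate by \<open>s\<close> equals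
  \<open>eta_mass * w x\<close> at \<open>s = 0\<close> and is nondecreasing as long as the dilated
  disc stays where the Laplacian is nonnegative.\<close>

lemma subharmonic_mean_value:
  fixes w :: "real^2 \<Rightarrow> real"
  assumes w: "has_partials w w'" "\<And>i. has_partials (w' i) (w'' i)" and c: "\<And>i j. continuous_on UNIV (w'' i j)"
    and sub: "\<And>y. y \<in> cball x t \<Longrightarrow> w'' 1 1 y + w'' 2 2 y \<ge> 0" and t: "t > 0"
  shows "eta_mass * w x \<le> (LINT z|lborel. (mcut z)\<^sup>2 * w (x + t *\<^sub>R z))"
proof -
  have cw: "continuous_on UNIV w" "\<And>i. continuous_on UNIV (w' i)"
    using w has_partials_continuous by blast+
  note [continuous_intros] = continuous_on_compose2[OF cw(1)] continuous_on_compose2[OF cw(2)] continuous_on_compose2[OF c]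
  define W where "W s = (LINT z|lborel. (mcut z)\<^sup>2 * w (x + s *\<^sub>R z))" for s
  define W' where "W' s = (LINT z|lborel. (mcut z)\<^sup>2 * (z$1 * w' 1 (x + s *\<^sub>R z) + z$2 * w' 2 (x + s *\<^sub>R z)))" for s
  have D: "(W has_real_derivative W' s) (at s)" for s
    unfolding W_def W'_def
  proof (rule DERIV_integral_compact_support)
    show "((\<lambda>s. (mcut z)\<^sup>2 * w (x + s *\<^sub>R z)) has_real_derivative (mcut z)\<^sup>2 * (z$1 * w' 1 (x + s *\<^sub>R z) + z$2 * w' 2 (x + s *\<^sub>R z))) (at s)" for s z
      by (intro DERIV_cmult has_partials_along w)
    show "continuous_on UNIV (\<lambda>(s, z). (mcut z)\<^sup>2 * (z$1 * w' 1 (x + s *\<^sub>R z) + z$2 * w' 2 (x + s *\<^sub>R z)))"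
      unfolding case_prod_beta by (intro continuous_intros continuous_on_compose2[OF continuous_mcut]) auto
  qed (auto simp: mcut_outside intro!: continuous_intros)
  have nonneg: "W' s \<ge> 0" if s: "0 \<le> s" "s \<le> t" for s
  proof -
    \<comment> \<open>Integration by parts for \<open>mcut z ^ 3 / 6\<close> times
      \<open>w' i\<close>. Adding the two vanishing integrals to \<open>W' s\<close> cancels the
      first derivatives and leaves \<open>s\<close> times the integral of this weight against the
      Laplacian.\<close>
    have int: "integrable lborel (\<lambda>z. mcut z ^ 3 / 6 * (s * w'' i i (x + s *\<^sub>R z)) - z$i * (mcut z)\<^sup>2 * w' i (x + s *\<^sub>R z))"
      "(LINT z|lborel. mcut z ^ 3 / 6 * (s * w'' i i (x + s *\<^sub>R z)) - z$i * (mcut z)\<^sup>2 * w' i (x + s *\<^sub>R z)) = 0" for i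
    proof -
      have P: "has_partials (\<lambda>z. mcut z ^ 3 / 6 * w' i (x + s *\<^sub>R z))
        (\<lambda>j z. (- z$j * (mcut z)\<^sup>2) * w' i (x + s *\<^sub>R z) + mcut z ^ 3 / 6 * (s *\<^sub>R w'' i j (x + s *\<^sub>R z)))"
        by (intro has_partials_mult has_partials_H has_partials_affine w)
      have "(LINT z|lborel. (- z$i * (mcut z)\<^sup>2) * w' i (x + s *\<^sub>R z) + mcut z ^ 3 / 6 * (s *\<^sub>R w'' i i (x + s *\<^sub>R z))) = 0"
        by (rule integral_partial_zero[OF P, of i 0 1]) (auto simp: mcut_outside intro!: continuous_intros)
      then show "(LINT z|lborel. mcut z ^ 3 / 6 * (s * w'' i i (x + s *\<^sub>R z)) - z$i * (mcut z)\<^sup>2 * w' i (x + s *\<^sub>R z)) = 0"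
        by (simp add: algebra_simps)
      show "integrable lborel (\<lambda>z. mcut z ^ 3 / 6 * (s * w'' i i (x + s *\<^sub>R z)) - z$i * (mcut z)\<^sup>2 * w' i (x + s *\<^sub>R z))"
        by (rule integrable_compact_support[of _ 0 1]) (auto simp: mcut_outside intro!: continuous_intros)
    qed
    have iW: "integrable lborel (\<lambda>z. (mcut z)\<^sup>2 * (z$1 * w' 1 (x + s *\<^sub>R z) + z$2 * w' 2 (x + s *\<^sub>R z)))"
      by (rule integrable_compact_support[of _ 0 1]) (auto simp: mcut_outside intro!: continuous_intros)
    have "W' s = W' s + ((LINT z|lborel. mcut z ^ 3 / 6 * (s * w'' 1 1 (x + s *\<^sub>R z)) - z$1 * (mcut z)\<^sup>2 * w' 1 (x + s *\<^sub>R z))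
       + (LINT z|lborel. mcut z ^ 3 / 6 * (s * w'' 2 2 (x + s *\<^sub>R z)) - z$2 * (mcut z)\<^sup>2 * w' 2 (x + s *\<^sub>R z)))"
      by (simp only: int(2) add_0_right)
    also have "\<dots> = (LINT z|lborel. (mcut z)\<^sup>2 * (z$1 * w' 1 (x + s *\<^sub>R z) + z$2 * w' 2 (x + s *\<^sub>R z))
        + ((mcut z ^ 3 / 6 * (s * w'' 1 1 (x + s *\<^sub>R z)) - z$1 * (mcut z)\<^sup>2 * w' 1 (x + s *\<^sub>R z))
        + (mcut z ^ 3 / 6 * (s * w'' 2 2 (x + s *\<^sub>R z)) - z$2 * (mcut z)\<^sup>2 * w' 2 (x + s *\<^sub>R z))))"
      unfolding W'_def
      by (simp only: Bochner_Integration.integral_add[OF int(1) int(1)]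
          Bochner_Integration.integral_add[OF iW Bochner_Integration.integrable_add[OF int(1) int(1)]])
    also have "\<dots> = (LINT z|lborel. mcut z ^ 3 / 6 * (s * (w'' 1 1 (x + s *\<^sub>R z) + w'' 2 2 (x + s *\<^sub>R z))))"
      by (intro Bochner_Integration.integral_cong refl) (simp add: algebra_simps)
    also have "\<dots> \<ge> 0"
    proof (intro integral_nonneg_AE AE_I2)
      fix z :: "real^2"
      show "0 \<le> mcut z ^ 3 / 6 * (s * (w'' 1 1 (x + s *\<^sub>R z) + w'' 2 2 (x + s *\<^sub>R z)))"
      proof (cases "z \<in> cball 0 1")
        case True
        then have "s * norm z \<le> t * 1" using s by (intro mult_mono) auto
        then have "x + s *\<^sub>R z \<in> cball x t" using s by (simp add: dist_norm)
        then show ?thesis using sub s mcut_bounds by (intro mult_nonneg_nonneg divide_nonneg_nonneg zero_le_power) auto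
      qed (simp add: mcut_outside)
    qed
    finally show ?thesis .
  qed
  have "W 0 \<le> W t"
    by (rule DERIV_nonneg_imp_nondecreasing) (use t D nonneg in auto)
  then show ?thesis unfolding W_def eta_mass_def by simp
qed

text \<open>The weighted average of \<open>w' i\<close> is followed from dilation 0, where it gives
  the value at \<open>x\<close>, to dilation \<open>t\<close>. There the derivative is moved to the
  weight, whose partial derivative \<open>- 4 * z$i * mcut z\<close> accounts for the first
  constant. The change in between is controlled by the Laplacian alone.\<close>

lemma gradient_estimate:
  fixes w :: "real^2 \<Rightarrow> real"
  assumes w: "has_partials w w'" "\<And>i. has_partials (w' i) (w'' i)" and c: "\<And>i j. continuous_on UNIV (w'' i j)"
    and sym: "\<And>i j. w'' i j = w'' j i"
    and K: "\<And>y. y \<in> cball x t \<Longrightarrow> \<bar>w y\<bar> \<le> K" and F: "\<And>y. y \<in> cball x t \<Longrightarrow> \<bar>w'' 1 1 y + w'' 2 2 y\<bar> \<le> F"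
    and t: "t > 0"
  shows "\<bar>w' i x\<bar> \<le> 4 * mcut_mass / eta_mass * (K / t) + t * F"
proof -
  define j where "j = (if i = 1 then 2 else 1 :: 2)"
  have ij: "j \<noteq> i" "i \<noteq> j" by (auto simp: j_def)
  have sum_ij: "a 1 + a 2 = a i + a j" for a :: "2 \<Rightarrow> real"
    using exhaust_2[of i] by (auto simp: j_def)
  have cw: "continuous_on UNIV w" "\<And>i. continuous_on UNIV (w' i)"
    using w has_partials_continuous by blast+
  note [continuous_intros] = continuous_on_compose2[OF cw(1)] continuous_on_compose2[OF cw(2)] continuous_on_compose2[OF c]
  define W where "W s = (LINT z|lborel. (mcut z)\<^sup>2 * w' i (x + s *\<^sub>R z))" for s
  define W' where "W' s = (LINT z|lborel. (mcut z)\<^sup>2 * (z$1 * w'' i 1 (x + s *\<^sub>R z) + z$2 * w'' i 2 (x + s *\<^sub>R z)))" for s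
  have in_ball: "x + s *\<^sub>R z \<in> cball x t" if "0 \<le> s" "s \<le> t" "z \<in> cball 0 1" for s z
  proof -
    have "s * norm z \<le> t * 1" using that by (intro mult_mono) auto
    then show ?thesis using that by (simp add: dist_norm)
  qed
  have K0: "K \<ge> 0" using K[of x] t by (force intro: order_trans[OF abs_ge_zero])
  have F0: "F \<ge> 0" using F[of x] t by (force intro: order_trans[OF abs_ge_zero])
  have zle: "\<bar>z$i\<bar> \<le> 1" if "z \<in> cball 0 1" for z :: "real^2"
    using component_le_norm_cart[of z i] that by simp
  have D: "(W has_real_derivative W' s) (at s)" for s
    unfolding W_def W'_def
  proof (rule DERIV_integral_compact_support)
    show "((\<lambda>s. (mcut z)\<^sup>2 * w' i (x + s *\<^sub>R z)) has_real_derivative (mcut z)\<^sup>2 * (z$1 * w'' i 1 (x + s *\<^sub>R z) + z$2 * w'' i 2 (x + s *\<^sub>R z))) (at s)" for s z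
      by (intro DERIV_cmult has_partials_along w)
    show "continuous_on UNIV (\<lambda>(s, z). (mcut z)\<^sup>2 * (z$1 * w'' i 1 (x + s *\<^sub>R z) + z$2 * w'' i 2 (x + s *\<^sub>R z)))"
      unfolding case_prod_beta by (intro continuous_intros continuous_on_compose2[OF continuous_mcut]) auto
  qed (auto simp: mcut_outside intro!: continuous_intros)
  have W'_bound: "\<bar>W' s\<bar> \<le> F * eta_mass" if s: "0 < s" "s < t" for s
  proof -
    let ?y = "\<lambda>z. x + s *\<^sub>R z"
    \<comment> \<open>Two integrations by parts exchange \<open>z$j * w'' i j\<close> for
      \<open>z$i * w'' j j\<close>. The terms containing derivatives of the weight cancel because it
      is radial, and only the Laplacian is left in \<open>W' s\<close>.\<close>
    have Z: "(LINT z|lborel. ((if k = l then 1 else 0) * (mcut z)\<^sup>2 + z$l * (- 4 * z$k * mcut z)) * w' j (?y z) + z$l * (mcut z)\<^sup>2 * (s *\<^sub>R w'' j k (?y z))) = 0"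
      (is "(LINT z|lborel. ?Z k l z) = 0") for k l
    proof -
      have P: "has_partials (\<lambda>z. (z$l * (mcut z)\<^sup>2) * w' j (?y z))
        (\<lambda>k z. ((if k = l then 1 else 0) * (mcut z)\<^sup>2 + z$l * (- 4 * z$k * mcut z)) * w' j (?y z) + z$l * (mcut z)\<^sup>2 * (s *\<^sub>R w'' j k (?y z)))"
        by (intro has_partials_mult has_partials_nth has_partials_eta has_partials_affine w)
      show ?thesis
        by (rule integral_partial_zero[OF P, of k 0 1]) (auto simp: mcut_outside intro!: continuous_intros)
    qed
    have Zi: "integrable lborel (?Z k l)" for k l
      by (rule integrable_compact_support[of _ 0 1]) (auto simp: mcut_outside intro!: continuous_intros)
    have I: "integrable lborel (\<lambda>z. (mcut z)\<^sup>2 * (z$k * w'' a b (?y z)))" for k a b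
      by (rule integrable_compact_support[of _ 0 1]) (auto simp: mcut_outside intro!: continuous_intros)
    have "(LINT z|lborel. ?Z i j z - ?Z j i z) = 0"
      using Z[of i j] Z[of j i] Zi[of i j] Zi[of j i] by (simp only: Bochner_Integration.integral_diff diff_0_right)
    also have "(\<lambda>z. ?Z i j z - ?Z j i z) = (\<lambda>z. s * ((mcut z)\<^sup>2 * (z$j * w'' i j (?y z)) - (mcut z)\<^sup>2 * (z$i * w'' j j (?y z))))"
      using ij sym[of i j] by (auto simp: fun_eq_iff algebra_simps)
    finally have swap: "(LINT z|lborel. (mcut z)\<^sup>2 * (z$j * w'' i j (?y z))) = (LINT z|lborel. (mcut z)\<^sup>2 * (z$i * w'' j j (?y z)))"
      using s I by simp
    have "W' s = (LINT z|lborel. (mcut z)\<^sup>2 * (z$i * w'' i i (?y z)) + (mcut z)\<^sup>2 * (z$j * w'' i j (?y z)))"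
      unfolding W'_def using sum_ij[of "\<lambda>k. z$k * w'' i k (?y z)" for z] by (simp add: algebra_simps)
    also have "\<dots> = (LINT z|lborel. (mcut z)\<^sup>2 * (z$i * w'' i i (?y z)) + (mcut z)\<^sup>2 * (z$i * w'' j j (?y z)))"
      using swap I by (simp only: Bochner_Integration.integral_add)
    also have "\<bar>\<dots>\<bar> \<le> (LINT z|lborel. F * (mcut z)\<^sup>2)"
    proof (rule integral_abs_bound_integral)
      show "integrable lborel (\<lambda>z. F * (mcut z)\<^sup>2)" using integrable_mcut by simp
      show "integrable lborel (\<lambda>z. (mcut z)\<^sup>2 * (z$i * w'' i i (?y z)) + (mcut z)\<^sup>2 * (z$i * w'' j j (?y z)))"
        by (intro Bochner_Integration.integrable_add I)
      fix z :: "real^2"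
      show "\<bar>(mcut z)\<^sup>2 * (z$i * w'' i i (?y z)) + (mcut z)\<^sup>2 * (z$i * w'' j j (?y z))\<bar> \<le> F * (mcut z)\<^sup>2"
      proof (cases "z \<in> cball 0 1")
        case True
        have "\<bar>w'' i i (?y z) + w'' j j (?y z)\<bar> \<le> F"
          using F[OF in_ball[of s z]] s True sum_ij[of "\<lambda>k. w'' k k (?y z)"] by simp
        then have "\<bar>z$i\<bar> * \<bar>w'' i i (?y z) + w'' j j (?y z)\<bar> \<le> 1 * F"
          using zle[OF True] by (intro mult_mono) auto
        then have "(mcut z)\<^sup>2 * (\<bar>z$i\<bar> * \<bar>w'' i i (?y z) + w'' j j (?y z)\<bar>) \<le> (mcut z)\<^sup>2 * F"
          by (intro mult_left_mono) auto
        moreover have "(mcut z)\<^sup>2 * (z$i * w'' i i (?y z)) + (mcut z)\<^sup>2 * (z$i * w'' j j (?y z))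
           = (mcut z)\<^sup>2 * (z$i * (w'' i i (?y z) + w'' j j (?y z)))" by (simp add: algebra_simps)
        ultimately show ?thesis by (simp add: abs_mult mult.commute)
      qed (simp add: mcut_outside)
    qed
    also have "\<dots> = F * eta_mass" by (simp add: eta_mass_def)
    finally show ?thesis .
  qed
  obtain \<xi> where \<xi>: "0 < \<xi>" "\<xi> < t" "W t - W 0 = (t - 0) * W' \<xi>"
    using MVT2[OF t, of W W'] D by blast
  have "\<bar>W 0\<bar> \<le> \<bar>W t\<bar> + t * (F * eta_mass)"
  proof -
    have "\<bar>W t - W 0\<bar> \<le> t * (F * eta_mass)"
      unfolding \<xi>(3) using W'_bound[OF \<xi>(1,2)] t by (simp add: abs_mult)
    then show ?thesis by linarith
  qed
  moreover have "t * \<bar>W t\<bar> \<le> 4 * K * mcut_mass"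
  proof -
    let ?y = "\<lambda>z. x + t *\<^sub>R z"
    have P: "has_partials (\<lambda>z. (mcut z)\<^sup>2 * w (?y z)) (\<lambda>i z. (- 4 * z$i * mcut z) * w (?y z) + (mcut z)\<^sup>2 * (t *\<^sub>R w' i (?y z)))"
      by (intro has_partials_mult has_partials_eta has_partials_affine w)
    have Z: "(LINT z|lborel. (- 4 * z$i * mcut z) * w (?y z) + (mcut z)\<^sup>2 * (t *\<^sub>R w' i (?y z))) = 0"
      by (rule integral_partial_zero[OF P, of i 0 1]) (auto simp: mcut_outside intro!: continuous_intros)
    have I1: "integrable lborel (\<lambda>z. (- 4 * z$i * mcut z) * w (?y z))"
      by (rule integrable_compact_support[of _ 0 1]) (auto simp: mcut_outside intro!: continuous_intros)
    have I2: "integrable lborel (\<lambda>z. (mcut z)\<^sup>2 * (t *\<^sub>R w' i (?y z)))"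
      by (rule integrable_compact_support[of _ 0 1]) (auto simp: mcut_outside intro!: continuous_intros)
    have "t * W t = (LINT z|lborel. (mcut z)\<^sup>2 * (t *\<^sub>R w' i (?y z)))"
      unfolding W_def by (subst integral_mult_right_zero[symmetric]) (simp add: mult_ac)
    also have "\<dots> = - (LINT z|lborel. (- 4 * z$i * mcut z) * w (?y z))"
      using Z unfolding Bochner_Integration.integral_add[OF I1 I2] by simp
    finally have "\<bar>t * W t\<bar> = \<bar>LINT z|lborel. (- 4 * z$i * mcut z) * w (?y z)\<bar>" by simp
    also have "\<dots> \<le> (LINT z|lborel. 4 * K * mcut z)"
    proof (rule integral_abs_bound_integral[OF I1])
      show "integrable lborel (\<lambda>z. 4 * K * mcut z)" using integrable_mcut by simp
      fix z :: "real^2"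
      show "\<bar>(- 4 * z$i * mcut z) * w (?y z)\<bar> \<le> 4 * K * mcut z"
      proof (cases "z \<in> cball 0 1")
        case True
        have "\<bar>z$i\<bar> * \<bar>w (?y z)\<bar> \<le> 1 * K"
          using zle[OF True] K[OF in_ball[of t z]] t True by (intro mult_mono) auto
        then have "(4 * mcut z) * (\<bar>z$i\<bar> * \<bar>w (?y z)\<bar>) \<le> (4 * mcut z) * K"
          using mcut_bounds[of z] by (intro mult_left_mono) auto
        then show ?thesis using mcut_bounds[of z] by (simp add: abs_mult mult_ac)
      qed (simp add: mcut_outside)
    qed
    also have "\<dots> = 4 * K * mcut_mass" by (simp add: mcut_mass_def)
    finally show ?thesis using t by (simp add: abs_mult)
  qed
  moreover have "W 0 = eta_mass * w' i x" by (simp add: W_def eta_mass_def)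
  ultimately have "eta_mass * \<bar>w' i x\<bar> \<le> 4 * K * mcut_mass / t + t * (F * eta_mass)"
    using eta_mass_pos t by (simp add: abs_mult pos_le_divide_eq mult.commute)
      (smt (verit) mult.commute pos_le_divide_eq)
  then have "\<bar>w' i x\<bar> \<le> (4 * K * mcut_mass / t + t * (F * eta_mass)) / eta_mass"
    using eta_mass_pos by (simp add: pos_le_divide_eq mult.commute)
  also have "\<dots> = 4 * mcut_mass / eta_mass * (K / t) + t * F"
    using eta_mass_pos t by (simp add: field_simps)
  finally show ?thesis .
qed

section \<open>Integral identities and their limits\<close>

lemma radial_algebra:
  fixes v1 v2 :: "'b::real_inner"
  shows "a * (v1 \<bullet> (a *\<^sub>R v1 + b *\<^sub>R v2) - (a * ((1/2) * (v1 \<bullet> v1 + v2 \<bullet> v2)) + a * e))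
    + b * (v2 \<bullet> (a *\<^sub>R v1 + b *\<^sub>R v2) - (b * ((1/2) * (v1 \<bullet> v1 + v2 \<bullet> v2)) + b * e))
    = (a *\<^sub>R v1 + b *\<^sub>R v2) \<bullet> (a *\<^sub>R v1 + b *\<^sub>R v2) - (a * a + b * b) * ((v1 \<bullet> v1 + v2 \<bullet> v2) / 2 + e)"
  by (simp add: inner_add_left inner_add_right inner_commute[of v2 v1] algebra_simps add_divide_distrib)

text \<open>The current \<open>A\<close> is the stress-energy tensor contracted with the radial
  field. In dimension two the squared gradient cancels in its divergence, which is the equation
  paired with the radial derivative minus \<open>2 * \<kappa> * V (w x)\<close>. The coefficient
  \<open>cc\<close> enters through the gradient of the cut-off.\<close>

lemma pohozaev_identity:
  fixes w :: "real^2 \<Rightarrow> 'b::euclidean_space" and V :: "'b \<Rightarrow> real"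
  assumes w: "has_partials w w'" "\<And>i. has_partials (w' i) (w'' i)" and c: "\<And>i j. continuous_on UNIV (w'' i j)"
    and sym: "\<And>i j. w'' i j = w'' j i"
    and V: "\<And>y. (V has_derivative (\<lambda>h. gV y \<bullet> h)) (at y)" and cgV: "continuous_on UNIV gV"
    and chi: "has_partials ct (\<lambda>i x. - (cc x * (x$i - p$i)))" and ccc: "continuous_on UNIV cc"
    and supp: "\<And>x. x \<notin> cball p b \<Longrightarrow> ct x = 0" "\<And>x. x \<notin> cball p b \<Longrightarrow> cc x = 0"
  shows "(LINT x|lborel. ct x * (2 * \<kappa> * V (w x))
     - ct x * ((w'' 1 1 x + w'' 2 2 x - \<kappa> *\<^sub>R gV (w x)) \<bullet> ((x$1 - p$1) *\<^sub>R w' 1 x + (x$2 - p$2) *\<^sub>R w' 2 x))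
     + cc x * ((norm ((x$1 - p$1) *\<^sub>R w' 1 x + (x$2 - p$2) *\<^sub>R w' 2 x))\<^sup>2
         - (norm (x - p))\<^sup>2 * (((norm (w' 1 x))\<^sup>2 + (norm (w' 2 x))\<^sup>2) / 2 + \<kappa> * V (w x)))) = 0"
proof -
  have cw: "continuous_on UNIV w" "\<And>i. continuous_on UNIV (w' i)"
    using w has_partials_continuous by blast+
  have cV: "continuous_on UNIV V" using V by (auto intro!: continuous_at_imp_continuous_on has_derivative_continuous)
  have cchi: "continuous_on UNIV ct" by (rule has_partials_continuous[OF chi])
  note [continuous_intros] = continuous_on_compose2[OF cw(1)] continuous_on_compose2[OF cw(2)] continuous_on_compose2[OF c]
    continuous_on_compose2[OF cgV] continuous_on_compose2[OF cV] continuous_on_compose2[OF cchi] continuous_on_compose2[OF ccc]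
  let ?xi = "\<lambda>k x. x$k - p$k"
  let ?X = "\<lambda>x. ?xi 1 x *\<^sub>R w' 1 x + ?xi 2 x *\<^sub>R w' 2 x"
  have Pxi: "has_partials (?xi k) (\<lambda>i x. (if i = k then 1 else 0) - 0)" for k
    by (intro has_partials_diff has_partials_nth has_partials_const)
  note PV = has_partials_compose[OF w(1), of V "\<lambda>y h. gV y \<bullet> h", OF V]
  have PX: "has_partials ?X (\<lambda>i x. ((if i = 1 then 1 else 0) - 0) *\<^sub>R w' 1 x + ?xi 1 x *\<^sub>R w'' 1 i x
      + (((if i = 2 then 1 else 0) - 0) *\<^sub>R w' 2 x + ?xi 2 x *\<^sub>R w'' 2 i x))"
    by (intro has_partials_add has_partials_scaleR Pxi w)
  have PE: "has_partials (\<lambda>x. w' 1 x \<bullet> w' 1 x + w' 2 x \<bullet> w' 2 x)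
     (\<lambda>i x. (w'' 1 i x \<bullet> w' 1 x + w' 1 x \<bullet> w'' 1 i x) + (w'' 2 i x \<bullet> w' 2 x + w' 2 x \<bullet> w'' 2 i x))"
    by (intro has_partials_add has_partials_inner w)
  define A where "A i x = w' i x \<bullet> ?X x - (?xi i x * ((1/2) * (w' 1 x \<bullet> w' 1 x + w' 2 x \<bullet> w' 2 x)) + ?xi i x * (\<kappa> * V (w x)))" for i x
  define A' where "A' i j x = (w'' i j x \<bullet> ?X x + w' i x \<bullet> (((if j = 1 then 1 else 0) - 0) *\<^sub>R w' 1 x + ?xi 1 x *\<^sub>R w'' 1 j x
      + (((if j = 2 then 1 else 0) - 0) *\<^sub>R w' 2 x + ?xi 2 x *\<^sub>R w'' 2 j x)))
    - (((((if j = i then 1 else 0) - 0) * ((1/2) * (w' 1 x \<bullet> w' 1 x + w' 2 x \<bullet> w' 2 x))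
      + ?xi i x * (0 * (w' 1 x \<bullet> w' 1 x + w' 2 x \<bullet> w' 2 x) + (1/2) * ((w'' 1 j x \<bullet> w' 1 x + w' 1 x \<bullet> w'' 1 j x) + (w'' 2 j x \<bullet> w' 2 x + w' 2 x \<bullet> w'' 2 j x)))))
      + (((if j = i then 1 else 0) - 0) * (\<kappa> * V (w x)) + ?xi i x * (0 * V (w x) + \<kappa> * (gV (w x) \<bullet> w' j x))))" for i j x
  have PA: "has_partials (A i) (A' i)" for i
    unfolding A_def[abs_def] A'_def[abs_def]
    by (intro has_partials_diff has_partials_add has_partials_mult has_partials_inner PX PE Pxi w PV has_partials_const)
  have cA: "continuous_on UNIV (A i)" for i by (rule has_partials_continuous[OF PA])
  have cA': "continuous_on UNIV (A' i i)" for i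
  proof -
    consider "i = 1" | "i = 2" using exhaust_2 by blast
    then show ?thesis unfolding A'_def by cases (simp; intro continuous_intros; simp)+
  qed
  have PZ: "has_partials (\<lambda>x. ct x * A i x) (\<lambda>j x. - (cc x * ?xi j x) * A i x + ct x * A' i j x)" for i
    by (intro has_partials_mult chi PA)
  have cZ: "continuous_on UNIV (\<lambda>x. - (cc x * ?xi i x) * A i x + ct x * A' i i x)" for i
    by (intro continuous_intros cchi ccc cA cA')
  have Z: "(LINT x|lborel. - (cc x * ?xi i x) * A i x + ct x * A' i i x) = 0" for i
    by (rule integral_partial_zero[OF PZ cZ]) (use supp in auto)
  have I: "integrable lborel (\<lambda>x. - (cc x * ?xi i x) * A i x + ct x * A' i i x)" for i
    by (rule integrable_compact_support[OF cZ, of p b]) (use supp in auto)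
  have "0 = - (LINT x|lborel. (- (cc x * ?xi 1 x) * A 1 x + ct x * A' 1 1 x) + (- (cc x * ?xi 2 x) * A 2 x + ct x * A' 2 2 x))"
    by (simp only: Bochner_Integration.integral_add[OF I I] Z)
  also have "\<dots> = (LINT x|lborel. - ((- (cc x * ?xi 1 x) * A 1 x + ct x * A' 1 1 x) + (- (cc x * ?xi 2 x) * A 2 x + ct x * A' 2 2 x)))"
    by (rule Bochner_Integration.integral_minus[symmetric])
  also have "\<dots> = (LINT x|lborel. ct x * (2 * \<kappa> * V (w x))
     - ct x * ((w'' 1 1 x + w'' 2 2 x - \<kappa> *\<^sub>R gV (w x)) \<bullet> ?X x)
     + cc x * ((norm (?X x))\<^sup>2 - (norm (x - p))\<^sup>2 * (((norm (w' 1 x))\<^sup>2 + (norm (w' 2 x))\<^sup>2) / 2 + \<kappa> * V (w x))))"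
  proof (intro Bochner_Integration.integral_cong refl)
    fix x
    have div: "A' 1 1 x + A' 2 2 x = (w'' 1 1 x + w'' 2 2 x - \<kappa> *\<^sub>R gV (w x)) \<bullet> ?X x - 2 * \<kappa> * V (w x)"
      unfolding A'_def using sym[of 1 2]
      by (simp add: inner_add_left inner_add_right inner_diff_left inner_diff_right inner_commute algebra_simps)
    have radial: "?xi 1 x * A 1 x + ?xi 2 x * A 2 x = (norm (?X x))\<^sup>2
       - (norm (x - p))\<^sup>2 * (((norm (w' 1 x))\<^sup>2 + (norm (w' 2 x))\<^sup>2) / 2 + \<kappa> * V (w x))"
      unfolding A_def power2_norm_eq_inner inner_real2[of "x - p"] vector_minus_component by (rule radial_algebra)
    have "- ((- (cc x * ?xi 1 x) * A 1 x + ct x * A' 1 1 x) + (- (cc x * ?xi 2 x) * A 2 x + ct x * A' 2 2 x))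
      = cc x * (?xi 1 x * A 1 x + ?xi 2 x * A 2 x) - ct x * (A' 1 1 x + A' 2 2 x)"
      by (simp add: algebra_simps)
    then show "- ((- (cc x * ?xi 1 x) * A 1 x + ct x * A' 1 1 x) + (- (cc x * ?xi 2 x) * A 2 x + ct x * A' 2 2 x))
      = ct x * (2 * \<kappa> * V (w x)) - ct x * ((w'' 1 1 x + w'' 2 2 x - \<kappa> *\<^sub>R gV (w x)) \<bullet> ?X x)
       + cc x * ((norm (?X x))\<^sup>2 - (norm (x - p))\<^sup>2 * (((norm (w' 1 x))\<^sup>2 + (norm (w' 2 x))\<^sup>2) / 2 + \<kappa> * V (w x)))"
      unfolding div radial by (simp add: algebra_simps)
  qed
  finally show ?thesis by simp
qed

text \<open>The divergence of \<open>ct\<close> times the field with components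
  \<open>w' i x \<bullet> gV (w x)\<close> integrates to zero. The chain rule brings in the Hessian
  of the potential as \<open>D\<close>, applied to each partial derivative.\<close>

lemma gradient_test_identity:
  fixes w :: "real^2 \<Rightarrow> 'b::euclidean_space"
  assumes w: "has_partials w w'" "\<And>i. has_partials (w' i) (w'' i)" and c: "\<And>i j. continuous_on UNIV (w'' i j)"
    and gV: "\<And>y. (gV has_derivative D y) (at y)" and cD: "continuous_on UNIV (\<lambda>(y, h). D y h)"
    and chi: "has_partials ct (\<lambda>i x. - (cc x * (x$i - p$i)))" and ccc: "continuous_on UNIV cc"
    and supp: "\<And>x. x \<notin> cball p b \<Longrightarrow> ct x = 0" "\<And>x. x \<notin> cball p b \<Longrightarrow> cc x = 0"
  shows "(LINT x|lborel. ct x * ((w'' 1 1 x + w'' 2 2 x) \<bullet> gV (w x) + (w' 1 x \<bullet> D (w x) (w' 1 x) + w' 2 x \<bullet> D (w x) (w' 2 x)))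
     - cc x * (((x$1 - p$1) *\<^sub>R w' 1 x + (x$2 - p$2) *\<^sub>R w' 2 x) \<bullet> gV (w x))) = 0"
proof -
  have cw: "continuous_on UNIV w" "\<And>i. continuous_on UNIV (w' i)"
    using w has_partials_continuous by blast+
  have cgV: "continuous_on UNIV gV" using gV by (auto intro!: continuous_at_imp_continuous_on has_derivative_continuous)
  have cchi: "continuous_on UNIV ct" by (rule has_partials_continuous[OF chi])
  have cDw: "continuous_on UNIV (\<lambda>x. D (w x) (w' i x))" for i
    using continuous_on_compose2[OF cD continuous_on_Pair[OF cw(1) cw(2)[of i]]] by simp
  note [continuous_intros] = continuous_on_compose2[OF cw(1)] continuous_on_compose2[OF cw(2)] continuous_on_compose2[OF c]
    continuous_on_compose2[OF cgV] continuous_on_compose2[OF cchi] continuous_on_compose2[OF ccc] cDw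
  note PgV = has_partials_compose[OF w(1), of gV D, OF gV]
  let ?Z = "\<lambda>i x. - (cc x * (x$i - p$i)) * (w' i x \<bullet> gV (w x)) + ct x * (w'' i i x \<bullet> gV (w x) + w' i x \<bullet> D (w x) (w' i x))"
  have PZ: "has_partials (\<lambda>x. ct x * (w' i x \<bullet> gV (w x))) (\<lambda>j x. - (cc x * (x$j - p$j)) * (w' i x \<bullet> gV (w x))
      + ct x * (w'' i j x \<bullet> gV (w x) + w' i x \<bullet> D (w x) (w' j x)))" for i
    by (intro has_partials_mult has_partials_inner chi w PgV)
  have cZ: "continuous_on UNIV (?Z i)" for i
    by (intro continuous_intros) auto
  have Z: "(LINT x|lborel. ?Z i x) = 0" for i
    by (rule integral_partial_zero[OF PZ cZ]) (use supp in auto)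
  have I: "integrable lborel (?Z i)" for i
    by (rule integrable_compact_support[OF cZ, of p b]) (use supp in auto)
  have "(LINT x|lborel. ?Z 1 x + ?Z 2 x) = 0"
    by (simp only: Bochner_Integration.integral_add[OF I I] Z)
  then show ?thesis by (simp add: inner_add_left algebra_simps)
qed

section \<open>The weak Poisson equation: mollified form and passage to the limit\<close>

lemma has_partials_unique_local:
  assumes f: "has_partials f f'" and g: "has_partials g g'" and "open S" "x \<in> S" "\<And>y. y \<in> S \<Longrightarrow> f y = g y"
  shows "f' i x = g' i x"
proof -
  have "(g has_derivative (\<lambda>h. h$1 *\<^sub>R f' 1 x + h$2 *\<^sub>R f' 2 x)) (at x)"
    by (rule has_derivative_transform_within_open[OF has_partialsD[OF f] assms(3,4)]) (use assms(5) in auto)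
  from has_derivative_unique[OF this has_partialsD[OF g]]
  have "(\<lambda>h::real^2. h$1 *\<^sub>R f' 1 x + h$2 *\<^sub>R f' 2 x) = (\<lambda>h. h$1 *\<^sub>R g' 1 x + h$2 *\<^sub>R g' 2 x)" .
  from fun_cong[OF this, of "axis i 1"] show ?thesis
    using exhaust_2[of i] by (auto simp: axis_def)
qed

text \<open>The equations \<open>\<nabla>u = G\<close> and \<open>\<Delta>u = f\<close> on the disc, tested with translates of the kernels.\<close>

definition weak_poisson ::
    "real^2 \<Rightarrow> real \<Rightarrow> (real^2 \<Rightarrow> 'b::euclidean_space) \<Rightarrow> (2 \<Rightarrow> real^2 \<Rightarrow> 'b) \<Rightarrow> (real^2 \<Rightarrow> 'b) \<Rightarrow> bool" where
  "weak_poisson p R u G f \<longleftrightarrow> integrable lborel u \<and> (\<forall>i. integrable lborel (G i)) \<and> integrable lborel f \<and>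
     (\<forall>x d. 0 < d \<and> dist p x + d < R \<longrightarrow>
        (\<forall>i. conv (ker' d i) u x = conv (ker d) (G i) x) \<and>
        conv (ker' d 1) (G 1) x + conv (ker' d 2) (G 2) x = conv (ker d) f x)"

lemma weak_poisson_mollified:
  assumes wp: "weak_poisson p R u G f" and d: "0 < d" "dist p x + d < R"
  shows "conv (ker' d i) u x = conv (ker d) (G i) x"
    "conv (ker'' d 1 1) u x + conv (ker'' d 2 2) u x = conv (ker d) f x"
proof -
  show "conv (ker' d i) u x = conv (ker d) (G i) x" using wp d unfolding weak_poisson_def by blast
  have I: "integrable lborel u" "\<And>i. integrable lborel (G i)" using wp unfolding weak_poisson_def by blast+
  \<comment> \<open>The identity between first derivatives holds on the whole open disc of radius
    \<open>R - d\<close>, so it may be differentiated there.\<close>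
  have "conv (ker'' d i j) u x = conv (ker' d j) (G i) x" for i j
    by (rule has_partials_unique_local[OF conv_ker_has_partials(2)[OF d(1) I(1)] conv_ker_has_partials(1)[OF d(1) I(2)], of "ball p (R - d)"])
      (use wp d in \<open>auto simp: weak_poisson_def\<close>)
  then show "conv (ker'' d 1 1) u x + conv (ker'' d 2 2) u x = conv (ker d) f x"
    using wp d unfolding weak_poisson_def by metis
qed

text \<open>The scalar gradient estimate is applied to the component of the mollification along the
  very vector to be estimated, so no constant depending on the target dimension appears.\<close>

lemma mollified_gradient_bound:
  fixes u :: "real^2 \<Rightarrow> 'b::euclidean_space"
  assumes wp: "weak_poisson p R u G f"
    and bu: "AE x in lborel. x \<in> ball p R \<longrightarrow> norm (u x) \<le> K" and bf: "AE x in lborel. x \<in> ball p R \<longrightarrow> norm (f x) \<le> F"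
    and nn: "0 \<le> K" "0 \<le> F" and d: "0 < d" "0 < t" "dist p x + t + d < R"
  shows "norm (conv (ker' d i) u x) \<le> 4 * mcut_mass / eta_mass * (K / t) + t * F"
proof -
  have I: "integrable lborel u" "integrable lborel f" using wp unfolding weak_poisson_def by blast+
  define a where "a = conv (ker' d i) u x"
  \<comment> \<open>The value 0 in the degenerate case keeps both properties of \<open>e\<close>:
    norm at most 1 and \<open>e \<bullet> a = norm a\<close>.\<close>
  define e where "e = (if a = 0 then 0 else a /\<^sub>R norm a)"
  have e: "norm e \<le> 1" "e \<bullet> a = norm a" by (auto simp: e_def power2_norm_eq_inner[symmetric] power2_eq_square)
  have D: "dist p y + d < R" if "y \<in> cball x t" for y
    using dist_triangle[of p y x] that d by auto
  have sub: "z \<in> cball y d \<Longrightarrow> z \<in> ball p R" if "y \<in> cball x t" for y z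
    using dist_triangle[of p z y] D[OF that] by auto
  have le: "\<bar>e \<bullet> v\<bar> \<le> norm v" for v
    using Cauchy_Schwarz_ineq2[of e v] e(1) mult_right_mono[OF e(1), of "norm v"] by simp
  have P: "has_partials (\<lambda>x. e \<bullet> conv (ker d) u x) (\<lambda>i x. 0 \<bullet> conv (ker d) u x + e \<bullet> conv (ker' d i) u x)"
    "has_partials (\<lambda>x. e \<bullet> conv (ker' d i) u x) (\<lambda>j x. 0 \<bullet> conv (ker' d i) u x + e \<bullet> conv (ker'' d i j) u x)" for i
    by (intro has_partials_inner has_partials_const conv_ker_has_partials d(1) I)+
  have "\<bar>e \<bullet> conv (ker' d i) u x\<bar> \<le> 4 * mcut_mass / eta_mass * (K / t) + t * F"
  proof (rule gradient_estimate[of "\<lambda>x. e \<bullet> conv (ker d) u x" "\<lambda>i x. e \<bullet> conv (ker' d i) u x" "\<lambda>i j x. e \<bullet> conv (ker'' d i j) u x"])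
    show "continuous_on UNIV (\<lambda>x. e \<bullet> conv (ker'' d i j) u x)" for i j
      by (intro continuous_intros continuous_conv_ker'' d(1) I)
    show "(\<lambda>x. e \<bullet> conv (ker'' d i j) u x) = (\<lambda>x. e \<bullet> conv (ker'' d j i) u x)" for i j
      by (subst ker''_sym) (rule refl)
    fix y assume y: "y \<in> cball x t"
    have "norm (conv (ker d) u y) \<le> K"
      by (rule norm_conv_le[OF mollifier_ker[OF d(1)] I(1) _ nn(1)]) (use bu sub[OF y] in \<open>auto elim: eventually_mono\<close>)
    then show "\<bar>e \<bullet> conv (ker d) u y\<bar> \<le> K" using le order_trans by blast
    have "norm (conv (ker d) f y) \<le> F"
      by (rule norm_conv_le[OF mollifier_ker[OF d(1)] I(2) _ nn(2)]) (use bf sub[OF y] in \<open>auto elim: eventually_mono\<close>)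
    then show "\<bar>e \<bullet> conv (ker'' d 1 1) u y + e \<bullet> conv (ker'' d 2 2) u y\<bar> \<le> F"
      using le[of "conv (ker d) f y"] weak_poisson_mollified(2)[OF wp d(1) D[OF y]]
      by (simp flip: inner_add_right)
  qed (use P d in simp_all)
  then show ?thesis using e by (simp flip: a_def)
qed

lemma integrable_bounded_on_cball:
  fixes f :: "real^2 \<Rightarrow> 'b::euclidean_space"
  assumes [measurable]: "f \<in> borel_measurable borel"
    and "AE x in lborel. x \<in> cball p b \<longrightarrow> norm (f x) \<le> M" "\<And>x. x \<notin> cball p b \<Longrightarrow> f x = 0"
  shows "integrable lborel f"
proof (rule Bochner_Integration.integrable_bound)
  show "integrable lborel (\<lambda>x. indicator (cball p b) x *\<^sub>R M)"
    using emeasure_bounded_finite[OF bounded_cball, of p b]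
    by (intro integrable_scaleR_left integrable_real_indicator) auto
  show "AE x in lborel. norm (f x) \<le> norm (indicator (cball p b) x *\<^sub>R M)"
    using assms(2) by eventually_elim (use assms(3) in \<open>auto simp: indicator_def\<close>)
qed simp

text \<open>The integrand is a continuous function of a tuple that stays in a fixed compact set over
  the disc, so a constant dominates. Both integral identities pass to the limit through this
  statement.\<close>

lemma compact_dominated_convergence:
  fixes J :: "'e::euclidean_space \<Rightarrow> real" and s :: "nat \<Rightarrow> real^2 \<Rightarrow> 'e"
  assumes J: "continuous_on UNIV J" and "\<And>n. s n \<in> borel_measurable borel" "s' \<in> borel_measurable borel"
    and S: "compact S" "\<And>n x. x \<in> cball p b \<Longrightarrow> s n x \<in> S"
    and lim: "AE x in lborel. (\<lambda>n. s n x) \<longlonglongrightarrow> s' x"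
  shows "(\<lambda>n. LINT x|lborel. indicator (cball p b) x * J (s n x)) \<longlonglongrightarrow> (LINT x|lborel. indicator (cball p b) x * J (s' x))"
proof -
  have Jm: "J \<in> borel_measurable borel" using J by (rule borel_measurable_continuous_onI)
  have "bounded (J ` S)" using J S by (intro compact_imp_bounded compact_continuous_image continuous_on_subset[OF J]) auto
  then obtain M where M: "\<And>y. y \<in> S \<Longrightarrow> \<bar>J y\<bar> \<le> M" unfolding bounded_iff by auto
  show ?thesis
  proof (rule integral_dominated_convergence[where w="\<lambda>x. indicator (cball p b) x *\<^sub>R M"])
    show "integrable lborel (\<lambda>x. indicator (cball p b) x *\<^sub>R M)"
      using emeasure_bounded_finite[OF bounded_cball, of p b]
      by (intro integrable_scaleR_left integrable_real_indicator) auto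
    show "AE x in lborel. (\<lambda>n. indicator (cball p b) x * J (s n x)) \<longlonglongrightarrow> indicator (cball p b) x * J (s' x)"
      using lim
    proof eventually_elim
      case (elim x)
      have "isCont J (s' x)" using J by (simp add: continuous_on_eq_continuous_at)
      then have "(\<lambda>n. J (s n x)) \<longlonglongrightarrow> J (s' x)" using elim by (rule isCont_tendsto_compose)
      then show ?case by (intro tendsto_intros)
    qed
    show "AE x in lborel. norm (indicator (cball p b) x * J (s n x)) \<le> indicator (cball p b) x *\<^sub>R M" for n
      using M S by (intro AE_I2) (auto simp: indicator_def)
    have "(\<lambda>x. J (s n x)) \<in> borel_measurable borel" "(\<lambda>x. J (s' x)) \<in> borel_measurable borel" for n
      using measurable_compose[OF assms(2) Jm] measurable_compose[OF assms(3) Jm] by auto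
    then show "(\<lambda>x. indicator (cball p b) x * J (s' x)) \<in> borel_measurable lborel"
      "(\<lambda>x. indicator (cball p b) x * J (s n x)) \<in> borel_measurable lborel" for n
      by (auto intro!: borel_measurable_times borel_measurable_indicator borel_closed)
  qed
qed

text \<open>Second derivatives occur in the two identities only through the Laplacian, and the
  Laplacian of a mollification of \<open>u\<close> is a mollification of \<open>f\<close>. The limit
  therefore asks only for almost everywhere convergence of \<open>u\<close>, \<open>G\<close> and
  \<open>f\<close> under uniform bounds.\<close>

lemma weak_poisson_limit:
  fixes u :: "real^2 \<Rightarrow> 'b::euclidean_space"
  assumes wp: "weak_poisson p R u G f"
    and bu: "AE x in lborel. x \<in> ball p R \<longrightarrow> norm (u x) \<le> K" and bf: "AE x in lborel. x \<in> ball p R \<longrightarrow> norm (f x) \<le> F"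
    and nn: "0 \<le> K" "0 \<le> F" and t: "0 < t" "b + t < R"
    and V: "\<And>y. (V has_derivative (\<lambda>h. gV y \<bullet> h)) (at y)"
    and gV: "\<And>y. (gV has_derivative D y) (at y)" and cD: "continuous_on UNIV (\<lambda>(y, h). D y h)"
    and ct: "has_partials ct (\<lambda>i x. - (cc x * (x$i - p$i)))" and ccc: "continuous_on UNIV cc"
    and supp: "\<And>x. x \<notin> cball p b \<Longrightarrow> ct x = 0" "\<And>x. x \<notin> cball p b \<Longrightarrow> cc x = 0"
  defines "X \<equiv> \<lambda>x. (x$1 - p$1) *\<^sub>R G 1 x + (x$2 - p$2) *\<^sub>R G 2 x"
  shows "AE x in lborel. x \<in> cball p b \<longrightarrow> norm (G i x) \<le> 4 * mcut_mass / eta_mass * (K / t) + t * F" (is ?th1)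
    and "(LINT x|lborel. ct x * (2 * \<kappa> * V (u x)) - ct x * ((f x - \<kappa> *\<^sub>R gV (u x)) \<bullet> X x)
      + cc x * ((norm (X x))\<^sup>2 - (norm (x - p))\<^sup>2 * (((norm (G 1 x))\<^sup>2 + (norm (G 2 x))\<^sup>2) / 2 + \<kappa> * V (u x)))) = 0" (is ?th2)
    and "(LINT x|lborel. ct x * (f x \<bullet> gV (u x) + (G 1 x \<bullet> D (u x) (G 1 x) + G 2 x \<bullet> D (u x) (G 2 x)))
      - cc x * (X x \<bullet> gV (u x))) = 0" (is ?th3)
proof -
  define L where "L = 4 * mcut_mass / eta_mass * (K / t) + t * F"
  have I: "integrable lborel u" "\<And>i. integrable lborel (G i)" "integrable lborel f"
    using wp unfolding weak_poisson_def by blast+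
  have [measurable]: "u \<in> borel_measurable borel" "\<And>i. G i \<in> borel_measurable borel" "f \<in> borel_measurable borel"
    using I by auto
  have cgV: "continuous_on UNIV gV" using gV by (auto intro!: continuous_at_imp_continuous_on has_derivative_continuous)
  have cV: "continuous_on UNIV V" using V by (auto intro!: continuous_at_imp_continuous_on has_derivative_continuous)
  have cct: "continuous_on UNIV ct" by (rule has_partials_continuous[OF ct])
  \<comment> \<open>Bundling the four functions makes one sequence of radii serve all of them almost
    everywhere.\<close>
  define g where "g x = (u x, G 1 x, G 2 x, f x)" for x
  have ig: "integrable lborel g"
  proof (rule Bochner_Integration.integrable_bound)
    show "integrable lborel (\<lambda>x. norm (u x) + (norm (G 1 x) + (norm (G 2 x) + norm (f x))))"
      by (intro Bochner_Integration.integrable_add integrable_norm I)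
    show "g \<in> borel_measurable lborel" unfolding g_def by measurable
    show "AE x in lborel. norm (g x) \<le> norm (norm (u x) + (norm (G 1 x) + (norm (G 2 x) + norm (f x))))"
    proof (rule AE_I2)
      fix x
      have "norm (g x) \<le> norm (u x) + (norm (G 1 x) + (norm (G 2 x) + norm (f x)))"
        unfolding g_def
        by (intro order_trans[OF norm_Pair_le] add_left_mono order_refl)
      then show "norm (g x) \<le> norm (norm (u x) + (norm (G 1 x) + (norm (G 2 x) + norm (f x))))" by simp
    qed
  qed
  \<comment> \<open>Radii below this gap leave room for the gradient estimate on discs of radius
    \<open>t\<close> about the points of \<open>cball p b\<close>.\<close>
  have "0 < R - b - t" using t by simp
  have "\<exists>d. (\<forall>n::nat. 0 < d n \<and> d n < R - b - t) \<and> (AE x in lborel. (\<lambda>n. conv (ker (d n)) g x) \<longlonglongrightarrow> g x)"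
    by (rule mollify_AE_subseq[OF ig \<open>0 < R - b - t\<close>], rule exI, rule conjI) auto
  then obtain d where d: "\<And>n. 0 < d n" "\<And>n::nat. d n < R - b - t"
    and lim: "AE x in lborel. (\<lambda>n. conv (ker (d n)) g x) \<longlonglongrightarrow> g x"
    by blast
  have Ig: "integrable lborel (\<lambda>y. ker (d n) (x - y) *\<^sub>R g y)" for n x
    by (rule integrable_conv_kernel[OF ig continuous_ker(1), of "d n"]) (use d(1)[of n] in \<open>auto intro!: ker_outside\<close>)
  have conv_g: "conv (ker (d n)) g x = (conv (ker (d n)) u x, conv (ker (d n)) (G 1) x, conv (ker (d n)) (G 2) x, conv (ker (d n)) f x)" for n x
    using integral_bounded_linear[OF bounded_linear_fst Ig[of n x]]
      integral_bounded_linear[OF bounded_linear_compose[OF bounded_linear_fst bounded_linear_snd] Ig[of n x]]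
      integral_bounded_linear[OF bounded_linear_compose[OF bounded_linear_fst bounded_linear_compose[OF bounded_linear_snd bounded_linear_snd]] Ig[of n x]]
      integral_bounded_linear[OF bounded_linear_compose[OF bounded_linear_snd bounded_linear_compose[OF bounded_linear_snd bounded_linear_snd]] Ig[of n x]]
    unfolding conv_def by (simp add: g_def prod_eq_iff)
  define w where "w n = conv (ker (d n)) u" for n
  define w' where "w' n i = conv (ker' (d n) i) u" for n i
  define w'' where "w'' n i j = conv (ker'' (d n) i j) u" for n i j
  have P: "has_partials (w n) (w' n)" "has_partials (w' n i) (w'' n i)" for n i
    unfolding w_def w'_def w''_def by (intro conv_ker_has_partials d(1) I)+
  have C: "continuous_on UNIV (w'' n i j)" for n i j unfolding w''_def by (intro continuous_conv_ker'' d(1) I)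
  have sym: "w'' n i j = w'' n j i" for n i j unfolding w''_def by (subst ker''_sym) (rule refl)
  have dR: "dist p x + t + d n < R" if "x \<in> cball p b" for x n using that d(2)[of n] by simp
  have dR': "dist p x + d n < R" if "x \<in> cball p b" for x n using dR[OF that, of n] t by simp
  have gG: "w' n i x = conv (ker (d n)) (G i) x" "w'' n 1 1 x + w'' n 2 2 x = conv (ker (d n)) f x" if "x \<in> cball p b" for n i x
    unfolding w'_def w''_def using weak_poisson_mollified[OF wp d(1) dR'[OF that]] by auto
  have bw': "norm (w' n i x) \<le> L" if "x \<in> cball p b" for n i x
    unfolding w'_def L_def by (rule mollified_gradient_bound[OF wp bu bf nn d(1) t(1) dR[OF that]])
  have sub: "z \<in> ball p R" if "x \<in> cball p b" "z \<in> cball x (d n)" for x z n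
    using dist_triangle[of p z x] dR'[OF that(1), of n] that(2) by auto
  have bw: "norm (w n x) \<le> K" if "x \<in> cball p b" for n x
    unfolding w_def
    by (rule norm_conv_le[OF mollifier_ker[OF d(1)] I(1) _ nn(1)]) (use bu sub[OF that] in \<open>auto elim: eventually_mono\<close>)
  have bl: "norm (conv (ker (d n)) f x) \<le> F" if "x \<in> cball p b" for n x
    by (rule norm_conv_le[OF mollifier_ker[OF d(1)] I(3) _ nn(2)]) (use bf sub[OF that] in \<open>auto elim: eventually_mono\<close>)
  show ?th1
    using lim unfolding L_def[symmetric]
  proof eventually_elim
    case (elim x)
    show ?case
    proof
      assume x: "x \<in> cball p b"
      have "(\<lambda>n. conv (ker (d n)) (G i) x) \<longlonglongrightarrow> G i x"
        using tendsto_fst[OF tendsto_snd[OF elim]] tendsto_fst[OF tendsto_snd[OF tendsto_snd[OF elim]]] exhaust_2[of i]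
        unfolding conv_g g_def by auto
      then have "(\<lambda>n. norm (conv (ker (d n)) (G i) x)) \<longlonglongrightarrow> norm (G i x)" by (rule tendsto_norm)
      then show "norm (G i x) \<le> L"
        by (rule LIMSEQ_le_const2) (use bw'[OF x] gG[OF x] in auto)
    qed
  qed
  have cc1: "continuous_on UNIV (\<lambda>x. conv (ker (d n)) h x)" if "integrable lborel h" for h :: "real^2 \<Rightarrow> 'b" and n
    by (rule has_partials_continuous[OF conv_ker_has_partials(1)[OF d(1) that]])
  have cmeas[measurable]: "conv (ker (d n)) u \<in> borel_measurable borel" "conv (ker (d n)) (G i) \<in> borel_measurable borel"
     "conv (ker (d n)) f \<in> borel_measurable borel" for n i
    by (intro borel_measurable_continuous_onI cc1 I)+
  define s where "s n x = (x, conv (ker (d n)) g x)" for n x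
  define s' where "s' x = (x, g x)" for x
  have sm[measurable]: "s n \<in> borel_measurable borel" "s' \<in> borel_measurable borel" for n
  proof -
    have "conv (ker (d n)) g \<in> borel_measurable borel"
      by (rule borel_measurable_continuous_onI[OF has_partials_continuous[OF conv_ker_has_partials(1)[OF d(1) ig]]])
    moreover have "g \<in> borel_measurable borel" using ig by auto
    ultimately show "s n \<in> borel_measurable borel" "s' \<in> borel_measurable borel"
      unfolding s_def s'_def by (auto intro!: borel_measurable_Pair)
  qed
  define S where "S = cball p b \<times> cball (0::'b) K \<times> cball (0::'b) L \<times> cball (0::'b) L \<times> cball (0::'b) F"
  have S: "compact S" "\<And>n x. x \<in> cball p b \<Longrightarrow> s n x \<in> S"
    unfolding S_def s_def conv_g using bw bw' bl gG(1)
    by (auto intro!: compact_Times simp: w_def)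
  have slim: "AE x in lborel. (\<lambda>n. s n x) \<longlonglongrightarrow> s' x"
    using lim unfolding s_def s'_def by eventually_elim (intro tendsto_intros)
  have zero: "(LINT x|lborel. indicator (cball p b) x * J (s' x)) = 0"
    if J: "continuous_on UNIV J" "\<And>n. (LINT x|lborel. indicator (cball p b) x * J (s n x)) = 0" for J :: "_ \<Rightarrow> real"
  proof -
    have "(\<lambda>n. LINT x|lborel. indicator (cball p b) x * J (s n x)) \<longlonglongrightarrow> (LINT x|lborel. indicator (cball p b) x * J (s' x))"
      by (rule compact_dominated_convergence[OF J(1) sm S(1) _ slim]) (rule S(2))
    then show ?thesis unfolding J(2) by (simp add: LIMSEQ_const_iff)
  qed
  note [continuous_intros] = continuous_on_compose2[OF cgV] continuous_on_compose2[OF cV] continuous_on_compose2[OF cct] continuous_on_compose2[OF ccc]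
  have cD': "continuous_on A (\<lambda>x. D (h x) (k x))" if "continuous_on A h" "continuous_on A k" for h k and A :: "'z::topological_space set"
    using continuous_on_compose2[OF cD continuous_on_Pair[OF that]] by simp
  show ?th2
  proof -
    define J where "J = (\<lambda>(x, a, A1, A2, l). ct x * (2 * \<kappa> * V a) - ct x * ((l - \<kappa> *\<^sub>R gV a) \<bullet> ((x$1 - p$1) *\<^sub>R A1 + (x$2 - p$2) *\<^sub>R A2))
      + cc x * ((norm ((x$1 - p$1) *\<^sub>R A1 + (x$2 - p$2) *\<^sub>R A2))\<^sup>2 - (norm (x - p))\<^sup>2 * (((norm A1)\<^sup>2 + (norm A2)\<^sup>2) / 2 + \<kappa> * V a)))"
    have "(LINT x|lborel. indicator (cball p b) x * J (s' x)) = 0"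
    proof (rule zero)
      show "continuous_on UNIV J" unfolding J_def case_prod_beta by (intro continuous_intros) auto
      fix n
      have "(LINT x|lborel. indicator (cball p b) x * J (s n x)) = (LINT x|lborel. ct x * (2 * \<kappa> * V (w n x))
         - ct x * ((w'' n 1 1 x + w'' n 2 2 x - \<kappa> *\<^sub>R gV (w n x)) \<bullet> ((x$1 - p$1) *\<^sub>R w' n 1 x + (x$2 - p$2) *\<^sub>R w' n 2 x))
         + cc x * ((norm ((x$1 - p$1) *\<^sub>R w' n 1 x + (x$2 - p$2) *\<^sub>R w' n 2 x))\<^sup>2
         - (norm (x - p))\<^sup>2 * (((norm (w' n 1 x))\<^sup>2 + (norm (w' n 2 x))\<^sup>2) / 2 + \<kappa> * V (w n x))))"
      proof (intro Bochner_Integration.integral_cong refl, goal_cases)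
        case (1 x)
        then show ?case
          using gG[of x n] supp[of x] by (cases "x \<in> cball p b") (simp_all add: J_def s_def conv_g w_def)
      qed
      also have "\<dots> = 0"
        by (rule pohozaev_identity[OF P C sym V cgV ct ccc supp])
      finally show "(LINT x|lborel. indicator (cball p b) x * J (s n x)) = 0" .
    qed
    also have "(\<lambda>x. indicator (cball p b) x * J (s' x)) = (\<lambda>x. ct x * (2 * \<kappa> * V (u x)) - ct x * ((f x - \<kappa> *\<^sub>R gV (u x)) \<bullet> X x)
      + cc x * ((norm (X x))\<^sup>2 - (norm (x - p))\<^sup>2 * (((norm (G 1 x))\<^sup>2 + (norm (G 2 x))\<^sup>2) / 2 + \<kappa> * V (u x))))"
    proof
      fix x
      show "indicator (cball p b) x * J (s' x) = ct x * (2 * \<kappa> * V (u x)) - ct x * ((f x - \<kappa> *\<^sub>R gV (u x)) \<bullet> X x)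
      + cc x * ((norm (X x))\<^sup>2 - (norm (x - p))\<^sup>2 * (((norm (G 1 x))\<^sup>2 + (norm (G 2 x))\<^sup>2) / 2 + \<kappa> * V (u x)))"
        using supp[of x] by (cases "x \<in> cball p b") (simp_all add: J_def s'_def g_def X_def)
    qed
    finally show ?thesis .
  qed
  show ?th3
  proof -
    define J where "J = (\<lambda>(x, a, A1, A2, l). ct x * (l \<bullet> gV a + (A1 \<bullet> D a A1 + A2 \<bullet> D a A2))
      - cc x * (((x$1 - p$1) *\<^sub>R A1 + (x$2 - p$2) *\<^sub>R A2) \<bullet> gV a))"
    have "(LINT x|lborel. indicator (cball p b) x * J (s' x)) = 0"
    proof (rule zero)
      show "continuous_on UNIV J" unfolding J_def case_prod_beta by (intro continuous_intros cD') auto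
      fix n
      have "(LINT x|lborel. indicator (cball p b) x * J (s n x)) = (LINT x|lborel. ct x * ((w'' n 1 1 x + w'' n 2 2 x) \<bullet> gV (w n x)
         + (w' n 1 x \<bullet> D (w n x) (w' n 1 x) + w' n 2 x \<bullet> D (w n x) (w' n 2 x)))
         - cc x * (((x$1 - p$1) *\<^sub>R w' n 1 x + (x$2 - p$2) *\<^sub>R w' n 2 x) \<bullet> gV (w n x)))"
      proof (intro Bochner_Integration.integral_cong refl, goal_cases)
        case (1 x)
        then show ?case
          using gG[of x n] supp[of x] by (cases "x \<in> cball p b") (simp_all add: J_def s_def conv_g w_def)
      qed
      also have "\<dots> = 0"
        by (rule gradient_test_identity[OF P C gV cD ct ccc supp])
      finally show "(LINT x|lborel. indicator (cball p b) x * J (s n x)) = 0" .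
    qed
    also have "(\<lambda>x. indicator (cball p b) x * J (s' x)) = (\<lambda>x. ct x * (f x \<bullet> gV (u x) + (G 1 x \<bullet> D (u x) (G 1 x) + G 2 x \<bullet> D (u x) (G 2 x)))
      - cc x * (X x \<bullet> gV (u x)))"
    proof
      fix x
      show "indicator (cball p b) x * J (s' x) = ct x * (f x \<bullet> gV (u x) + (G 1 x \<bullet> D (u x) (G 1 x) + G 2 x \<bullet> D (u x) (G 2 x)))
      - cc x * (X x \<bullet> gV (u x))"
        using supp[of x] by (cases "x \<in> cball p b") (simp_all add: J_def s'_def g_def X_def)
    qed
    finally show ?thesis .
  qed
qed

section \<open>The local energy estimate\<close>

text \<open>The gradient part is absorbed by the potential part and this by the annulus, whence the
  factor \<open>C * C1\<^sup>2 / l + 1\<close>. The term with \<open>sqrt \<epsilon>\<close> is the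
  annulus contribution of the second test.\<close>

lemma energy_estimate:
  fixes u :: "real^2 \<Rightarrow> 'b::euclidean_space"
  assumes wp: "weak_poisson p R u G f" and eps: "0 < \<epsilon>" "b + \<epsilon> < R" and b: "0 < b"
    and bu: "AE x in lborel. x \<in> ball p R \<longrightarrow> norm (u x) \<le> K" and K: "0 \<le> K"
    and ff: "AE x in lborel. x \<in> ball p R \<longrightarrow> f x = (1 / \<epsilon>\<^sup>2) *\<^sub>R gV (u x)"
    and V: "\<And>y. (V has_derivative (\<lambda>h. gV y \<bullet> h)) (at y)" and V0: "\<And>y. 0 \<le> V y"
    and gV: "\<And>y. (gV has_derivative D y) (at y)" and cD: "continuous_on UNIV (\<lambda>(y, h). D y h)"
    and B: "\<And>y. norm y \<le> K \<Longrightarrow> norm (gV y) \<le> B"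
    and coer: "\<And>y h. norm y \<le> K \<Longrightarrow> h \<bullet> D y h \<ge> (l - C * V y) * (norm h)\<^sup>2" and lC: "0 < l" "0 \<le> C"
    and ct: "has_partials ct (\<lambda>i x. - (cc x * (x$i - p$i)))" and ccc: "continuous_on UNIV cc"
    and supp: "\<And>x. x \<notin> cball p b \<Longrightarrow> ct x = 0" "\<And>x. x \<notin> cball p b \<Longrightarrow> cc x = 0"
    and nonneg: "\<And>x. 0 \<le> ct x" "\<And>x. 0 \<le> cc x"
  defines "e \<equiv> \<lambda>x. \<epsilon> * (((norm (G 1 x))\<^sup>2 + (norm (G 2 x))\<^sup>2) / 2) + (1 / \<epsilon>) * V (u x)"
    and "C1 \<equiv> 4 * mcut_mass / eta_mass * K + B"
  shows "integrable lborel (\<lambda>x. ct x * e x)" "integrable lborel (\<lambda>x. cc x * e x)"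
    "(LINT x|lborel. ct x * e x) \<le> ((C * C1\<^sup>2 / l + 1) * b\<^sup>2 / 2) * (LINT x|lborel. cc x * e x)
       + B * b / (2 * l) * sqrt \<epsilon> * ((LINT x|lborel. cc x) + (LINT x|lborel. cc x * e x))"
proof -
  define F where "F = (1 / \<epsilon>\<^sup>2) * B"
  have "norm (gV 0) \<le> B" using B[of 0] K by simp
  then have B0: "0 \<le> B" using norm_ge_zero[of "gV 0"] by linarith
  have F0: "0 \<le> F" using B0 by (simp add: F_def)
  have bf: "AE x in lborel. x \<in> ball p R \<longrightarrow> norm (f x) \<le> F"
    using ff bu by eventually_elim (use B eps in \<open>auto simp: F_def divide_simps\<close>)
  \<comment> \<open>The gradient bound at scale \<open>\<epsilon>\<close>: the Laplacian has size at
    most \<open>B / \<epsilon>\<^sup>2\<close>, so both summands are of order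
    \<open>1 / \<epsilon>\<close> and combine to \<open>C1 / \<epsilon>\<close>.\<close>
  define L where "L = 4 * mcut_mass / eta_mass * (K / \<epsilon>) + \<epsilon> * F"
  have L: "L = C1 / \<epsilon>" using eps by (simp add: L_def F_def C1_def field_simps power2_eq_square)
  note lim = weak_poisson_limit[OF wp bu bf K F0 eps V gV cD ct ccc]
  have GL: "AE x in lborel. x \<in> cball p b \<longrightarrow> norm (G i x) \<le> L" for i
    unfolding L_def by (rule lim(1)) (fact supp)+
  have I: "integrable lborel u" "\<And>i. integrable lborel (G i)" "integrable lborel f"
    using wp unfolding weak_poisson_def by blast+
  have cgV: "continuous_on UNIV gV" using gV by (auto intro!: continuous_at_imp_continuous_on has_derivative_continuous)
  have cV: "continuous_on UNIV V" using V by (auto intro!: continuous_at_imp_continuous_on has_derivative_continuous)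
  have cct: "continuous_on UNIV ct" by (rule has_partials_continuous[OF ct])
  have [measurable]: "u \<in> borel_measurable borel" "\<And>i. G i \<in> borel_measurable borel" "f \<in> borel_measurable borel"
     "gV \<in> borel_measurable borel" "V \<in> borel_measurable borel" "ct \<in> borel_measurable borel" "cc \<in> borel_measurable borel"
    using I by (auto intro!: borel_measurable_continuous_onI cgV cV cct ccc)
  have Dm: "(\<lambda>x. D (u x) (G i x)) \<in> borel_measurable borel" for i
  proof -
    have "(\<lambda>(y, h). D y h) \<in> borel_measurable borel" using cD by (rule borel_measurable_continuous_onI)
    moreover have "(\<lambda>x. (u x, G i x)) \<in> borel_measurable borel" by (intro borel_measurable_Pair) measurable
    ultimately show ?thesis using measurable_compose[of "\<lambda>x. (u x, G i x)" borel borel "\<lambda>(y, h). D y h" borel] by simp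
  qed
  obtain Mt where Mt: "\<And>x. norm (ct x) \<le> Mt" using bounded_compact_support[OF cct supp(1)] by metis
  obtain Mc where Mc: "\<And>x. norm (cc x) \<le> Mc" using bounded_compact_support[OF ccc supp(2)] by metis
  have "bounded (V ` cball 0 K)" by (intro compact_imp_bounded compact_continuous_image continuous_on_subset[OF cV]) auto
  then obtain MV where "\<forall>z\<in>V ` cball 0 K. norm z \<le> MV" unfolding bounded_iff by blast
  then have "norm (V y) \<le> MV" if "y \<in> cball 0 K" for y using that by blast
  then have MV: "V y \<le> MV" if "norm y \<le> K" for y using that by fastforce
  have "compact (cball (0::'b) K \<times> cball (0::'b) L)" by (intro compact_Times compact_cball)
  moreover have "continuous_on UNIV (\<lambda>z. snd z \<bullet> D (fst z) (snd z))"
    using cD by (intro continuous_intros) (simp add: case_prod_beta')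
  ultimately have "bounded ((\<lambda>z. snd z \<bullet> D (fst z) (snd z)) ` (cball 0 K \<times> cball 0 L))"
    by (intro compact_imp_bounded compact_continuous_image) (auto intro: continuous_on_subset)
  then obtain MD where MD': "\<forall>z\<in>(\<lambda>z. snd z \<bullet> D (fst z) (snd z)) ` (cball 0 K \<times> cball 0 L). norm z \<le> MD"
    unfolding bounded_iff by blast
  have MD: "\<bar>h \<bullet> D y h\<bar> \<le> MD" if "norm y \<le> K" "norm h \<le> L" for y h
  proof -
    have "(y, h) \<in> cball 0 K \<times> cball 0 L" using that by simp
    then have "norm (snd (y, h) \<bullet> D (fst (y, h)) (snd (y, h))) \<le> MD" using MD' by blast
    then show ?thesis by simp
  qed
  have pt: "AE x in lborel. x \<in> cball p b \<longrightarrow> norm (u x) \<le> K \<and> f x = (1 / \<epsilon>\<^sup>2) *\<^sub>R gV (u x) \<and> norm (G 1 x) \<le> L \<and> norm (G 2 x) \<le> L"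
    using bu ff GL[of 1] GL[of 2]
    by eventually_elim (use eps in auto)
  have int: "integrable lborel (\<lambda>x. k x * h x)"
    if "k = ct \<or> k = cc" "h \<in> borel_measurable borel" "AE x in lborel. x \<in> cball p b \<longrightarrow> \<bar>h x\<bar> \<le> M" for k h M
  proof (rule integrable_bounded_on_cball[of _ p b "max Mt Mc * M"])
    show "(\<lambda>x. k x * h x) \<in> borel_measurable borel" using that(1,2) by auto
    show "AE x in lborel. x \<in> cball p b \<longrightarrow> norm (k x * h x) \<le> max Mt Mc * M"
      using that(3)
    proof eventually_elim
      case (elim x)
      have "\<bar>k x\<bar> \<le> max Mt Mc" using that(1) Mt[of x] Mc[of x] by auto
      then show ?case using elim by (auto simp: abs_mult intro!: mult_mono intro: order_trans[OF abs_ge_zero])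
    qed
    show "x \<notin> cball p b \<Longrightarrow> k x * h x = 0" for x using that(1) supp by auto
  qed
  define g2 where "g2 x = (norm (G 1 x))\<^sup>2 + (norm (G 2 x))\<^sup>2" for x
  have g2: "0 \<le> g2 x" for x by (simp add: g2_def)
  have [measurable]: "g2 \<in> borel_measurable borel" "e \<in> borel_measurable borel" unfolding g2_def[abs_def] e_def by measurable
  have e_eq: "e x = \<epsilon> * (g2 x / 2) + (1 / \<epsilon>) * V (u x)" for x by (simp add: e_def g2_def)
  have g2L: "AE x in lborel. x \<in> cball p b \<longrightarrow> \<bar>g2 x\<bar> \<le> 2 * L\<^sup>2"
    using pt
  proof eventually_elim
    case (elim x)
    show ?case
    proof
      assume "x \<in> cball p b"
      then have "(norm (G 1 x))\<^sup>2 \<le> L\<^sup>2" "(norm (G 2 x))\<^sup>2 \<le> L\<^sup>2" using elim by (auto intro: power_mono)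
      then show "\<bar>g2 x\<bar> \<le> 2 * L\<^sup>2" using g2[of x] unfolding g2_def by simp
    qed
  qed
  have VMV: "AE x in lborel. x \<in> cball p b \<longrightarrow> \<bar>V (u x)\<bar> \<le> MV"
    using pt by eventually_elim (use MV V0 in auto)
  have eM: "AE x in lborel. x \<in> cball p b \<longrightarrow> \<bar>e x\<bar> \<le> \<epsilon> * L\<^sup>2 + (1 / \<epsilon>) * MV"
    using g2L VMV
  proof eventually_elim
    case (elim x)
    show ?case
    proof
      assume "x \<in> cball p b"
      then have "\<epsilon> * (g2 x / 2) \<le> \<epsilon> * L\<^sup>2" "(1 / \<epsilon>) * V (u x) \<le> (1 / \<epsilon>) * MV"
        using elim eps by (auto intro!: mult_left_mono divide_right_mono)
      moreover have "0 \<le> e x" unfolding e_eq using g2[of x] V0[of "u x"] eps by simp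
      ultimately show "\<bar>e x\<bar> \<le> \<epsilon> * L\<^sup>2 + (1 / \<epsilon>) * MV" unfolding e_eq by simp
    qed
  qed
  have e0: "0 \<le> e x" for x unfolding e_eq using g2[of x] V0[of "u x"] eps by simp
  show Ite: "integrable lborel (\<lambda>x. ct x * e x)" and Ice: "integrable lborel (\<lambda>x. cc x * e x)"
    by (rule int[OF _ _ eM]; simp)+
  have ItV: "integrable lborel (\<lambda>x. ct x * V (u x))" by (rule int[OF _ _ VMV]) simp_all
  have Itg: "integrable lborel (\<lambda>x. ct x * g2 x)" by (rule int[OF _ _ g2L]) simp_all
  have Icc: "integrable lborel cc" by (rule integrable_compact_support[OF ccc supp(2)])
  define X where "X x = (x$1 - p$1) *\<^sub>R G 1 x + (x$2 - p$2) *\<^sub>R G 2 x" for x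
  have [measurable]: "X \<in> borel_measurable borel" unfolding X_def[abs_def] by measurable
  have comp: "\<bar>x$i - p$i\<bar> \<le> b" if "x \<in> cball p b" for x i
    using component_le_norm_cart[of "x - p" i] that by (simp add: dist_norm norm_minus_commute)
  have Xb: "norm (X x) \<le> b * (norm (G 1 x) + norm (G 2 x))" if "x \<in> cball p b" for x
  proof -
    have "norm (X x) \<le> \<bar>x$1 - p$1\<bar> * norm (G 1 x) + \<bar>x$2 - p$2\<bar> * norm (G 2 x)"
      unfolding X_def by (rule order_trans[OF norm_triangle_ineq]) simp
    also have "\<dots> \<le> b * norm (G 1 x) + b * norm (G 2 x)"
      using comp[OF that] by (intro add_mono mult_right_mono) auto
    finally show ?thesis by (simp add: algebra_simps)
  qed
  \<comment> \<open>With \<kappa> equal to \<open>1 / \<epsilon>\<^sup>2\<close> the equation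
    removes the middle term of the identity. In the annulus \<open>(norm (X x))\<^sup>2\<close> has
    the good sign and is dropped; the factor \<open>b\<^sup>2\<close> comes from bounding
    \<open>(norm (x - p))\<^sup>2\<close>.\<close>
  have pot: "(2 / \<epsilon>) * (LINT x|lborel. ct x * V (u x)) \<le> b\<^sup>2 * (LINT x|lborel. cc x * e x)"
  proof -
    let ?Q = "\<lambda>x. (norm (X x))\<^sup>2 - (norm (x - p))\<^sup>2 * (g2 x / 2 + (1 / \<epsilon>\<^sup>2) * V (u x))"
    let ?J = "\<lambda>x. ct x * (2 * (1 / \<epsilon>\<^sup>2) * V (u x)) - ct x * ((f x - (1 / \<epsilon>\<^sup>2) *\<^sub>R gV (u x)) \<bullet> X x) + cc x * ?Q x"
    have J0: "(LINT x|lborel. ?J x) = 0"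
      unfolding X_def g2_def by (rule lim(2)) (fact supp)+
    have Qb: "- ?Q x \<le> b\<^sup>2 * (e x / \<epsilon>)" if "x \<in> cball p b" for x
    proof -
      have "(norm (x - p))\<^sup>2 \<le> b\<^sup>2" using that by (intro power_mono) (auto simp: dist_norm norm_minus_commute)
      then have "(norm (x - p))\<^sup>2 * (g2 x / 2 + (1 / \<epsilon>\<^sup>2) * V (u x)) \<le> b\<^sup>2 * (g2 x / 2 + (1 / \<epsilon>\<^sup>2) * V (u x))"
        using g2[of x] V0[of "u x"] by (intro mult_right_mono) auto
      moreover have eq: "g2 x / 2 + (1 / \<epsilon>\<^sup>2) * V (u x) = e x / \<epsilon>"
        unfolding e_eq using eps by (simp add: field_simps power2_eq_square)
      moreover have "0 \<le> (norm (X x))\<^sup>2" by simp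
      ultimately show ?thesis unfolding eq by linarith
    qed
    have IQ: "integrable lborel (\<lambda>x. cc x * ?Q x)"
    proof (rule int[where M="(b * (2 * L))\<^sup>2 + b\<^sup>2 * ((\<epsilon> * L\<^sup>2 + (1 / \<epsilon>) * MV) / \<epsilon>)"])
      show "AE x in lborel. x \<in> cball p b \<longrightarrow> \<bar>?Q x\<bar> \<le> (b * (2 * L))\<^sup>2 + b\<^sup>2 * ((\<epsilon> * L\<^sup>2 + (1 / \<epsilon>) * MV) / \<epsilon>)"
        using pt eM
      proof eventually_elim
        case (elim x)
        show ?case
        proof
          assume x: "x \<in> cball p b"
          have "norm (X x) \<le> b * (2 * L)"
            using elim x b by (intro order_trans[OF Xb[OF x]] mult_left_mono) auto
          then have "(norm (X x))\<^sup>2 \<le> (b * (2 * L))\<^sup>2" by (intro power_mono) auto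
          moreover have "0 \<le> (norm (x - p))\<^sup>2 * (g2 x / 2 + (1 / \<epsilon>\<^sup>2) * V (u x))"
            using g2[of x] V0[of "u x"] by (intro mult_nonneg_nonneg) auto
          moreover have "b\<^sup>2 * (e x / \<epsilon>) \<le> b\<^sup>2 * ((\<epsilon> * L\<^sup>2 + (1 / \<epsilon>) * MV) / \<epsilon>)"
            using elim x eps by (intro mult_left_mono divide_right_mono) auto
          moreover have "0 \<le> b\<^sup>2 * (e x / \<epsilon>)" using e0[of x] eps by simp
          moreover have "0 \<le> (b * (2 * L))\<^sup>2" by simp
          ultimately show "\<bar>?Q x\<bar> \<le> (b * (2 * L))\<^sup>2 + b\<^sup>2 * ((\<epsilon> * L\<^sup>2 + (1 / \<epsilon>) * MV) / \<epsilon>)"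
            using Qb[OF x] by linarith
        qed
      qed
    qed simp_all
    have "(LINT x|lborel. ?J x) = (LINT x|lborel. (2 / \<epsilon>\<^sup>2) * (ct x * V (u x)) + cc x * ?Q x)"
    proof (rule Bochner_Integration.integral_cong_AE)
      show "AE x in lborel. ?J x = (2 / \<epsilon>\<^sup>2) * (ct x * V (u x)) + cc x * ?Q x"
        using pt
      proof eventually_elim
        case (elim x)
        then show ?case using supp[of x] by (cases "x \<in> cball p b") simp_all
      qed
    qed measurable
    then have "(2 / \<epsilon>\<^sup>2) * (LINT x|lborel. ct x * V (u x)) = - (LINT x|lborel. cc x * ?Q x)"
      using J0 ItV IQ by simp
    also have "\<dots> = (LINT x|lborel. - (cc x * ?Q x))" by (rule Bochner_Integration.integral_minus[symmetric])
    also have "\<dots> \<le> (LINT x|lborel. (b\<^sup>2 / \<epsilon>) * (cc x * e x))"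
    proof (rule integral_mono)
      show "integrable lborel (\<lambda>x. - (cc x * ?Q x))" using IQ by (rule Bochner_Integration.integrable_minus)
      show "integrable lborel (\<lambda>x. (b\<^sup>2 / \<epsilon>) * (cc x * e x))" using Ice by simp
      fix x
      show "- (cc x * ?Q x) \<le> (b\<^sup>2 / \<epsilon>) * (cc x * e x)"
      proof (cases "x \<in> cball p b")
        case True
        have "cc x * (- ?Q x) \<le> cc x * (b\<^sup>2 * (e x / \<epsilon>))" by (rule mult_left_mono[OF Qb[OF True] nonneg(2)])
        moreover have "cc x * (- ?Q x) = - (cc x * ?Q x)" by (rule mult_minus_right)
        moreover have "cc x * (b\<^sup>2 * (e x / \<epsilon>)) = (b\<^sup>2 / \<epsilon>) * (cc x * e x)" by simp
        ultimately show ?thesis by linarith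
      qed (simp add: supp)
    qed
    also have "\<dots> = (b\<^sup>2 / \<epsilon>) * (LINT x|lborel. cc x * e x)" by simp
    finally have "\<epsilon> * ((2 / \<epsilon>\<^sup>2) * (LINT x|lborel. ct x * V (u x))) \<le> \<epsilon> * ((b\<^sup>2 / \<epsilon>) * (LINT x|lborel. cc x * e x))"
      using eps by (intro mult_left_mono) auto
    then show ?thesis using eps by (simp add: power2_eq_square)
  qed
  have grad: "l * \<epsilon> * (LINT x|lborel. ct x * g2 x) \<le> C * (2 * C1\<^sup>2) / \<epsilon> * (LINT x|lborel. ct x * V (u x))
      + B * b * sqrt \<epsilon> * ((LINT x|lborel. cc x) + (LINT x|lborel. cc x * e x))"
  proof -
    let ?T = "\<lambda>x. f x \<bullet> gV (u x) + (G 1 x \<bullet> D (u x) (G 1 x) + G 2 x \<bullet> D (u x) (G 2 x))"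
    have J0: "(LINT x|lborel. ct x * ?T x - cc x * (X x \<bullet> gV (u x))) = 0"
      unfolding X_def by (rule lim(3)) (fact supp)+
    \<comment> \<open>The Hessian bound degenerates where \<open>V\<close> is large. There the
      squared gradient is replaced by its bound \<open>2 * L\<^sup>2\<close>, which turns the defect
      into a multiple of \<open>V (u x) / \<epsilon>\<close>. The term with \<open>f\<close> is a
      positive multiple of a square and is dropped.\<close>
    have low: "AE x in lborel. x \<in> cball p b \<longrightarrow> \<epsilon> * ?T x \<ge> l * \<epsilon> * g2 x - (C * (2 * C1\<^sup>2) / \<epsilon>) * V (u x)"
      using pt g2L
    proof eventually_elim
      case (elim x)
      show ?case
      proof
        assume x: "x \<in> cball p b"
        have "f x \<bullet> gV (u x) = (1 / \<epsilon>\<^sup>2) * (norm (gV (u x)))\<^sup>2" using elim x by (simp add: power2_norm_eq_inner)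
        then have "0 \<le> f x \<bullet> gV (u x)" by simp
        moreover have "G i x \<bullet> D (u x) (G i x) \<ge> (l - C * V (u x)) * (norm (G i x))\<^sup>2" for i
          using coer elim x by blast
        from this[of 1] this[of 2]
        have "G 1 x \<bullet> D (u x) (G 1 x) + G 2 x \<bullet> D (u x) (G 2 x) \<ge> l * g2 x - C * V (u x) * g2 x"
          by (simp add: g2_def algebra_simps)
        moreover have "C * V (u x) * g2 x \<le> C * V (u x) * (2 * L\<^sup>2)"
          using elim x lC V0[of "u x"] by (intro mult_left_mono) auto
        ultimately have "?T x \<ge> l * g2 x - C * V (u x) * (2 * L\<^sup>2)" by linarith
        then have "\<epsilon> * ?T x \<ge> \<epsilon> * (l * g2 x - C * V (u x) * (2 * L\<^sup>2))" using eps by (intro mult_left_mono) auto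
        also have "\<epsilon> * (l * g2 x - C * V (u x) * (2 * L\<^sup>2)) = l * \<epsilon> * g2 x - (C * (2 * C1\<^sup>2) / \<epsilon>) * V (u x)"
          unfolding L using eps by (simp add: field_simps power2_eq_square)
        finally show "\<epsilon> * ?T x \<ge> l * \<epsilon> * g2 x - (C * (2 * C1\<^sup>2) / \<epsilon>) * V (u x)" .
      qed
    qed
    \<comment> \<open>The product is linear in the gradient. Writing \<open>\<epsilon>\<close> as a
      product of two square roots bounds it by 1 plus the energy density and keeps one factor
      \<open>sqrt \<epsilon>\<close>.\<close>
    have up: "AE x in lborel. x \<in> cball p b \<longrightarrow> \<epsilon> * \<bar>X x \<bullet> gV (u x)\<bar> \<le> B * b * sqrt \<epsilon> * (1 + e x)"
      using pt
    proof eventually_elim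
      case (elim x)
      show ?case
      proof
        assume x: "x \<in> cball p b"
        have "\<bar>X x \<bullet> gV (u x)\<bar> \<le> norm (X x) * norm (gV (u x))" by (rule Cauchy_Schwarz_ineq2)
        also have "\<dots> \<le> (b * (norm (G 1 x) + norm (G 2 x))) * B"
          using elim x Xb[OF x] B b by (intro mult_mono) auto
        finally have "\<epsilon> * \<bar>X x \<bullet> gV (u x)\<bar> \<le> \<epsilon> * ((b * (norm (G 1 x) + norm (G 2 x))) * B)"
          using eps by (intro mult_left_mono) auto
        also have "\<dots> = B * b * sqrt \<epsilon> * (sqrt \<epsilon> * norm (G 1 x) + sqrt \<epsilon> * norm (G 2 x))"
        proof -
          have "B * b * s * (s * y + s * z) = (s * s) * ((b * (y + z)) * B)" for s y z :: real
            by (simp add: algebra_simps)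
          from this[of "sqrt \<epsilon>" "norm (G 1 x)" "norm (G 2 x)"] show ?thesis using eps
            by (simp only: real_sqrt_mult_self abs_of_pos)
        qed
        also have "\<dots> \<le> B * b * sqrt \<epsilon> * (1 + e x)"
        proof (rule mult_left_mono)
          have am: "s + r \<le> 1 + (s\<^sup>2 + r\<^sup>2) / 2" for s r :: real
            using zero_le_power2[of "s - 1"] zero_le_power2[of "r - 1"] by (simp add: power2_diff field_simps)
          have "sqrt \<epsilon> * norm (G 1 x) + sqrt \<epsilon> * norm (G 2 x) \<le> 1 + ((sqrt \<epsilon> * norm (G 1 x))\<^sup>2 + (sqrt \<epsilon> * norm (G 2 x))\<^sup>2) / 2"
            by (rule am)
          also have "\<dots> = 1 + \<epsilon> * (g2 x / 2)" using eps by (simp add: power_mult_distrib g2_def algebra_simps add_divide_distrib)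
          also have "\<dots> \<le> 1 + e x" unfolding e_eq using V0[of "u x"] eps by simp
          finally show "sqrt \<epsilon> * norm (G 1 x) + sqrt \<epsilon> * norm (G 2 x) \<le> 1 + e x" .
          show "0 \<le> B * b * sqrt \<epsilon>" using B0 b eps by simp
        qed
        finally show "\<epsilon> * \<bar>X x \<bullet> gV (u x)\<bar> \<le> B * b * sqrt \<epsilon> * (1 + e x)" .
      qed
    qed
    let ?S = "\<lambda>x. l * \<epsilon> * (ct x * g2 x) - (C * (2 * C1\<^sup>2) / \<epsilon>) * (ct x * V (u x)) - B * b * sqrt \<epsilon> * (cc x + cc x * e x)"
    have "(LINT x|lborel. ?S x) \<le> (LINT x|lborel. \<epsilon> * (ct x * ?T x - cc x * (X x \<bullet> gV (u x))))"
    proof (rule integral_mono_AE)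
      show "integrable lborel ?S"
        by (intro Bochner_Integration.integrable_diff Bochner_Integration.integrable_add integrable_mult_right Itg ItV Icc Ice)
      have "integrable lborel (\<lambda>x. ct x * ?T x)"
      proof (rule int[where M="F * B + 2 * MD"])
        show "AE x in lborel. x \<in> cball p b \<longrightarrow> \<bar>?T x\<bar> \<le> F * B + 2 * MD"
          using pt
        proof eventually_elim
          case (elim x)
          show ?case
          proof
            assume x: "x \<in> cball p b"
            have "norm (f x) \<le> F" using elim x B by (simp add: F_def divide_right_mono)
            then have "\<bar>f x \<bullet> gV (u x)\<bar> \<le> F * B"
              using elim x B F0 by (intro order_trans[OF Cauchy_Schwarz_ineq2] mult_mono) auto
            moreover have "\<bar>G 1 x \<bullet> D (u x) (G 1 x)\<bar> \<le> MD" "\<bar>G 2 x \<bullet> D (u x) (G 2 x)\<bar> \<le> MD"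
              using MD elim x by blast+
            ultimately show "\<bar>?T x\<bar> \<le> F * B + 2 * MD" by linarith
          qed
        qed
      qed (use Dm in simp_all)
      moreover have "integrable lborel (\<lambda>x. cc x * (X x \<bullet> gV (u x)))"
      proof (rule int[where M="b * (2 * L) * B"])
        show "AE x in lborel. x \<in> cball p b \<longrightarrow> \<bar>X x \<bullet> gV (u x)\<bar> \<le> b * (2 * L) * B"
          using pt
        proof eventually_elim
          case (elim x)
          show ?case
          proof
            assume x: "x \<in> cball p b"
            have "norm (X x) \<le> b * (2 * L)"
              using elim x b by (intro order_trans[OF Xb[OF x]] mult_left_mono) auto
            moreover have "norm (gV (u x)) \<le> B" using B elim x by blast
            ultimately show "\<bar>X x \<bullet> gV (u x)\<bar> \<le> b * (2 * L) * B"
              using order_trans[OF norm_ge_zero, of "X x" "b * (2 * L)"]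
              by (intro order_trans[OF Cauchy_Schwarz_ineq2] mult_mono) auto
          qed
        qed
      qed simp_all
      ultimately show "integrable lborel (\<lambda>x. \<epsilon> * (ct x * ?T x - cc x * (X x \<bullet> gV (u x))))" by simp
      show "AE x in lborel. ?S x \<le> \<epsilon> * (ct x * ?T x - cc x * (X x \<bullet> gV (u x)))"
        using low up
      proof eventually_elim
        case (elim x)
        show ?case
        proof (cases "x \<in> cball p b")
          case True
          have "ct x * (l * \<epsilon> * g2 x - (C * (2 * C1\<^sup>2) / \<epsilon>) * V (u x)) \<le> ct x * (\<epsilon> * ?T x)"
            using elim True nonneg(1)[of x] by (intro mult_left_mono) auto
          moreover have "cc x * (\<epsilon> * (X x \<bullet> gV (u x))) \<le> cc x * (B * b * sqrt \<epsilon> * (1 + e x))"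
          proof (rule mult_left_mono[OF _ nonneg(2)])
            have "\<epsilon> * (X x \<bullet> gV (u x)) \<le> \<epsilon> * \<bar>X x \<bullet> gV (u x)\<bar>" using eps by (intro mult_left_mono) auto
            then show "\<epsilon> * (X x \<bullet> gV (u x)) \<le> B * b * sqrt \<epsilon> * (1 + e x)" using elim True by auto
          qed
          ultimately show ?thesis by (simp add: algebra_simps)
        qed (simp add: supp)
      qed
    qed
    also have "\<dots> = 0" using J0 by simp
    finally have "(LINT x|lborel. ?S x) \<le> 0" .
    then show ?thesis using Itg ItV Icc Ice by simp
  qed
  have "(LINT x|lborel. ct x * e x) = (\<epsilon> / 2) * (LINT x|lborel. ct x * g2 x) + (1 / \<epsilon>) * (LINT x|lborel. ct x * V (u x))"
  proof -
    have "(LINT x|lborel. ct x * e x) = (LINT x|lborel. (\<epsilon> / 2) * (ct x * g2 x) + (1 / \<epsilon>) * (ct x * V (u x)))"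
      by (intro Bochner_Integration.integral_cong refl) (simp add: e_eq algebra_simps)
    then show ?thesis using Itg ItV by simp
  qed
  define a where "a = (LINT x|lborel. ct x * g2 x)"
  define v where "v = (1 / \<epsilon>) * (LINT x|lborel. ct x * V (u x))"
  define E where "E = (LINT x|lborel. cc x * e x)"
  define r where "r = B * b * sqrt \<epsilon> * ((LINT x|lborel. cc x) + E)"
  have "v \<le> b\<^sup>2 / 2 * E" using pot unfolding v_def E_def by (simp add: mult.commute)
  have "l * (\<epsilon> * a) \<le> 2 * (C * C1\<^sup>2 * v) + r" using grad unfolding v_def a_def r_def E_def by (simp add: algebra_simps)
  then have "\<epsilon> / 2 * a \<le> (C * C1\<^sup>2 * v) / l + r / (2 * l)"
    using lC(1) by (simp add: field_simps)
  moreover have "(LINT x|lborel. ct x * e x) = \<epsilon> / 2 * a + v" unfolding a_def v_def by fact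
  ultimately have "(LINT x|lborel. ct x * e x) \<le> (C * C1\<^sup>2 / l + 1) * v + r / (2 * l)" by (simp add: algebra_simps)
  also have "\<dots> \<le> (C * C1\<^sup>2 / l + 1) * (b\<^sup>2 / 2 * E) + r / (2 * l)"
    using \<open>v \<le> _\<close> lC by (intro add_right_mono mult_left_mono) auto
  finally show "(LINT x|lborel. ct x * e x) \<le> ((C * C1\<^sup>2 / l + 1) * b\<^sup>2 / 2) * (LINT x|lborel. cc x * e x)
       + B * b / (2 * l) * sqrt \<epsilon> * ((LINT x|lborel. cc x) + (LINT x|lborel. cc x * e x))"
    by (simp add: r_def E_def)
qed

section \<open>Kato inequality and the uniform bound\<close>

text \<open>A smooth convex truncation of the norm with bounded gradient, vanishing near the origin.\<close>

definition qf :: "real \<Rightarrow> real" where "qf t = max 0 t - arctan (max 0 t)"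
definition qf' :: "real \<Rightarrow> real" where "qf' t = 1 - 1 / (1 + (max 0 t)\<^sup>2)"
definition qf'' :: "real \<Rightarrow> real" where "qf'' t = 2 * max 0 t / (1 + (max 0 t)\<^sup>2)\<^sup>2"

lemma one_plus_sq_pos: "1 + (t::real)\<^sup>2 > 0" "1 + (t::real)\<^sup>2 \<noteq> 0"
proof -
  show "1 + t\<^sup>2 > 0" by (rule add_pos_nonneg) auto
  then show "1 + t\<^sup>2 \<noteq> 0" by simp
qed

lemma DERIV_qf: "(qf has_real_derivative qf' t) (at t)"
  unfolding qf_def[abs_def] qf'_def
  by (rule DERIV_comp_max0[of "\<lambda>t. t - arctan t" "\<lambda>t. 1 - 1 / (1 + t\<^sup>2)"])
    (auto intro!: derivative_eq_intros simp: one_plus_sq_pos inverse_eq_divide)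

lemma DERIV_qf': "(qf' has_real_derivative qf'' t) (at t)"
  unfolding qf'_def[abs_def] qf''_def
  by (rule DERIV_comp_max0[of "\<lambda>t. 1 - 1 / (1 + t\<^sup>2)" "\<lambda>t. 2 * t / (1 + t\<^sup>2)\<^sup>2"])
    (auto intro!: derivative_eq_intros simp: one_plus_sq_pos power2_eq_square[of "1 + _"])

lemma qf'_bounds: "0 \<le> qf' t" "qf' t \<le> 1" "0 \<le> qf'' t"
  using one_plus_sq_pos(1)[of "max 0 t"] by (auto simp: qf'_def qf''_def divide_simps)

lemma qf_bounds: "0 \<le> qf t" "max 0 t - 2 \<le> qf t" "qf t \<le> max 0 t"
proof -
  have "arctan (max 0 t) \<le> max 0 t" using arctan_le_self[of "max 0 t"] by simp
  then show "0 \<le> qf t" by (simp add: qf_def)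
  show "max 0 t - 2 \<le> qf t" using arctan_ubound[of "max 0 t"] pi_less_4 by (simp add: qf_def)
  show "qf t \<le> max 0 t" using zero_le_arctan_iff[of "max 0 t"] by (simp add: qf_def)
qed

lemma continuous_qf: "continuous_on A qf" "continuous_on A qf'" "continuous_on A qf''"
proof -
  show "continuous_on A qf" "continuous_on A qf'"
    by (auto intro!: continuous_at_imp_continuous_on DERIV_isCont[OF DERIV_qf] DERIV_isCont[OF DERIV_qf'])
  show "continuous_on A qf''" unfolding qf''_def[abs_def]
    by (intro continuous_intros) (simp add: one_plus_sq_pos)
qed

text \<open>A smooth substitute for the norm, which is not differentiable at the origin; the two
  differ by at most 1.\<close>

definition nf :: "'b::real_inner \<Rightarrow> real" where "nf y = sqrt (1 + y \<bullet> y)"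

lemma nf_bounds: "1 \<le> nf y" "norm y \<le> nf y" "nf y \<le> 1 + norm y" "(nf y)\<^sup>2 = 1 + y \<bullet> y"
proof -
  show "1 \<le> nf y" by (simp add: nf_def)
  show "norm y \<le> nf y" unfolding nf_def norm_eq_sqrt_inner by simp
  have "1 + y \<bullet> y \<le> (1 + norm y)\<^sup>2" by (simp add: power2_sum power2_norm_eq_inner)
  then show "nf y \<le> 1 + norm y" unfolding nf_def by (rule real_le_lsqrt[rotated]) simp
  show "(nf y)\<^sup>2 = 1 + y \<bullet> y" by (simp add: nf_def)
qed

lemma nf_pos: "0 < nf y" "nf y \<noteq> 0" using nf_bounds(1)[of y] by auto

lemma has_derivative_nf: "(nf has_derivative (\<lambda>h. (y \<bullet> h) * inverse (nf y))) (at y)"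
proof -
  have p: "0 < 1 + y \<bullet> y" by (simp add: add_pos_nonneg)
  have "((\<lambda>y. 1 + y \<bullet> y) has_derivative (\<lambda>h. 0 + (y \<bullet> h + h \<bullet> y))) (at y)"
    by (intro has_derivative_add has_derivative_const has_derivative_inner has_derivative_ident)
  from has_derivative_compose[OF this DERIV_real_sqrt[OF p, unfolded has_field_derivative_def]]
  show ?thesis unfolding nf_def[abs_def]
    by (rule has_derivative_eq_rhs) (auto simp: inner_commute fun_eq_iff)
qed

lemma continuous_nf: "continuous_on A nf"
  using has_derivative_nf by (auto intro!: continuous_at_imp_continuous_on has_derivative_continuous)

text \<open>A nondecreasing convex function of a convex function. Its gradient vanishes where
  \<open>nf y \<le> r\<close> and is elsewhere a nonnegative multiple of \<open>y\<close>, so the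
  growth condition gives it a sign against the gradient of the potential.\<close>

definition Phi :: "real \<Rightarrow> 'b::real_inner \<Rightarrow> real" where "Phi r y = qf (nf y - r)"
definition dPhi :: "real \<Rightarrow> 'b::real_inner \<Rightarrow> 'b" where "dPhi r y = (qf' (nf y - r) * inverse (nf y)) *\<^sub>R y"

lemma continuous_Phi: "continuous_on A (Phi r)" "continuous_on A (dPhi r)"
  unfolding Phi_def[abs_def] dPhi_def[abs_def]
  by (intro continuous_intros continuous_on_compose2[OF continuous_qf(1)] continuous_on_compose2[OF continuous_qf(2)] continuous_nf; auto simp: nf_pos)+

lemma norm_dPhi_le: "norm (dPhi r y) \<le> 1"
proof -
  have "norm (dPhi r y) = qf' (nf y - r) * (norm y / nf y)"
    using nf_pos[of y] qf'_bounds by (simp add: dPhi_def divide_inverse)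
  also have "\<dots> \<le> 1 * 1"
    using nf_bounds[of y] nf_pos[of y] qf'_bounds by (intro mult_mono) (auto simp: divide_simps)
  finally show ?thesis by simp
qed

lemma has_derivative_Phi: "(Phi r has_derivative (\<lambda>h. dPhi r y \<bullet> h)) (at y)"
proof -
  have "((\<lambda>y. nf y - r) has_derivative (\<lambda>h. (y \<bullet> h) * inverse (nf y) - 0)) (at y)"
    by (intro has_derivative_diff has_derivative_nf has_derivative_const)
  from has_derivative_compose[OF this DERIV_qf[unfolded has_field_derivative_def]]
  show ?thesis unfolding Phi_def[abs_def] dPhi_def
    by (rule has_derivative_eq_rhs) (auto simp: mult_ac)
qed

lemma Phi_Lipschitz: "\<bar>Phi r y - Phi r z\<bar> \<le> norm (y - z)"
proof -
  have "norm (Phi r y - Phi r z) \<le> 1 * norm (y - z)"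
  proof (rule differentiable_bound[OF convex_UNIV, of "Phi r" "\<lambda>y h. dPhi r y \<bullet> h"])
    show "(Phi r has_derivative (\<bullet>) (dPhi r x)) (at x)" for x using has_derivative_Phi .
    show "onorm ((\<bullet>) (dPhi r x)) \<le> 1" for x
    proof (rule onorm_bound)
      fix h
      have "\<bar>dPhi r x \<bullet> h\<bar> \<le> norm (dPhi r x) * norm h" by (rule Cauchy_Schwarz_ineq2)
      also have "\<dots> \<le> 1 * norm h" by (intro mult_right_mono norm_dPhi_le) auto
      finally show "norm (dPhi r x \<bullet> h) \<le> 1 * norm h" by simp
    qed simp
  qed auto
  then show ?thesis by simp
qed

text \<open>Convexity in pointwise form: the chain rule produces the first-order term together with
  the Hessian of \<open>Phi r\<close> evaluated on the partial derivatives, and this second part is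
  nonnegative.\<close>

lemma has_partials_Phi:
  fixes w :: "real^2 \<Rightarrow> 'b::euclidean_space"
  assumes w: "has_partials w w'" "\<And>i. has_partials (w' i) (w'' i)" and c: "\<And>i j. continuous_on UNIV (w'' i j)"
  obtains W' W'' where "has_partials (\<lambda>x. Phi r (w x)) W'" "\<And>i. has_partials (W' i) (W'' i)"
    "\<And>i j. continuous_on UNIV (W'' i j)" "\<And>x. dPhi r (w x) \<bullet> (w'' 1 1 x + w'' 2 2 x) \<le> W'' 1 1 x + W'' 2 2 x"
proof -
  have cw: "continuous_on UNIV w" "\<And>i. continuous_on UNIV (w' i)"
    using w has_partials_continuous by blast+
  let ?n = "\<lambda>x. nf (w x)"
  let ?m = "\<lambda>x. inverse (nf (w x))"
  let ?q = "\<lambda>x. qf' (nf (w x) - r)"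
  define a where "a i x = (w x \<bullet> w' i x) * ?m x" for i x
  have Pn: "has_partials ?n a"
    unfolding a_def[abs_def] by (rule has_partials_compose[OF w(1), of nf "\<lambda>y h. (y \<bullet> h) * inverse (nf y)"]) (rule has_derivative_nf)
  have Pnr: "has_partials (\<lambda>x. ?n x - r) (\<lambda>i x. a i x - 0)"
    by (intro has_partials_diff Pn has_partials_const)
  have Pm: "has_partials ?m (\<lambda>i x. - (?m x * (a i x) * ?m x))"
    by (rule has_partials_compose[OF Pn, of inverse "\<lambda>y h. - (inverse y * h * inverse y)"])
      (rule has_derivative_inverse'[OF nf_pos(2)])
  define a' where "a' i j x = (w' j x \<bullet> w' i x + w x \<bullet> w'' i j x) * ?m x + (w x \<bullet> w' i x) * (- (?m x * (a j x) * ?m x))" for i j x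
  have Pa: "has_partials (a i) (a' i)" for i
    unfolding a_def[of i, abs_def] a'_def[abs_def] by (intro has_partials_mult has_partials_inner w Pm)
  have PPhi: "has_partials (\<lambda>x. Phi r (w x)) (\<lambda>i x. ?q x * (a i x - 0))"
    unfolding Phi_def by (rule has_partials_compose_real[OF Pnr]) (rule DERIV_qf)
  have Pq: "has_partials ?q (\<lambda>i x. qf'' (?n x - r) * (a i x - 0))"
    by (rule has_partials_compose_real[OF Pnr]) (rule DERIV_qf')
  let ?W'' = "\<lambda>i j x. (qf'' (?n x - r) * (a j x - 0)) * (a i x - 0) + ?q x * (a' i j x - 0)"
  have PW: "has_partials (\<lambda>x. ?q x * (a i x - 0)) (?W'' i)" for i
    by (intro has_partials_mult Pq has_partials_diff Pa has_partials_const)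
  have ca: "continuous_on UNIV (a i)" for i by (rule has_partials_continuous[OF Pa])
  have ca': "continuous_on UNIV (a' i j)" for i j
    unfolding a'_def[abs_def]
    by (intro continuous_intros cw c ca continuous_on_compose2[OF continuous_nf]) (auto simp: nf_pos)
  have cW: "continuous_on UNIV (?W'' i j)" for i j
    by (intro continuous_intros ca ca' continuous_on_compose2[OF continuous_qf(2)] continuous_on_compose2[OF continuous_qf(3)]
         continuous_on_compose2[OF continuous_nf] cw) auto
  have ge: "dPhi r (w x) \<bullet> (w'' 1 1 x + w'' 2 2 x) \<le> ?W'' 1 1 x + ?W'' 2 2 x" for x
  proof -
    \<comment> \<open>This is the convexity of \<open>nf\<close>. By Cauchy-Schwarz the negative
      term from differentiating \<open>?m\<close> is in absolute value at most
      \<open>(w' i x \<bullet> w' i x) * ?m x\<close>.\<close>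
    have a'ge: "(w x \<bullet> w'' i i x) * ?m x \<le> a' i i x" for i
    proof -
      have mp: "0 < ?m x" using nf_pos by simp
      have "(w x \<bullet> w' i x)\<^sup>2 \<le> (nf (w x))\<^sup>2 * (w' i x \<bullet> w' i x)"
      proof -
        have "(w x \<bullet> w' i x)\<^sup>2 \<le> (w x \<bullet> w x) * (w' i x \<bullet> w' i x)" by (rule Cauchy_Schwarz_ineq)
        also have "\<dots> \<le> (nf (w x))\<^sup>2 * (w' i x \<bullet> w' i x)" unfolding nf_bounds(4) by (intro mult_right_mono) auto
        finally show ?thesis .
      qed
      then have "(w x \<bullet> w' i x)\<^sup>2 * (?m x)\<^sup>2 \<le> (nf (w x))\<^sup>2 * (w' i x \<bullet> w' i x) * (?m x)\<^sup>2"
        by (intro mult_right_mono) auto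
      also have "\<dots> = (w' i x \<bullet> w' i x) * (nf (w x) * ?m x)\<^sup>2" by (simp only: power_mult_distrib mult_ac)
      also have "nf (w x) * ?m x = 1" by (rule right_inverse[OF nf_pos(2)])
      also have "(w' i x \<bullet> w' i x) * 1\<^sup>2 = w' i x \<bullet> w' i x" by simp
      finally have "(w x \<bullet> w' i x)\<^sup>2 * (?m x)\<^sup>2 * ?m x \<le> (w' i x \<bullet> w' i x) * ?m x"
        using mp by (intro mult_right_mono) auto
      then show ?thesis unfolding a'_def a_def by (simp add: power2_eq_square algebra_simps)
    qed
    have "dPhi r (w x) \<bullet> (w'' 1 1 x + w'' 2 2 x) = ?q x * ((w x \<bullet> w'' 1 1 x) * ?m x) + ?q x * ((w x \<bullet> w'' 2 2 x) * ?m x)"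
      by (simp add: dPhi_def inner_add_right algebra_simps)
    also have "\<dots> \<le> ?q x * a' 1 1 x + ?q x * a' 2 2 x"
      by (intro add_mono mult_left_mono a'ge qf'_bounds)
    also have "\<dots> \<le> ?W'' 1 1 x + ?W'' 2 2 x"
      using qf'_bounds(3)[of "?n x - r"] by (simp add: mult.assoc)
    finally show ?thesis .
  qed
  show ?thesis using that[OF PPhi PW cW ge] .
qed

text \<open>Compact support of \<open>g\<close> alone is enough, because the field
  \<open>f x * g' i x - g x * f' i x\<close> inherits it.\<close>

lemma green_second:
  fixes f g :: "real^2 \<Rightarrow> real"
  assumes f: "has_partials f f'" "\<And>i. has_partials (f' i) (f'' i)" "\<And>i j. continuous_on UNIV (f'' i j)"
    and g: "has_partials g g'" "\<And>i. has_partials (g' i) (g'' i)" "\<And>i j. continuous_on UNIV (g'' i j)"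
    and supp: "\<And>x. x \<notin> cball p b \<Longrightarrow> g x = 0"
  shows "(LINT x|lborel. f x * (g'' 1 1 x + g'' 2 2 x)) = (LINT x|lborel. g x * (f'' 1 1 x + f'' 2 2 x))"
proof -
  have supp': "g' i x = 0" if "x \<notin> cball p b" for i x
    by (rule partials_support[OF g(1) _ that]) (fact supp)
  have supp'': "g'' i j x = 0" if "x \<notin> cball p b" for i j x
    by (rule partials_support[OF g(2) _ that]) (fact supp')
  note [continuous_intros] = has_partials_continuous[OF f(1)] has_partials_continuous[OF f(2)] f(3)
    has_partials_continuous[OF g(1)] has_partials_continuous[OF g(2)] g(3)
  let ?Z = "\<lambda>i x. (f' i x * g' i x + f x * g'' i i x) - (g' i x * f' i x + g x * f'' i i x)"
  have P: "has_partials (\<lambda>x. f x * g' i x - g x * f' i x) (\<lambda>j x. (f' j x * g' i x + f x * g'' i j x) - (g' j x * f' i x + g x * f'' i j x))" for i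
    by (intro has_partials_diff has_partials_mult f g)
  have cZ: "continuous_on UNIV (?Z i)" for i by (intro continuous_intros)
  have Z: "(LINT x|lborel. ?Z i x) = 0" for i
    by (rule integral_partial_zero[OF P cZ, of p b]) (simp add: supp supp' supp'')
  have I: "integrable lborel (?Z i)" for i
    by (rule integrable_compact_support[OF cZ, of p b]) (simp add: supp supp' supp'')
  have I1: "integrable lborel (\<lambda>x. f x * (g'' 1 1 x + g'' 2 2 x))" "integrable lborel (\<lambda>x. g x * (f'' 1 1 x + f'' 2 2 x))"
    by (rule integrable_compact_support[of _ p b]; (intro continuous_intros)?; simp add: supp supp'')+
  have "(LINT x|lborel. f x * (g'' 1 1 x + g'' 2 2 x) - g x * (f'' 1 1 x + f'' 2 2 x)) = (LINT x|lborel. ?Z 1 x + ?Z 2 x)"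
    by (intro Bochner_Integration.integral_cong refl) (simp add: algebra_simps)
  also have "\<dots> = 0" by (simp only: Bochner_Integration.integral_add[OF I I] Z)
  finally show ?thesis using I1 by simp
qed

text \<open>\<open>1 \<le> r\<close> compensates for the excess of \<open>nf\<close> over the norm.
  The last bound is how an estimate of \<open>Phi r\<close> is turned back into one of the
  norm.\<close>

lemma Phi_bounds:
  assumes "1 \<le> r" shows "0 \<le> Phi r y" "Phi r y \<le> norm y" "norm y \<le> r + 2 + Phi r y"
proof -
  show "0 \<le> Phi r y" using qf_bounds(1) by (simp add: Phi_def)
  have "max 0 (nf y - r) \<le> norm y" using nf_bounds(3)[of y] assms by simp
  then show "Phi r y \<le> norm y" using qf_bounds(3)[of "nf y - r"] unfolding Phi_def by linarith
  show "norm y \<le> r + 2 + Phi r y"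
    using qf_bounds(2)[of "nf y - r"] nf_bounds(2)[of y] unfolding Phi_def by simp
qed

lemma tendsto_integral_mollified:
  fixes v :: "nat \<Rightarrow> real^2 \<Rightarrow> 'b::euclidean_space"
  assumes "(\<lambda>n. LINT x|lborel. norm (v n x - u x)) \<longlonglongrightarrow> 0"
    and a: "\<And>n. \<bar>a n - b\<bar> \<le> B * (LINT x|lborel. norm (v n x - u x))"
  shows "a \<longlonglongrightarrow> b"
proof -
  have "(\<lambda>n. B * (LINT x|lborel. norm (v n x - u x))) \<longlonglongrightarrow> 0"
    using tendsto_mult_left[OF assms(1), of B] by simp
  then have "(\<lambda>n. a n - b) \<longlonglongrightarrow> 0"
    by (rule Lim_null_comparison[rotated]) (use a in auto)
  then show ?thesis by (simp add: LIM_zero_iff)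
qed

text \<open>The convexity inequality is integrated against \<open>g\<close> for mollifications of
  \<open>u\<close>, where Green's formula applies. As \<open>dPhi\<close> has norm at most 1, L^1
  convergence of the right-hand sides and dominated convergence suffice in the limit; no bound on
  \<open>u\<close> is available at this stage.\<close>

lemma kato_inequality:
  fixes u :: "real^2 \<Rightarrow> 'b::euclidean_space"
  assumes wp: "weak_poisson p R u G f" and r: "1 \<le> r"
    and sign: "AE x in lborel. x \<in> ball p R \<longrightarrow> 0 \<le> dPhi r (u x) \<bullet> f x"
    and g: "has_partials g g'" "\<And>i. has_partials (g' i) (g'' i)" "\<And>i j. continuous_on UNIV (g'' i j)"
    and g0: "\<And>x. 0 \<le> g x" and supp: "\<And>x. x \<notin> cball q b \<Longrightarrow> g x = 0"
    and \<delta>: "0 < \<delta>" "\<And>x. x \<in> cball q b \<Longrightarrow> dist p x + \<delta> < R"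
  shows "0 \<le> (LINT x|lborel. Phi r (u x) * (g'' 1 1 x + g'' 2 2 x))"
proof -
  have I: "integrable lborel u" "integrable lborel f"
    using wp unfolding weak_poisson_def by blast+
  have PB: "0 \<le> Phi r y" "Phi r y \<le> norm y" for y :: 'b by (rule Phi_bounds[OF r])+
  obtain d0 where d0: "\<And>n. 0 < d0 n" "\<And>n::nat. d0 n < \<delta>" "d0 \<longlonglongrightarrow> 0"
    and lim0: "AE x in lborel. (\<lambda>n. conv (ker (d0 n)) u x) \<longlonglongrightarrow> u x"
    by (rule mollify_AE_subseq[OF I(1) \<delta>(1)]) blast
  obtain N where N: "\<And>n. n \<ge> N \<Longrightarrow> integrable lborel (\<lambda>x. conv (ker (d0 n)) u x - u x)"
      "\<And>n. n \<ge> N \<Longrightarrow> integrable lborel (\<lambda>x. conv (ker (d0 n)) f x - f x)"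
    using eventually_conj[OF mollify_L1(1)[OF I(1) d0(1,3)] mollify_L1(1)[OF I(2) d0(1,3)]]
    unfolding eventually_sequentially by metis
  define d where "d n = d0 (n + N)" for n
  have d: "0 < d n" "d n < \<delta>" "integrable lborel (\<lambda>x. conv (ker (d n)) u x - u x)"
     "integrable lborel (\<lambda>x. conv (ker (d n)) f x - f x)" for n
    using d0 N unfolding d_def by auto
  have lim: "AE x in lborel. (\<lambda>n. conv (ker (d n)) u x) \<longlonglongrightarrow> u x"
    using lim0 by eventually_elim (auto simp: d_def dest: LIMSEQ_ignore_initial_segment)
  have L1: "(\<lambda>n. LINT x|lborel. norm (conv (ker (d n)) u x - u x)) \<longlonglongrightarrow> 0"
    "(\<lambda>n. LINT x|lborel. norm (conv (ker (d n)) f x - f x)) \<longlonglongrightarrow> 0"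
    unfolding d_def using LIMSEQ_ignore_initial_segment[OF mollify_L1(2)[OF I(1) d0(1,3)]]
      LIMSEQ_ignore_initial_segment[OF mollify_L1(2)[OF I(2) d0(1,3)]] by auto
  define w where "w n = conv (ker (d n)) u" for n
  define fn where "fn n = conv (ker (d n)) f" for n
  define k where "k x = g'' 1 1 x + g'' 2 2 x" for x
  have ck: "continuous_on UNIV k" unfolding k_def[abs_def] by (intro continuous_intros g)
  have cg: "continuous_on UNIV g" by (rule has_partials_continuous[OF g(1)])
  have supp': "g' i x = 0" if "x \<notin> cball q b" for i x
    by (rule partials_support[OF g(1) _ that]) (fact supp)
  have supp'': "g'' i j x = 0" if "x \<notin> cball q b" for i j x
    by (rule partials_support[OF g(2) _ that]) (fact supp')
  have sk: "k x = 0" if "x \<notin> cball q b" for x using supp''[OF that] by (simp add: k_def)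
  obtain Bk where Bk: "\<And>x. norm (k x) \<le> Bk" "0 \<le> Bk" using bounded_compact_support[OF ck sk] by metis
  obtain Bg where Bg: "\<And>x. norm (g x) \<le> Bg" "0 \<le> Bg" using bounded_compact_support[OF cg supp] by metis
  have cw: "continuous_on UNIV (w n)" for n
    unfolding w_def by (rule has_partials_continuous[OF conv_ker_has_partials(1)[OF d(1) I(1)]])
  have cfn: "continuous_on UNIV (fn n)" for n
    unfolding fn_def by (rule has_partials_continuous[OF conv_ker_has_partials(1)[OF d(1) I(2)]])
  note [continuous_intros] = continuous_on_compose2[OF continuous_Phi(1)] continuous_on_compose2[OF continuous_Phi(2)]
  have [measurable]: "u \<in> borel_measurable borel" "f \<in> borel_measurable borel" "k \<in> borel_measurable borel"
     "g \<in> borel_measurable borel" "w n \<in> borel_measurable borel" "fn n \<in> borel_measurable borel"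
     "(Phi r :: 'b \<Rightarrow> real) \<in> borel_measurable borel" "(dPhi r :: 'b \<Rightarrow> 'b) \<in> borel_measurable borel" for n
    using I by (auto intro!: borel_measurable_continuous_onI ck cg cw cfn continuous_Phi)
  have bP: "\<bar>dPhi r y \<bullet> z\<bar> \<le> norm z" for y z :: 'b
    using Cauchy_Schwarz_ineq2[of "dPhi r y" z] mult_right_mono[OF norm_dPhi_le[of r y], of "norm z"] by simp
  have IPu: "integrable lborel (\<lambda>x. Phi r (u x) * k x)"
  proof (rule Bochner_Integration.integrable_bound)
    show "integrable lborel (\<lambda>x. Bk * norm (u x))" using I by simp
    show "AE x in lborel. norm (Phi r (u x) * k x) \<le> norm (Bk * norm (u x))"
      using PB Bk by (intro AE_I2) (auto simp: abs_mult mult.commute[of Bk] intro!: mult_mono)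
  qed measurable
  have IPw: "integrable lborel (\<lambda>x. Phi r (w n x) * k x)" for n
    by (rule integrable_compact_support[of _ q b]) (auto intro!: continuous_intros cw ck simp: sk)
  have limA: "(\<lambda>n. LINT x|lborel. Phi r (w n x) * k x) \<longlonglongrightarrow> (LINT x|lborel. Phi r (u x) * k x)"
  proof (rule tendsto_integral_mollified[OF L1(1), folded w_def])
    fix n
    have "\<bar>(LINT x|lborel. Phi r (w n x) * k x) - (LINT x|lborel. Phi r (u x) * k x)\<bar>
       = \<bar>LINT x|lborel. Phi r (w n x) * k x - Phi r (u x) * k x\<bar>"
      using IPw IPu by simp
    also have "\<dots> \<le> (LINT x|lborel. Bk * norm (w n x - u x))"
    proof (rule integral_abs_bound_integral)
      show "integrable lborel (\<lambda>x. Phi r (w n x) * k x - Phi r (u x) * k x)" using IPw IPu by simp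
      show "integrable lborel (\<lambda>x. Bk * norm (w n x - u x))" using d(3)[of n] by (simp add: w_def)
      fix x
      have "\<bar>(Phi r (w n x) - Phi r (u x)) * k x\<bar> \<le> norm (w n x - u x) * Bk"
        unfolding abs_mult using Phi_Lipschitz Bk by (intro mult_mono) auto
      then show "\<bar>Phi r (w n x) * k x - Phi r (u x) * k x\<bar> \<le> Bk * norm (w n x - u x)"
        by (simp only: left_diff_distrib mult.commute[of Bk])
    qed
    finally show "\<bar>(LINT x|lborel. Phi r (w n x) * k x) - (LINT x|lborel. Phi r (u x) * k x)\<bar>
       \<le> Bk * (LINT x|lborel. norm (w n x - u x))" by simp
  qed
  have bgf: "norm (g x * (dPhi r y \<bullet> z)) \<le> Bg * norm z" for x and y z :: 'b
    unfolding norm_mult using Bg(1)[of x] Bg(2) bP[of y z] by (intro mult_mono) auto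
  have IB: "integrable lborel (\<lambda>x. g x * (dPhi r (w n x) \<bullet> f x))" for n
  proof (rule Bochner_Integration.integrable_bound)
    show "integrable lborel (\<lambda>x. Bg * norm (f x))" using I by simp
    show "AE x in lborel. norm (g x * (dPhi r (w n x) \<bullet> f x)) \<le> norm (Bg * norm (f x))"
      using bgf Bg(2) by (intro AE_I2) (auto intro: order_trans)
  qed measurable
  have limB: "(\<lambda>n. LINT x|lborel. g x * (dPhi r (w n x) \<bullet> f x)) \<longlonglongrightarrow> (LINT x|lborel. g x * (dPhi r (u x) \<bullet> f x))"
  proof (rule integral_dominated_convergence[where w="\<lambda>x. Bg * norm (f x)"])
    show "integrable lborel (\<lambda>x. Bg * norm (f x))" using I by simp
    show "AE x in lborel. norm (g x * (dPhi r (w n x) \<bullet> f x)) \<le> Bg * norm (f x)" for n using bgf by simp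
    show "AE x in lborel. (\<lambda>n. g x * (dPhi r (w n x) \<bullet> f x)) \<longlonglongrightarrow> g x * (dPhi r (u x) \<bullet> f x)"
      using lim
    proof eventually_elim
      case (elim x)
      have "isCont (dPhi r) (u x)" using continuous_Phi(2)[of "UNIV :: 'b set" r] by (simp add: continuous_on_eq_continuous_at)
      then have "(\<lambda>n. dPhi r (w n x)) \<longlonglongrightarrow> dPhi r (u x)" using elim unfolding w_def by (rule isCont_tendsto_compose)
      then show ?case by (intro tendsto_intros)
    qed
  qed measurable
  \<comment> \<open>The mollified right-hand side \<open>fn n\<close> is exchanged for
    \<open>f\<close> at the cost of their L^1 distance, because the sign hypothesis is formulated
    for \<open>f\<close>.\<close>
  have ineq: "(LINT x|lborel. g x * (dPhi r (w n x) \<bullet> f x)) - Bg * (LINT x|lborel. norm (fn n x - f x))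
      \<le> (LINT x|lborel. Phi r (w n x) * k x)" for n
  proof -
    note P = conv_ker_has_partials[OF d(1)[of n] I(1)] and C = continuous_conv_ker''[OF d(1)[of n] I(1)]
    obtain W' W'' where W: "has_partials (\<lambda>x. Phi r (w n x)) W'" "\<And>i. has_partials (W' i) (W'' i)"
      "\<And>i j. continuous_on UNIV (W'' i j)"
      "\<And>x. dPhi r (w n x) \<bullet> (conv (ker'' (d n) 1 1) u x + conv (ker'' (d n) 2 2) u x) \<le> W'' 1 1 x + W'' 2 2 x"
      unfolding w_def by (rule has_partials_Phi[OF P C]) blast
    have dif: "integrable lborel (\<lambda>x. norm (fn n x - f x))" using d(4)[of n] by (simp add: fn_def)
    have "(LINT x|lborel. g x * (dPhi r (w n x) \<bullet> f x)) - Bg * (LINT x|lborel. norm (fn n x - f x))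
       = (LINT x|lborel. g x * (dPhi r (w n x) \<bullet> f x) - Bg * norm (fn n x - f x))"
      using IB[of n] dif by simp
    also have "\<dots> \<le> (LINT x|lborel. g x * (W'' 1 1 x + W'' 2 2 x))"
    proof (rule integral_mono)
      show "integrable lborel (\<lambda>x. g x * (dPhi r (w n x) \<bullet> f x) - Bg * norm (fn n x - f x))"
        using IB[of n] dif by simp
      show "integrable lborel (\<lambda>x. g x * (W'' 1 1 x + W'' 2 2 x))"
        by (rule integrable_compact_support[of _ q b]) (auto intro!: continuous_intros cg W simp: supp)
      fix x
      show "g x * (dPhi r (w n x) \<bullet> f x) - Bg * norm (fn n x - f x) \<le> g x * (W'' 1 1 x + W'' 2 2 x)"
      proof (cases "x \<in> cball q b")
        case True
        then have "dist p x + d n < R" using \<delta>(2) d(2)[of n] by fastforce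
        then have "dPhi r (w n x) \<bullet> fn n x \<le> W'' 1 1 x + W'' 2 2 x"
          using W(4)[of x] weak_poisson_mollified(2)[OF wp d(1)] by (simp add: fn_def)
        then have "g x * (dPhi r (w n x) \<bullet> fn n x) \<le> g x * (W'' 1 1 x + W'' 2 2 x)"
          using g0 by (intro mult_left_mono) auto
        moreover have "g x * (dPhi r (w n x) \<bullet> f x) = g x * (dPhi r (w n x) \<bullet> fn n x) - g x * (dPhi r (w n x) \<bullet> (fn n x - f x))"
          by (simp add: inner_diff_right right_diff_distrib)
        moreover have "\<bar>g x * (dPhi r (w n x) \<bullet> (fn n x - f x))\<bar> \<le> Bg * norm (fn n x - f x)"
          using bgf[of x "w n x" "fn n x - f x"] by simp
        ultimately show ?thesis by linarith
      next
        case False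
        then show ?thesis using supp[OF False] Bg(2) by simp
      qed
    qed
    also have "\<dots> = (LINT x|lborel. Phi r (w n x) * k x)"
      unfolding k_def by (rule green_second[OF W(1,2,3) g, symmetric]) (fact supp)
    finally show ?thesis .
  qed
  have "(\<lambda>n. (LINT x|lborel. g x * (dPhi r (w n x) \<bullet> f x)) - Bg * (LINT x|lborel. norm (fn n x - f x)))
      \<longlonglongrightarrow> (LINT x|lborel. g x * (dPhi r (u x) \<bullet> f x)) - Bg * 0"
    using L1(2) unfolding fn_def by (intro tendsto_diff limB tendsto_mult_left)
  then have "(LINT x|lborel. g x * (dPhi r (u x) \<bullet> f x)) - Bg * 0 \<le> (LINT x|lborel. Phi r (u x) * k x)"
    by (rule LIMSEQ_le[OF _ limA]) (use ineq in auto)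
  moreover have "0 \<le> (LINT x|lborel. g x * (dPhi r (u x) \<bullet> f x))"
  proof (rule integral_nonneg_AE)
    show "AE x in lborel. 0 \<le> g x * (dPhi r (u x) \<bullet> f x)"
      using sign
    proof eventually_elim
      case (elim x)
      show ?case
      proof (cases "x \<in> cball q b")
        case True
        then have "x \<in> ball p R" using \<delta>(2)[OF True] \<delta>(1) by simp
        then show ?thesis using elim g0 by simp
      qed (simp add: supp)
    qed
  qed
  ultimately show ?thesis by (simp add: k_def)
qed

lemma has_partials_reflect:
  "has_partials f f' \<Longrightarrow> has_partials (\<lambda>z. f (y - z)) (\<lambda>i z. - f' i (y - z))"
  using has_partials_affine[of f f' y "-1"] by simp

lemma has_partials_minus:
  "has_partials f f' \<Longrightarrow> has_partials (\<lambda>z. - f z) (\<lambda>i z. - f' i z)"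
  using has_partials_diff[OF has_partials_const[of 0], of f f'] by simp

lemma integral_affine:
  fixes f :: "real^2 \<Rightarrow> real"
  assumes [measurable]: "f \<in> borel_measurable borel" and t: "t > 0"
  shows "(LINT z|lborel. f (x + t *\<^sub>R z)) = (LINT z|lborel. f z) / t\<^sup>2"
proof -
  have "lborel = density (distr lborel borel (\<lambda>z. x + t *\<^sub>R z)) (\<lambda>_. ennreal (t\<^sup>2))"
    using lborel_affine[of t x] t by (simp add: ennreal_power)
  then have "(LINT z|lborel. f z) = (LINT z|density (distr lborel borel (\<lambda>z. x + t *\<^sub>R z)) (\<lambda>_. ennreal (t\<^sup>2)). f z)"
    by simp
  also have "\<dots> = t\<^sup>2 * (LINT z|lborel. f (x + t *\<^sub>R z))"
    by (simp add: integral_density integral_distr)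
  finally show ?thesis using t by simp
qed

lemma integrable_affine:
  fixes f :: "real^2 \<Rightarrow> real"
  assumes "integrable lborel f" and t: "t > 0"
  shows "integrable lborel (\<lambda>z. f (x + t *\<^sub>R z))"
proof -
  have [measurable]: "f \<in> borel_measurable borel" using assms by auto
  have "lborel = density (distr lborel borel (\<lambda>z. x + t *\<^sub>R z)) (\<lambda>_. ennreal (t\<^sup>2))"
    using lborel_affine[of t x] t by (simp add: ennreal_power)
  then have "integrable (density (distr lborel borel (\<lambda>z. x + t *\<^sub>R z)) (\<lambda>_. ennreal (t\<^sup>2))) f"
    using assms by simp
  then have "integrable lborel (\<lambda>z. t\<^sup>2 * f (x + t *\<^sub>R z))"
    by (simp add: integrable_density integrable_distr_eq)
  then show ?thesis using t by simp
qed

text \<open>\<open>Phi r\<close> of \<open>u\<close> is weakly subharmonic, so its mollifications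
  are classically subharmonic and the mean value inequality bounds them by their L^1 norm. Almost
  everywhere convergence carries the bound back to \<open>u\<close>.\<close>

lemma sup_bound:
  fixes u :: "real^2 \<Rightarrow> 'b::euclidean_space"
  assumes wp: "weak_poisson p R u G f" and \<kappa>: "0 \<le> \<kappa>"
    and ff: "AE x in lborel. x \<in> ball p R \<longrightarrow> f x = \<kappa> *\<^sub>R gV (u x)"
    and out: "\<And>y. norm y > R1 \<Longrightarrow> 0 \<le> y \<bullet> gV y" and R1: "0 \<le> R1" and t: "0 < t"
    and A: "(LINT x|lborel. indicator (ball p R) x * norm (u x)) \<le> A"
  shows "AE x in lborel. dist p x + t < R \<longrightarrow> norm (u x) \<le> sqrt (1 + R1\<^sup>2) + 2 + A / (t\<^sup>2 * eta_mass)"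
proof -
  \<comment> \<open>With this choice \<open>nf y > r\<close> means exactly
    \<open>norm y > R1\<close>, so \<open>dPhi r\<close> is nonzero only where the hypothesis
    \<open>out\<close> gives a sign.\<close>
  define r where "r = sqrt (1 + R1\<^sup>2)"
  have r: "1 \<le> r" by (simp add: r_def)
  have I: "integrable lborel u" "integrable lborel f"
    using wp unfolding weak_poisson_def by blast+
  have [measurable]: "u \<in> borel_measurable borel" "(Phi r :: 'b \<Rightarrow> real) \<in> borel_measurable borel"
    using I by (auto intro!: borel_measurable_continuous_onI continuous_Phi)
  have PB: "0 \<le> Phi r y" "Phi r y \<le> norm y" for y :: 'b by (rule Phi_bounds[OF r])+
  have dout: "0 \<le> dPhi r y \<bullet> gV y" for y
  proof (cases "norm y > R1")
    case True
    have "0 \<le> (qf' (nf y - r) * inverse (nf y)) * (y \<bullet> gV y)"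
      using out[OF True] qf'_bounds(1) nf_pos(1)[of y] by (intro mult_nonneg_nonneg) auto
    then show ?thesis by (simp add: dPhi_def)
  next
    case False
    have "nf y \<le> r" unfolding nf_def r_def using False
      by (simp add: power_mono power2_norm_eq_inner[symmetric])
    then show ?thesis by (simp add: dPhi_def qf'_def)
  qed
  have sign: "AE x in lborel. x \<in> ball p R \<longrightarrow> 0 \<le> dPhi r (u x) \<bullet> f x"
    using ff by eventually_elim (use dout \<kappa> in auto)
  \<comment> \<open>The truncation does not affect the mollifications at the points considered, and
    it makes the total integral at most \<open>A\<close>.\<close>
  define v where "v x = indicator (ball p R) x * Phi r (u x)" for x
  have v0: "0 \<le> v x" for x unfolding v_def by (intro mult_nonneg_nonneg Phi_bounds(1)[OF r]) simp
  have Iiu: "integrable lborel (\<lambda>x. indicator (ball p R) x * norm (u x))"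
    using integrable_real_mult_indicator[of "ball p R" lborel "\<lambda>x. norm (u x)"] I by (simp add: mult.commute)
  have Iv: "integrable lborel v"
  proof (rule Bochner_Integration.integrable_bound[OF Iiu])
    have "(\<lambda>x. Phi r (u x)) \<in> borel_measurable borel"
      by (rule measurable_compose[OF _ borel_measurable_continuous_onI[OF continuous_Phi(1)]]) simp
    then show "v \<in> borel_measurable lborel" unfolding v_def[abs_def]
      by (auto intro!: borel_measurable_times borel_measurable_indicator)
    show "AE x in lborel. norm (v x) \<le> norm (indicator (ball p R) x * norm (u x))"
      using PB by (intro AE_I2) (auto simp: v_def indicator_def)
  qed
  have intv: "(LINT x|lborel. v x) \<le> A"
  proof -
    have "(LINT x|lborel. v x) \<le> (LINT x|lborel. indicator (ball p R) x * norm (u x))"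
      using PB by (intro integral_mono Iv Iiu) (auto simp: v_def indicator_def)
    then show ?thesis using A by simp
  qed
  obtain d0 where d0: "\<And>n. 0 < d0 n" "\<And>n::nat. d0 n < 1" "d0 \<longlonglongrightarrow> 0"
    and lim0: "AE x in lborel. (\<lambda>n. conv (ker (d0 n)) v x) \<longlonglongrightarrow> v x"
    by (rule mollify_AE_subseq[OF Iv zero_less_one]) blast
  obtain N where N: "\<And>n. n \<ge> N \<Longrightarrow> integrable lborel (\<lambda>x. conv (ker (d0 n)) v x - v x)"
    using mollify_L1(1)[OF Iv d0(1,3)] unfolding eventually_sequentially by metis
  define d where "d n = d0 (n + N)" for n
  define vn where "vn n = conv (ker (d n)) v" for n
  have d: "0 < d n" "integrable lborel (\<lambda>x. vn n x - v x)" for n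
    using d0 N unfolding d_def vn_def by auto
  have dl: "d \<longlonglongrightarrow> 0" unfolding d_def by (rule LIMSEQ_ignore_initial_segment[OF d0(3)])
  have lim: "AE x in lborel. (\<lambda>n. vn n x) \<longlonglongrightarrow> v x"
    using lim0 by eventually_elim (auto simp: d_def vn_def dest: LIMSEQ_ignore_initial_segment)
  have L1: "(\<lambda>n. LINT x|lborel. norm (vn n x - v x)) \<longlonglongrightarrow> 0"
    unfolding d_def vn_def by (rule LIMSEQ_ignore_initial_segment[OF mollify_L1(2)[OF Iv d0(1,3)]])
  have Ivn: "integrable lborel (vn n)" for n
    using Bochner_Integration.integrable_add[OF d(2)[of n] Iv] by simp
  have mv: "eta_mass * vn n x \<le> (A + (LINT x|lborel. norm (vn n x - v x))) / t\<^sup>2" if x: "dist p x + t + d n < R" for n x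
  proof -
    note P = conv_ker_has_partials[OF d(1)[of n] Iv] and C = continuous_conv_ker''[OF d(1)[of n] Iv]
    have sub: "0 \<le> conv (ker'' (d n) 1 1) v y + conv (ker'' (d n) 2 2) v y" if y: "y \<in> cball x t" for y
    proof -
      have dy: "dist p y + d n < R" using dist_triangle[of p y x] x y by simp
      define \<delta> where "\<delta> = (R - (dist p y + d n)) / 2"
      have \<delta>: "0 < \<delta>" using dy by (simp add: \<delta>_def)
      have in_ball: "dist p z + \<delta> < R" if "z \<in> cball y (d n)" for z
        using dist_triangle[of p z y] that dy by (simp add: \<delta>_def field_simps)
      have oc: "y - z \<notin> ball 0 (d n)" if "z \<notin> cball y (d n)" for z
        using that by (simp add: dist_norm norm_minus_commute)
      have Pk: "has_partials (\<lambda>z. ker (d n) (y - z)) (\<lambda>i z. - ker' (d n) i (y - z))"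
        by (rule has_partials_reflect[OF has_partials_ker])
      have Pk': "has_partials (\<lambda>z. - ker' (d n) i (y - z)) (\<lambda>j z. ker'' (d n) i j (y - z))" for i
        using has_partials_minus[OF has_partials_reflect[OF has_partials_ker'[of "d n" i], of y]] by simp
      \<comment> \<open>Kato's inequality, tested with the kernel centred at \<open>y\<close>, says
        that the mollification of \<open>v\<close> has nonnegative Laplacian at
        \<open>y\<close>.\<close>
      have "0 \<le> (LINT z|lborel. Phi r (u z) * (ker'' (d n) 1 1 (y - z) + ker'' (d n) 2 2 (y - z)))"
      proof (rule kato_inequality[OF wp r sign Pk Pk' _ _ _ \<delta> in_ball])
        show "continuous_on UNIV (\<lambda>z. ker'' (d n) i j (y - z))" for i j
          by (intro continuous_on_compose2[OF continuous_ker(3)] continuous_intros) auto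
        show "0 \<le> ker (d n) (y - z)" for z using ker_nonneg[OF d(1)] .
        show "ker (d n) (y - z) = 0" if "z \<notin> cball y (d n)" for z
          using ker_outside(1)[OF d(1) oc[OF that]] .
      qed
      also have "\<dots> = (LINT z|lborel. ker'' (d n) 1 1 (y - z) *\<^sub>R v z + ker'' (d n) 2 2 (y - z) *\<^sub>R v z)"
      proof (intro Bochner_Integration.integral_cong refl)
        fix z
        show "Phi r (u z) * (ker'' (d n) 1 1 (y - z) + ker'' (d n) 2 2 (y - z))
           = ker'' (d n) 1 1 (y - z) *\<^sub>R v z + ker'' (d n) 2 2 (y - z) *\<^sub>R v z"
        proof (cases "z \<in> cball y (d n)")
          case True
          then have "z \<in> ball p R" using in_ball[OF True] \<delta> by simp
          then show ?thesis by (simp add: v_def algebra_simps)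
        qed (simp add: ker_outside(3)[OF d(1) oc])
      qed
      also have "\<dots> = conv (ker'' (d n) 1 1) v y + conv (ker'' (d n) 2 2) v y"
        unfolding conv_def
        by (intro Bochner_Integration.integral_add integrable_conv_kernel[OF Iv continuous_ker(3), of "d n"])
          (auto intro!: ker_outside(3) d)
      finally show ?thesis .
    qed
    have "eta_mass * vn n x \<le> (LINT z|lborel. (mcut z)\<^sup>2 * vn n (x + t *\<^sub>R z))"
      unfolding vn_def by (rule subharmonic_mean_value[OF P C sub t])
    also have "\<dots> \<le> (LINT z|lborel. norm (vn n (x + t *\<^sub>R z)))"
    proof (rule integral_mono)
      have cvn: "continuous_on UNIV (vn n)" unfolding vn_def by (rule has_partials_continuous[OF P(1)])
      show "integrable lborel (\<lambda>z. (mcut z)\<^sup>2 * vn n (x + t *\<^sub>R z))"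
        by (rule integrable_compact_support[of _ 0 1])
          (auto intro!: continuous_intros continuous_on_compose2[OF cvn] simp: mcut_outside)
      show "integrable lborel (\<lambda>z. norm (vn n (x + t *\<^sub>R z)))"
        by (rule integrable_affine[OF integrable_norm[OF Ivn] t])
      fix z
      have "(mcut z)\<^sup>2 * vn n (x + t *\<^sub>R z) \<le> (mcut z)\<^sup>2 * norm (vn n (x + t *\<^sub>R z))"
        by (intro mult_left_mono) auto
      also have "\<dots> \<le> 1 * norm (vn n (x + t *\<^sub>R z))"
        using mcut_bounds[of z] by (intro mult_right_mono) (auto simp: power_le_one)
      finally show "(mcut z)\<^sup>2 * vn n (x + t *\<^sub>R z) \<le> norm (vn n (x + t *\<^sub>R z))" by simp
    qed
    also have "\<dots> = (LINT z|lborel. norm (vn n z)) / t\<^sup>2"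
      using integral_affine[of "\<lambda>z. norm (vn n z)" t x] Ivn[of n] t by auto
    also have "\<dots> \<le> (A + (LINT x|lborel. norm (vn n x - v x))) / t\<^sup>2"
    proof (rule divide_right_mono)
      have "(LINT z|lborel. norm (vn n z)) \<le> (LINT z|lborel. v z + norm (vn n z - v z))"
      proof (rule integral_mono)
        show "integrable lborel (\<lambda>z. norm (vn n z))" by (rule integrable_norm[OF Ivn])
        show "integrable lborel (\<lambda>z. v z + norm (vn n z - v z))"
          by (rule Bochner_Integration.integrable_add[OF Iv integrable_norm[OF d(2)]])
        show "norm (vn n z) \<le> v z + norm (vn n z - v z)" for z using v0[of z] by (simp add: abs_if)
      qed
      then show "(LINT z|lborel. norm (vn n z)) \<le> A + (LINT x|lborel. norm (vn n x - v x))"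
        using Iv d(2)[of n] intv by simp
    qed simp
    finally show ?thesis .
  qed
  show ?thesis
    using lim
  proof eventually_elim
    case (elim x)
    show ?case
    proof
      assume x: "dist p x + t < R"
      have "(\<lambda>n. (A + (LINT x|lborel. norm (vn n x - v x))) / t\<^sup>2) \<longlonglongrightarrow> (A + 0) / t\<^sup>2"
        using t by (intro tendsto_intros L1) auto
      moreover have "(\<lambda>n. eta_mass * vn n x) \<longlonglongrightarrow> eta_mass * v x" by (intro tendsto_intros elim)
      moreover have "\<forall>\<^sub>F n in sequentially. d n < R - dist p x - t"
        using dl x by (intro order_tendstoD(2)) auto
      then have "\<forall>\<^sub>F n in sequentially. eta_mass * vn n x \<le> (A + (LINT x|lborel. norm (vn n x - v x))) / t\<^sup>2"
        by eventually_elim (intro mv; simp)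
      ultimately have "eta_mass * v x \<le> (A + 0) / t\<^sup>2" by (intro tendsto_le[OF sequentially_bot])
      then have "v x \<le> A / (t\<^sup>2 * eta_mass)"
        using eta_mass_pos t by (simp add: field_simps)
      moreover have "v x = Phi r (u x)" using x t by (simp add: v_def)
      ultimately show "norm (u x) \<le> sqrt (1 + R1\<^sup>2) + 2 + A / (t\<^sup>2 * eta_mass)"
        using Phi_bounds(3)[OF r, of "u x"] unfolding r_def by linarith
    qed
  qed
qed

section \<open>The potential and the cut-off\<close>

text \<open>The profile is the square of 1 minus s squared, where s rescales the squared radius to
  run from 0 to 1 across the annulus, continued by constants. The two squares flatten it at both
  ends, so it is C^1 and \<open>cc\<close> is continuous; working with the squared radius makes the
  gradient a multiple of \<open>x - p\<close>.\<close>

lemma radial_cutoff: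
  fixes p :: "real^2"
  assumes ab: "0 < a" "a < b"
  obtains ct cc :: "real^2 \<Rightarrow> real" where "has_partials ct (\<lambda>i x. - (cc x * (x$i - p$i)))" "continuous_on UNIV cc"
    "\<And>x. x \<notin> cball p b \<Longrightarrow> ct x = 0" "\<And>x. x \<notin> cball p b \<Longrightarrow> cc x = 0" "\<And>x. x \<in> ball p a \<Longrightarrow> cc x = 0"
    "\<And>x. x \<in> ball p a \<Longrightarrow> ct x = 1" "\<And>x. 0 \<le> ct x" "\<And>x. 0 \<le> cc x"
proof -
  define D where "D = b\<^sup>2 - a\<^sup>2"
  have D: "D > 0" using ab by (simp add: D_def power_strict_mono)
  define s where "s x = ((x - p) \<bullet> (x - p) - a\<^sup>2) * inverse D" for x
  define m where "m x = max 0 (1 - (max 0 (s x))\<^sup>2)" for x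
  define ct where "ct x = (m x)\<^sup>2" for x
  define cc where "cc x = 8 * m x * max 0 (s x) * inverse D" for x
  have Pi: "has_partials (\<lambda>x. (x - p) \<bullet> (x - p)) (\<lambda>i x. 2 * (x$i - p$i))"
    using has_partials_affine[OF has_partials_inner_self, of "-p" 1] by (simp add: algebra_simps)
  have Ps: "has_partials s (\<lambda>i x. (2 * (x$i - p$i) - 0) * inverse D + ((x - p) \<bullet> (x - p) - a\<^sup>2) * 0)"
    unfolding s_def[abs_def] by (intro has_partials_mult has_partials_diff Pi has_partials_const)
  have d1: "((\<lambda>t::real. (max 0 t)\<^sup>2) has_real_derivative 2 * max 0 t) (at t)" for t
    by (rule DERIV_comp_max0[of "\<lambda>t. t\<^sup>2" "\<lambda>t. 2 * t"]) (auto intro!: derivative_eq_intros)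
  have P2: "has_partials (\<lambda>x. 1 - (max 0 (s x))\<^sup>2) (\<lambda>i x. 0 - (2 * max 0 (s x)) * ((2 * (x$i - p$i) - 0) * inverse D + ((x - p) \<bullet> (x - p) - a\<^sup>2) * 0))"
    by (intro has_partials_diff has_partials_const has_partials_compose_real[OF Ps d1])
  have P3: "has_partials ct (\<lambda>i x. 2 * max 0 (1 - (max 0 (s x))\<^sup>2) *
     (0 - (2 * max 0 (s x)) * ((2 * (x$i - p$i) - 0) * inverse D + ((x - p) \<bullet> (x - p) - a\<^sup>2) * 0)))"
    unfolding ct_def[abs_def] m_def by (rule has_partials_compose_real[OF P2 d1])
  have P: "has_partials ct (\<lambda>i x. - (cc x * (x$i - p$i)))"
    by (rule back_subst[of "has_partials ct", OF P3]) (auto simp: fun_eq_iff cc_def m_def)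
  have c: "continuous_on UNIV cc"
    unfolding cc_def[abs_def] m_def s_def by (intro continuous_intros)
  have nsq: "(x - p) \<bullet> (x - p) = (dist p x)\<^sup>2" for x by (simp add: dist_norm norm_minus_commute power2_norm_eq_inner[symmetric])
  have outer: "m x = 0" if "x \<notin> cball p b" for x
  proof -
    have "b\<^sup>2 \<le> (dist p x)\<^sup>2" using that ab by (intro power_mono) auto
    then have "D \<le> (x - p) \<bullet> (x - p) - a\<^sup>2" by (simp add: nsq D_def)
    then have "1 \<le> s x" using D by (simp add: s_def field_simps)
    then have "1 \<le> (max 0 (s x))\<^sup>2" by (simp add: one_le_power)
    then show ?thesis by (simp add: m_def)
  qed
  have inner: "max 0 (s x) = 0" if "x \<in> ball p a" for x
  proof -
    have "(dist p x)\<^sup>2 \<le> a\<^sup>2" using that by (intro power_mono) auto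
    then have "s x \<le> 0" using D by (simp add: s_def nsq mult_le_0_iff)
    then show ?thesis by simp
  qed
  show ?thesis
  proof (rule that[OF P c])
    show "x \<notin> cball p b \<Longrightarrow> ct x = 0" "x \<notin> cball p b \<Longrightarrow> cc x = 0" for x
      using outer by (auto simp: ct_def cc_def)
    show "x \<in> ball p a \<Longrightarrow> cc x = 0" "x \<in> ball p a \<Longrightarrow> ct x = 1" for x
      using inner by (auto simp: ct_def cc_def m_def)
    show "0 \<le> ct x" "0 \<le> cc x" for x using D by (auto simp: ct_def cc_def m_def)
  qed
qed

section \<open>Consequences of the hypotheses on the potential\<close>

lemma Ck_continuous: "Ck k f \<Longrightarrow> continuous_on UNIV f"
proof (cases k)
  case (Suc m)
  assume "Ck k f"
  then have "f differentiable_on UNIV" by (simp add: Suc)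
  then show ?thesis by (rule differentiable_imp_continuous_on)
qed simp

lemma Ck_has_derivative:
  "Ck (Suc k) f \<Longrightarrow> (f has_derivative frechet_derivative f (at x)) (at x)"
proof -
  assume "Ck (Suc k) f"
  then have "f differentiable_on UNIV" by simp
  then have "f differentiable (at x)" unfolding differentiable_on_def by simp
  then show ?thesis by (simp only: frechet_derivative_works)
qed

lemma frechet_derivative_basis_sum:
  fixes f :: "'a::euclidean_space \<Rightarrow> 'b::real_normed_vector"
  assumes "Ck (Suc k) f"
  shows "frechet_derivative f (at x) h = (\<Sum>b\<in>Basis. (h \<bullet> b) *\<^sub>R frechet_derivative f (at x) b)"
proof -
  have "linear (frechet_derivative f (at x))"
    using Ck_has_derivative[OF assms] has_derivative_linear by blast
  then show ?thesis
    using linear_sum[of "frechet_derivative f (at x)" "\<lambda>b. (h \<bullet> b) *\<^sub>R b" Basis]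
    by (simp add: euclidean_representation linear_cmul)
qed

lemma gderiv_unique: "GDERIV f x :> D \<Longrightarrow> grad f x = D"
  unfolding grad_def
proof (rule the_equality)
  fix D' assume a: "GDERIV f x :> D" "GDERIV f x :> D'"
  have "(\<lambda>h. h \<bullet> D') = (\<lambda>h. h \<bullet> D)"
    by (rule has_derivative_unique) (use a in \<open>auto simp: gderiv_def\<close>)
  then have "(D' - D) \<bullet> D' = (D' - D) \<bullet> D" by (rule fun_cong)
  then have "(D' - D) \<bullet> (D' - D) = 0" by (simp add: inner_diff_right)
  then show "D' = D" by simp
qed

text \<open>\<open>grad\<close> is a definite description, so its values become usable only after a
  gradient has been exhibited; differentiability provides the coordinate sum.\<close>

lemma grad_eq_sum:
  assumes "Ck (Suc k) V"
  shows "grad V y = (\<Sum>b\<in>Basis. frechet_derivative V (at y) b *\<^sub>R b)"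
    "(V has_derivative (\<lambda>h. grad V y \<bullet> h)) (at y)"
proof -
  let ?g = "\<Sum>b\<in>Basis. frechet_derivative V (at y) b *\<^sub>R b"
  have eq: "frechet_derivative V (at y) = (\<lambda>h. ?g \<bullet> h)"
  proof
    fix h
    have "?g \<bullet> h = (\<Sum>b\<in>Basis. (h \<bullet> b) *\<^sub>R frechet_derivative V (at y) b)"
      unfolding inner_sum_left by (intro sum.cong refl) (simp add: inner_commute[of h])
    then show "frechet_derivative V (at y) h = ?g \<bullet> h"
      using frechet_derivative_basis_sum[OF assms, of y h] by simp
  qed
  have "GDERIV V y :> ?g"
    unfolding gderiv_def
    by (rule has_derivative_eq_rhs[OF Ck_has_derivative[OF assms]], rule ext, subst eq, rule inner_commute)
  then show g: "grad V y = ?g" by (rule gderiv_unique)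
  show "(V has_derivative (\<lambda>h. grad V y \<bullet> h)) (at y)"
    by (rule has_derivative_eq_rhs[OF Ck_has_derivative[OF assms]], rule ext, subst eq, simp only: g)
qed

text \<open>Expansion in coordinates reduces the Hessian to finitely many continuous second partial
  derivatives, which gives continuity jointly in the point and the direction.\<close>

lemma grad_differentiable:
  fixes V :: "'a::euclidean_space \<Rightarrow> real"
  assumes "Ck (Suc (Suc 0)) V"
  shows "(grad V has_derivative frechet_derivative (grad V) (at y)) (at y)"
    "continuous_on UNIV (\<lambda>(y, h). frechet_derivative (grad V) (at y) h)"
proof -
  let ?V1 = "\<lambda>b x. frechet_derivative V (at x) b"
  have C1: "Ck (Suc 0) (?V1 b)" if "b \<in> Basis" for b using assms that by simp
  have c2: "continuous_on UNIV (\<lambda>x. frechet_derivative (?V1 b) (at x) c)" if "b \<in> Basis" "c \<in> Basis" for b c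
    using C1[OF that(1)] that(2) by simp
  let ?D = "\<lambda>y h. \<Sum>b\<in>Basis. (\<Sum>c\<in>Basis. (h \<bullet> c) * frechet_derivative (?V1 b) (at y) c) *\<^sub>R b"
  have geq: "grad V = (\<lambda>y. \<Sum>b\<in>Basis. ?V1 b y *\<^sub>R b)" using grad_eq_sum(1)[OF assms] by (rule ext)
  have D: "(grad V has_derivative ?D y) (at y)" for y
    unfolding geq
  proof (rule has_derivative_sum)
    fix b :: 'a assume b: "b \<in> Basis"
    have "(?V1 b has_derivative frechet_derivative (?V1 b) (at y)) (at y)" by (rule Ck_has_derivative[OF C1[OF b]])
    then have "((\<lambda>y. ?V1 b y *\<^sub>R b) has_derivative (\<lambda>h. frechet_derivative (?V1 b) (at y) h *\<^sub>R b)) (at y)"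
      by (rule has_derivative_scaleR_left)
    moreover have "frechet_derivative (?V1 b) (at y) h = (\<Sum>c\<in>Basis. (h \<bullet> c) * frechet_derivative (?V1 b) (at y) c)" for h
      using frechet_derivative_basis_sum[OF C1[OF b], of y h] by (simp only: real_scaleR_def)
    then have "(\<lambda>h. frechet_derivative (?V1 b) (at y) h *\<^sub>R b)
       = (\<lambda>h. (\<Sum>c\<in>Basis. (h \<bullet> c) * frechet_derivative (?V1 b) (at y) c) *\<^sub>R b)"
      by (intro ext arg_cong[where f="\<lambda>t. t *\<^sub>R b"])
    ultimately show "((\<lambda>y. ?V1 b y *\<^sub>R b) has_derivative (\<lambda>h. (\<Sum>c\<in>Basis. (h \<bullet> c) * frechet_derivative (?V1 b) (at y) c) *\<^sub>R b)) (at y)"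
      by (rule has_derivative_eq_rhs)
  qed
  have eq: "frechet_derivative (grad V) (at y) = ?D y" for y
    using frechet_derivative_at[OF D[of y]] by (rule sym)
  show "(grad V has_derivative frechet_derivative (grad V) (at y)) (at y)" unfolding eq by (rule D)
  show "continuous_on UNIV (\<lambda>(y, h). frechet_derivative (grad V) (at y) h)"
    unfolding eq case_prod_beta
    by (intro continuous_intros continuous_on_compose2[OF c2]) auto
qed

lemma potential_nonneg:
  assumes "admissible_potential V" shows "0 \<le> V y"
proof -
  have "(INF y. V y) = 0" "bdd_below (range V)" using assms by (auto simp: admissible_potential_def)
  then show ?thesis using cINF_lower[of V UNIV y] by simp
qed

lemma potential_C2: "admissible_potential V \<Longrightarrow> Ck (Suc (Suc 0)) V"
  unfolding admissible_potential_def smooth_def by (elim conjE allE)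

lemma potential_continuous:
  assumes "admissible_potential V"
  shows "continuous_on UNIV V" "continuous_on UNIV (grad V)"
proof -
  show "continuous_on UNIV V" by (rule Ck_continuous[OF potential_C2[OF assms]])
  show "continuous_on UNIV (grad V)"
    by (intro continuous_at_imp_continuous_on ballI
        has_derivative_continuous[OF grad_differentiable(1)[OF potential_C2[OF assms]]])
qed

text \<open>A compactness argument: without such constants, counterexamples would converge to a well
  together with a unit direction in which the Hessian is not positive. Away from the wells
  \<open>C * V y\<close> makes up for whatever the Hessian does.\<close>

lemma potential_coercive:
  fixes V :: "real^'k \<Rightarrow> real"
  assumes "admissible_potential V"
  obtains l C where "0 < l" "0 \<le> C"
    "\<And>y h. norm y \<le> K \<Longrightarrow> h \<bullet> frechet_derivative (grad V) (at y) h \<ge> (l - C * V y) * (norm h)\<^sup>2"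
proof -
  let ?H = "\<lambda>y h. h \<bullet> frechet_derivative (grad V) (at y) h"
  note C2 = potential_C2[OF assms]
  have cV: "continuous_on UNIV V" by (rule potential_continuous[OF assms])
  have cH: "continuous_on UNIV (\<lambda>z. ?H (fst z) (snd z))"
    using grad_differentiable(2)[OF C2] by (intro continuous_intros) (simp add: case_prod_beta')
  have pos: "?H \<sigma> h > 0" if "V \<sigma> = 0" "h \<noteq> 0" for \<sigma> h
    using assms that unfolding admissible_potential_def zero_set_def by blast
  let ?S = "cball (0::real^'k) K \<times> sphere (0::real^'k) 1"
  have S: "compact ?S" by (intro compact_Times compact_cball compact_sphere)
  \<comment> \<open>One parameter lowers \<open>l\<close> and raises \<open>C\<close> at the same
    time, so a violation for some \<open>m\<close> is a violation for all smaller values. This is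
    what allows passing to a subsequence.\<close>
  have "\<exists>m::nat. \<forall>z\<in>?S. ?H (fst z) (snd z) \<ge> 1 / real (Suc m) - real m * V (fst z)"
  proof (rule ccontr)
    assume "\<not> ?thesis"
    then have "\<forall>m::nat. \<exists>z\<in>?S. ?H (fst z) (snd z) < 1 / real (Suc m) - real m * V (fst z)"
      by (auto simp: not_le)
    then obtain z where z: "\<And>m. z m \<in> ?S" "\<And>m. ?H (fst (z m)) (snd (z m)) < 1 / real (Suc m) - real m * V (fst (z m))"
      by metis
    obtain x \<phi> where x: "x \<in> ?S" "strict_mono \<phi>" "(z \<circ> \<phi>) \<longlonglongrightarrow> x"
      using S z(1) unfolding compact_def by blast
    let ?y = "\<lambda>n. z (\<phi> n)"
    have lim: "?y \<longlonglongrightarrow> x" using x(3) by (simp add: comp_def)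
    have limH: "(\<lambda>n. ?H (fst (?y n)) (snd (?y n))) \<longlonglongrightarrow> ?H (fst x) (snd x)"
      by (rule isCont_tendsto_compose[OF _ lim, of "\<lambda>z. ?H (fst z) (snd z)"])
        (use cH in \<open>simp only: continuous_on_eq_continuous_at[OF open_UNIV] UNIV_I ball_UNIV\<close>)
    have limV: "(\<lambda>n. V (fst (?y n))) \<longlonglongrightarrow> V (fst x)"
      by (rule isCont_tendsto_compose[OF _ tendsto_fst[OF lim], of V])
        (use cV in \<open>simp only: continuous_on_eq_continuous_at[OF open_UNIV] UNIV_I ball_UNIV\<close>)
    have bd: "?H (fst (?y n)) (snd (?y n)) < 1 / real (Suc n) - real n * V (fst (?y n))" for n
    proof -
      have n: "n \<le> \<phi> n" using seq_suble[OF x(2)] .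
      have "1 / real (Suc (\<phi> n)) \<le> 1 / real (Suc n)" using n by (intro divide_left_mono) auto
      moreover have "real n * V (fst (?y n)) \<le> real (\<phi> n) * V (fst (?y n))"
        using n potential_nonneg[OF assms] by (intro mult_right_mono) auto
      ultimately show ?thesis using z(2)[of "\<phi> n"] by linarith
    qed
    have i0: "(\<lambda>n. 1 / real (Suc n)) \<longlonglongrightarrow> 0" using LIMSEQ_inverse_real_of_nat by (simp add: inverse_eq_divide)
    have H0: "?H (fst x) (snd x) \<le> 0"
    proof (rule LIMSEQ_le[OF limH i0])
      have "?H (fst (?y n)) (snd (?y n)) \<le> 1 / real (Suc n)" for n
        using bd[of n] mult_nonneg_nonneg[OF of_nat_0_le_iff[of n] potential_nonneg[OF assms, of "fst (?y n)"]] by linarith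
      then show "\<exists>N. \<forall>n\<ge>N. ?H (fst (?y n)) (snd (?y n)) \<le> 1 / real (Suc n)" by blast
    qed
    \<comment> \<open>If \<open>V\<close> stayed positive in the limit, its growing multiples would
      push the Hessian values to minus infinity, while these converge.\<close>
    have V0: "V (fst x) \<le> 0"
    proof (rule ccontr)
      assume "\<not> V (fst x) \<le> 0"
      then have v: "V (fst x) > 0" by simp
      obtain N where N: "real N > (2 - ?H (fst x) (snd x)) / (V (fst x) / 2)"
        using reals_Archimedean2 by blast
      have "\<forall>\<^sub>F n in sequentially. V (fst x) / 2 < V (fst (?y n))"
        using v by (intro order_tendstoD(1)[OF limV]) simp
      moreover have "\<forall>\<^sub>F n in sequentially. ?H (fst x) (snd x) - 1 < ?H (fst (?y n)) (snd (?y n))"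
        by (intro order_tendstoD(1)[OF limH]) simp
      moreover have "\<forall>\<^sub>F n in sequentially. N \<le> n" by (rule eventually_ge_at_top)
      ultimately have "\<forall>\<^sub>F n in sequentially. False"
      proof eventually_elim
        case (elim n)
        have "2 - ?H (fst x) (snd x) < real N * (V (fst x) / 2)" using N v by (simp add: pos_divide_less_eq)
        also have "\<dots> \<le> real n * V (fst (?y n))" using elim v by (intro mult_mono) auto
        finally show False using bd[of n] elim(2) by (smt (verit) divide_le_eq_1 of_nat_0_less_iff of_nat_Suc of_nat_0_le_iff)
      qed
      then show False by simp
    qed
    then have "V (fst x) = 0" using potential_nonneg[OF assms, of "fst x"] by simp
    moreover have "snd x \<noteq> 0" using x(1) by auto
    ultimately show False using pos[of "fst x" "snd x"] H0 by simp
  qed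
  then obtain m where m: "\<And>y h. norm y \<le> K \<Longrightarrow> norm h = 1 \<Longrightarrow> ?H y h \<ge> 1 / real (Suc m) - real m * V y"
    by force
  show ?thesis
  proof (rule that[of "1 / real (Suc m)" "real m"])
    fix y h :: "real^'k" assume y: "norm y \<le> K"
    have lin: "linear (frechet_derivative (grad V) (at y))"
      using grad_differentiable(1)[OF C2] has_derivative_linear by blast
    show "?H y h \<ge> (1 / real (Suc m) - real m * V y) * (norm h)\<^sup>2"
    proof (cases "h = 0")
      case False
      define e where "e = h /\<^sub>R norm h"
      have e: "norm e = 1" "h = norm h *\<^sub>R e" using False by (auto simp: e_def)
      have "?H y h = (norm h)\<^sup>2 * ?H y e"
      proof -
        have "frechet_derivative (grad V) (at y) (norm h *\<^sub>R e) = norm h *\<^sub>R frechet_derivative (grad V) (at y) e"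
          by (rule linear_cmul[OF lin])
        then show ?thesis using e(2) by (metis (no_types) inner_scaleR_left inner_scaleR_right mult.assoc power2_eq_square)
      qed
      moreover have "(norm h)\<^sup>2 * ?H y e \<ge> (norm h)\<^sup>2 * (1 / real (Suc m) - real m * V y)"
        by (intro mult_left_mono m y e) auto
      ultimately show ?thesis by (simp add: mult.commute)
    qed simp
  qed auto
qed

lemma potential_bounded_gradient:
  assumes "admissible_potential V"
  obtains B where "\<And>y. norm y \<le> K \<Longrightarrow> norm (grad V y) \<le> B"
proof -
  have "bounded (grad V ` cball 0 K)"
    by (intro compact_imp_bounded compact_continuous_image continuous_on_subset[OF potential_continuous(2)[OF assms]]) auto
  then obtain B where "\<forall>z\<in>grad V ` cball 0 K. norm z \<le> B" unfolding bounded_iff by blast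
  then have "norm (grad V y) \<le> B" if "y \<in> cball 0 K" for y using that by blast
  then show ?thesis using that by fastforce
qed

text \<open>Beyond radius \<open>R\<close> the radial derivative of \<open>V\<close> is at least
  \<open>\<alpha> * R\<close>. The mean value theorem along the ray through \<open>y\<close> turns
  this into linear growth, with \<open>c = 1 / (\<alpha> * R)\<close>.\<close>

lemma potential_growth:
  fixes V :: "real^'k \<Rightarrow> real"
  assumes "admissible_potential V"
  obtains R c where "0 < R" "0 \<le> c" "\<And>y. norm y > R \<Longrightarrow> 0 \<le> y \<bullet> grad V y" "\<And>y. norm y \<le> R + c * V y"
proof -
  obtain \<alpha> R where R: "\<alpha> > 0" "R > 0" "\<And>y. norm y > R \<Longrightarrow> y \<bullet> grad V y \<ge> \<alpha> * (norm y)\<^sup>2"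
    using assms unfolding admissible_potential_def by blast
  note dV = grad_eq_sum(2)[OF potential_C2[OF assms]]
  show ?thesis
  proof (rule that[of R "1 / (\<alpha> * R)"])
    show "0 \<le> y \<bullet> grad V y" if "norm y > R" for y
      using R(3)[OF that] R(1) by (meson less_imp_le mult_nonneg_nonneg order_trans zero_le_power2)
    show "norm y \<le> R + 1 / (\<alpha> * R) * V y" for y
    proof (cases "norm y \<le> R")
      case True
      then show ?thesis using R potential_nonneg[OF assms, of y] by (simp add: add_increasing2)
    next
      case False
      define e where "e = y /\<^sub>R norm y"
      have e: "norm e = 1" "y = norm y *\<^sub>R e"
      proof -
        have "norm y \<noteq> 0" using False R(2) by linarith
        then show "norm e = 1" "y = norm y *\<^sub>R e" by (simp_all add: e_def)
      qed
      have "((\<lambda>t. V (t *\<^sub>R e)) has_real_derivative grad V (t *\<^sub>R e) \<bullet> e) (at t)" for t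
      proof -
        have "((\<lambda>t. t *\<^sub>R e) has_derivative (\<lambda>s. s *\<^sub>R e)) (at t)" by (auto intro!: derivative_eq_intros)
        from has_derivative_compose[OF this dV] show ?thesis
          unfolding has_field_derivative_def by (rule has_derivative_eq_rhs) (auto simp: mult.commute)
      qed
      from MVT2[of R "norm y" "\<lambda>t. V (t *\<^sub>R e)" "\<lambda>t. grad V (t *\<^sub>R e) \<bullet> e", OF _ this]
      obtain t where t: "R < t" "t < norm y" "V (norm y *\<^sub>R e) - V (R *\<^sub>R e) = (norm y - R) * (grad V (t *\<^sub>R e) \<bullet> e)"
        using False by auto
      have "\<alpha> * t\<^sup>2 \<le> t * (grad V (t *\<^sub>R e) \<bullet> e)"
        using R(3)[of "t *\<^sub>R e"] t e(1) R by (simp add: inner_commute)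
      then have "\<alpha> * t \<le> grad V (t *\<^sub>R e) \<bullet> e" using t R by (simp add: power2_eq_square)
      moreover have "\<alpha> * R \<le> \<alpha> * t" using t R by simp
      ultimately have "(norm y - R) * (\<alpha> * R) \<le> (norm y - R) * (grad V (t *\<^sub>R e) \<bullet> e)"
        using False by (intro mult_left_mono) auto
      also have "\<dots> \<le> V y" using t(3) e(2) potential_nonneg[OF assms, of "R *\<^sub>R e"] by simp
      finally have "norm y - R \<le> V y / (\<alpha> * R)" using R by (simp add: pos_le_divide_eq)
      then show ?thesis by simp
    qed
  qed (use R in auto)
qed

section \<open>From weak solutions to mollified equations\<close>

text \<open>Weak solutions are Lebesgue measurable and locally integrable on
  \<open>\<Omega>\<close>, whereas convolution is set up for Borel functions integrable on the
  plane. Restriction to a compact set and a change on a null set, coordinate by coordinate, bridge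
  the two.\<close>

lemma borel_representative:
  fixes g :: "real^2 \<Rightarrow> 'b::euclidean_space"
  assumes "set_integrable lebesgue K g" and K: "K \<in> sets borel"
  obtains g' where "integrable lborel g'" "AE x in lborel. g' x = indicator K x *\<^sub>R g x" "\<And>x. x \<notin> K \<Longrightarrow> g' x = 0"
proof -
  let ?h = "\<lambda>x. indicator K x *\<^sub>R g x"
  have h: "integrable lebesgue ?h" using assms(1) by (simp add: set_integrable_def)
  then have hm: "?h \<in> borel_measurable lebesgue" by auto
  have gb_ex: "\<exists>gb\<in>borel_measurable lborel. AE x in lborel. ?h x \<bullet> b = gb x" for b
    by (rule completion_ex_borel_measurable_real[OF borel_measurable_inner[OF hm borel_measurable_const]])
  define gb where "gb b = (SOME k. k \<in> borel_measurable lborel \<and> (AE x in lborel. ?h x \<bullet> b = k x))" for b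
  have "gb b \<in> borel_measurable lborel \<and> (AE x in lborel. ?h x \<bullet> b = gb b x)" for b
    unfolding gb_def by (rule someI_ex[of "\<lambda>k. k \<in> borel_measurable lborel \<and> (AE x in lborel. ?h x \<bullet> b = k x)"])
      (use gb_ex[of b] in blast)
  then have gb: "\<And>b. gb b \<in> borel_measurable lborel" "\<And>b. AE x in lborel. ?h x \<bullet> b = gb b x" by blast+
  define g' where "g' x = indicator K x *\<^sub>R (\<Sum>b\<in>Basis. gb b x *\<^sub>R b)" for x
  have g'm: "g' \<in> borel_measurable lborel"
    unfolding g'_def[abs_def] using K gb(1)
    by (intro borel_measurable_scaleR borel_measurable_indicator borel_measurable_sum) auto
  have "AE x in lborel. \<forall>b\<in>Basis. ?h x \<bullet> b = gb b x"
    using gb(2) by (intro AE_finite_allI) auto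
  then have ae: "AE x in lborel. g' x = ?h x"
  proof eventually_elim
    case (elim x)
    have "(\<Sum>b\<in>Basis. gb b x *\<^sub>R b) = (\<Sum>b\<in>Basis. (?h x \<bullet> b) *\<^sub>R b)"
      using elim by (intro sum.cong) auto
    then have "(\<Sum>b\<in>Basis. gb b x *\<^sub>R b) = ?h x" by (simp only: euclidean_representation)
    then show ?case unfolding g'_def by (cases "x \<in> K") auto
  qed
  have "integrable lebesgue g'"
    by (rule integrable_cong_AE_imp[OF h]) (use g'm ae in \<open>auto intro: measurable_completion AE_completion elim: eventually_mono\<close>)
  then have "integrable lborel g'" using g'm by (simp add: integrable_completion)
  then show ?thesis by (rule that[OF _ ae]) (simp add: g'_def)
qed

text \<open>The map \<open>pr\<close> stands for scalar multiplication, the inner product and real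
  multiplication, so that one argument transfers all the integrals in the weak formulations.\<close>

lemma integral_representative:
  fixes g :: "real^2 \<Rightarrow> 'b::euclidean_space" and k :: "real^2 \<Rightarrow> 'a::euclidean_space" and pr :: "'a \<Rightarrow> 'b \<Rightarrow> 'c::euclidean_space"
  assumes bl: "bounded_bilinear pr" and k: "continuous_on UNIV k" "\<And>x. x \<notin> K \<Longrightarrow> k x = 0"
    and K: "compact K" "K \<subseteq> \<Omega>" and op: "open \<Omega>" and g: "set_integrable lebesgue K g"
    and g': "integrable lborel g'" "AE x in lborel. g' x = indicator K x *\<^sub>R g x"
  shows "integrable (lebesgue_on \<Omega>) (\<lambda>x. pr (k x) (g x))" "integrable lborel (\<lambda>x. pr (k x) (g' x))"
    "(LINT x|lebesgue_on \<Omega>. pr (k x) (g x)) = (LINT x|lborel. pr (k x) (g' x))"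
proof -
  interpret bounded_bilinear pr by fact
  have sO: "\<Omega> \<inter> space lebesgue \<in> sets lebesgue" using op by auto
  have Kb: "K \<in> sets borel" using K(1) by (simp add: borel_compact)
  let ?h = "\<lambda>x. indicator K x *\<^sub>R g x"
  have h: "integrable lebesgue ?h" using g by (simp add: set_integrable_def)
  have "bounded (k ` K)" by (intro compact_imp_bounded compact_continuous_image continuous_on_subset[OF k(1)] K) auto
  then obtain B where "\<forall>z\<in>k ` K. norm z \<le> B" unfolding bounded_iff by blast
  then have B: "norm (k x) \<le> max B 0" for x using k(2)[of x] by (cases "x \<in> K") (auto simp: le_max_iff_disj)
  obtain C where C: "C \<ge> 0" "\<And>a b. norm (pr a b) \<le> norm a * norm b * C" using nonneg_bounded by blast
  have km: "k \<in> borel_measurable borel" using k(1) by (rule borel_measurable_continuous_onI)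
  have prc: "continuous_on UNIV (\<lambda>z. pr (fst z) (snd z))" by (intro continuous_on continuous_intros)
  have eq: "indicator \<Omega> x *\<^sub>R pr (k x) (g x) = pr (k x) (?h x)" for x
    using k(2)[of x] K(2) by (cases "x \<in> K") (auto simp: scaleR_right zero_left)
  have fm: "(\<lambda>x. pr (k x) (?h x)) \<in> borel_measurable lebesgue"
    by (rule borel_measurable_continuous_Pair[OF _ _ prc]) (use km h in \<open>auto intro: measurable_completion\<close>)
  have f'm: "(\<lambda>x. pr (k x) (g' x)) \<in> borel_measurable lborel"
    by (rule borel_measurable_continuous_Pair[OF _ _ prc]) (use km g' in auto)
  have bound: "norm (pr (k x) z) \<le> (max B 0 * C) * norm z" for x z
  proof -
    have "norm (pr (k x) z) \<le> norm (k x) * norm z * C" by (rule C(2))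
    also have "\<dots> \<le> max B 0 * norm z * C" using B[of x] C(1) by (intro mult_right_mono) auto
    finally show ?thesis by (simp add: mult_ac)
  qed
  have int: "integrable lebesgue (\<lambda>x. pr (k x) (?h x))"
  proof (rule Bochner_Integration.integrable_bound[OF _ fm])
    show "integrable lebesgue (\<lambda>x. (max B 0 * C) * norm (?h x))" using integrable_norm[OF h] by simp
    show "AE x in lebesgue. norm (pr (k x) (?h x)) \<le> norm ((max B 0 * C) * norm (?h x))"
      by (intro AE_I2 order_trans[OF bound]) simp
  qed
  then show "integrable (lebesgue_on \<Omega>) (\<lambda>x. pr (k x) (g x))"
    by (subst integrable_restrict_space[OF sO]) (simp only: eq)
  have ae: "AE x in lborel. pr (k x) (g' x) = pr (k x) (?h x)" using g'(2) by eventually_elim simp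
  have int': "integrable lebesgue (\<lambda>x. pr (k x) (g' x))"
    by (rule integrable_cong_AE_imp[OF int]) (use f'm ae in \<open>auto intro: measurable_completion AE_completion elim: eventually_mono\<close>)
  then show "integrable lborel (\<lambda>x. pr (k x) (g' x))" using f'm by (simp add: integrable_completion)
  have "(LINT x|lebesgue_on \<Omega>. pr (k x) (g x)) = (LINT x|lebesgue. pr (k x) (?h x))"
    by (subst integral_restrict_space[OF sO]) (simp only: eq)
  also have "\<dots> = (LINT x|lebesgue. pr (k x) (g' x))"
    by (rule integral_cong_AE) (use fm f'm ae in \<open>auto intro: measurable_completion AE_completion elim: eventually_mono\<close>)
  also have "\<dots> = (LINT x|lborel. pr (k x) (g' x))" by (rule integral_completion[OF f'm])
  finally show "(LINT x|lebesgue_on \<Omega>. pr (k x) (g x)) = (LINT x|lborel. pr (k x) (g' x))" .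
qed

lemma conv_component:
  fixes g :: "real^2 \<Rightarrow> real^'k"
  assumes "integrable lborel (\<lambda>y. k (x - y) *\<^sub>R g y)"
  shows "conv k g x $ m = (LINT y|lborel. k (x - y) * g y $ m)"
  unfolding conv_def using integral_bounded_linear[OF bounded_linear_vec_nth assms, of m] by simp

lemma set_integrable_component:
  fixes g :: "real^2 \<Rightarrow> 'b::euclidean_space"
  assumes "set_integrable lebesgue K g" "bounded_linear h"
  shows "set_integrable lebesgue K (\<lambda>x. h (g x))"
  using integrable_bounded_linear[OF assms(2) assms(1)[unfolded set_integrable_def]]
  unfolding set_integrable_def by (simp add: linear_cmul[OF bounded_linear.linear[OF assms(2)]])

text \<open>Membership in the Sobolev space guarantees that the choice made by
  \<open>weak_gradient\<close> picks an actual weak gradient.\<close>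

lemma weak_solution_weak_gradient:
  assumes "weak_solution \<Omega> V \<epsilon> u"
  shows "has_weak_gradient \<Omega> u (weak_gradient \<Omega> u)"
proof -
  obtain G0 where "has_weak_gradient \<Omega> u G0" using assms unfolding weak_solution_def sobolev_H1_def by blast
  then show ?thesis
    unfolding weak_gradient_def by (rule someI[of "has_weak_gradient \<Omega> u"])
qed

lemma weak_solution_set_integrable:
  assumes "weak_solution \<Omega> V \<epsilon> u" "compact K" "K \<subseteq> \<Omega>"
  shows "set_integrable lebesgue K u" "set_integrable lebesgue K (weak_gradient \<Omega> u)"
  using weak_solution_weak_gradient[OF assms(1)] assms(2,3)
  unfolding has_weak_gradient_def locally_integrable_def by blast+

text \<open>While \<open>dist p x + d < R\<close>, the kernel centred at \<open>x\<close> is an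
  admissible test function. With it both weak equations become equations between convolutions
  evaluated at \<open>x\<close>.\<close>

lemma weak_solution_weak_poisson:
  fixes u :: "real^2 \<Rightarrow> real^'k"
  assumes ws: "weak_solution \<Omega> V \<epsilon> u" and op: "open \<Omega>" and sub: "cball p R \<subseteq> \<Omega>"
  obtains u' G f where "weak_poisson p R u' G f"
    "AE x in lborel. x \<in> cball p R \<longrightarrow> u' x = u x \<and> (\<forall>i m. G i x $ m = weak_gradient \<Omega> u x $ m $ i) \<and>
       f x = (1 / \<epsilon>\<^sup>2) *\<^sub>R grad V (u' x)"
proof -
  let ?K = "cball p R"
  let ?Gw = "weak_gradient \<Omega> u"
  have K: "compact ?K" "?K \<in> sets borel" by auto
  note wg = weak_solution_weak_gradient[OF ws]
  note su = weak_solution_set_integrable(1)[OF ws K(1) sub] and sG = weak_solution_set_integrable(2)[OF ws K(1) sub]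
  have sf: "set_integrable lebesgue ?K (\<lambda>x. grad V (u x))"
    using ws K sub unfolding weak_solution_def locally_integrable_def by blast
  obtain u' where u': "integrable lborel u'" "AE x in lborel. u' x = indicator ?K x *\<^sub>R u x" "\<And>x. x \<notin> ?K \<Longrightarrow> u' x = 0"
    by (rule borel_representative[OF su K(2)]) blast
  obtain G' where G': "integrable lborel G'" "AE x in lborel. G' x = indicator ?K x *\<^sub>R ?Gw x" "\<And>x. x \<notin> ?K \<Longrightarrow> G' x = 0"
    by (rule borel_representative[OF sG K(2)]) blast
  obtain f' where f': "integrable lborel f'" "AE x in lborel. f' x = indicator ?K x *\<^sub>R grad V (u x)" "\<And>x. x \<notin> ?K \<Longrightarrow> f' x = 0"
    by (rule borel_representative[OF sf K(2)]) blast
  \<comment> \<open>Rows of the gradient matrix belong to components of \<open>u\<close>;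
    \<open>G i\<close> is a column, the derivative of all components in direction
    \<open>i\<close>.\<close>
  define G where "G i x = (\<chi> m. G' x $ m $ i)" for i :: 2 and x
  define f where "f x = (1 / \<epsilon>\<^sup>2) *\<^sub>R f' x" for x
  have blG: "bounded_linear (\<lambda>A::real^2^'k. (\<chi> m. A $ m $ i) :: real^'k)" for i
    by (rule linear_linear[THEN iffD2]) (auto intro!: linearI simp: vec_eq_iff)
  have IG: "integrable lborel (G i)" for i
    unfolding G_def[abs_def] by (rule integrable_bounded_linear[OF blG G'(1)])
  have If: "integrable lborel f" unfolding f_def[abs_def] using f'(1) by simp
  have blm: "bounded_linear (\<lambda>y::real^'k. y $ m)" for m by (rule bounded_linear_vec_nth)
  have blM: "bounded_linear (\<lambda>A::real^2^'k. A $ m)" for m by (rule bounded_linear_vec_nth)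
  have wp: "weak_poisson p R u' G f"
    unfolding weak_poisson_def
  proof (intro conjI allI impI u'(1) IG If)
    fix x d assume "0 < d \<and> dist p x + d < R"
    then have d: "0 < d" "dist p x + d < R" by auto
    define \<phi> where "\<phi> y = ker d (x - y)" for y
    \<comment> \<open>The minus sign arises because the kernel is evaluated at \<open>x - y\<close>
      and differentiated in \<open>y\<close>.\<close>
    define g\<phi> where "g\<phi> y = (\<chi> i. - ker' d i (x - y))" for y
    have out: "x - y \<notin> ball 0 d" if "y \<notin> cball x d" for y using that by (simp add: dist_norm norm_minus_commute)
    have inK: "cball x d \<subseteq> ?K"
    proof
      fix y assume "y \<in> cball x d"
      then have "dist x y \<le> d" by simp
      then show "y \<in> ?K" unfolding mem_cball using dist_triangle[of p y x] d by linarith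
    qed
    have \<phi>0: "\<phi> y = 0" "g\<phi> y = 0" if "y \<notin> ?K" for y
    proof -
      have "y \<notin> cball x d" using inK that by blast
      then show "\<phi> y = 0" "g\<phi> y = 0"
        using ker_outside[OF d(1) out] by (auto simp: \<phi>_def g\<phi>_def vec_eq_iff)
    qed
    have c\<phi>: "continuous_on UNIV \<phi>" unfolding \<phi>_def[abs_def]
      by (intro continuous_on_compose2[OF continuous_ker(1)] continuous_intros) auto
    have cg\<phi>: "continuous_on UNIV g\<phi>" unfolding g\<phi>_def[abs_def]
      by (intro continuous_intros continuous_on_compose2[OF continuous_ker(2)]) auto
    have grad\<phi>: "grad \<phi> = g\<phi>"
    proof
      fix y
      have "has_partials \<phi> (\<lambda>i y. - ker' d i (x - y))"
        unfolding \<phi>_def[abs_def] by (rule has_partials_reflect[OF has_partials_ker])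
      from has_partialsD[OF this, of y] have "GDERIV \<phi> y :> g\<phi> y"
        unfolding gderiv_def by (rule has_derivative_eq_rhs) (auto simp: fun_eq_iff inner_real2 g\<phi>_def)
      then show "grad \<phi> y = g\<phi> y" by (rule gderiv_unique)
    qed
    have test: "test_function \<Omega> \<phi>"
    proof -
      have "{y. \<phi> y \<noteq> 0} \<subseteq> cball x d" unfolding \<phi>_def using ker_outside(1)[OF d(1) out] by blast
      then have cl: "closure {y. \<phi> y \<noteq> 0} \<subseteq> cball x d" by (simp add: closure_minimal)
      then have "compact (closure {y. \<phi> y \<noteq> 0})"
        by (meson bounded_cball bounded_subset closed_closure compact_eq_bounded_closed)
      moreover have "closure {y. \<phi> y \<noteq> 0} \<subseteq> \<Omega>" using cl inK sub by blast
      ultimately show ?thesis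
        unfolding test_function_def compact_support_in_def \<phi>_def using smooth_ker_translate by blast
    qed
    have Iu: "integrable lborel (\<lambda>y. ker' d i (x - y) *\<^sub>R u' y)" for i
      by (rule integrable_conv_kernel[OF u'(1) continuous_ker(2), of d]) (use ker_outside[OF d(1)] in auto)
    have IkG: "integrable lborel (\<lambda>y. ker d (x - y) *\<^sub>R G i y)" "integrable lborel (\<lambda>y. ker' d j (x - y) *\<^sub>R G i y)" for i j
      by (rule integrable_conv_kernel[OF IG continuous_ker(1), of d], use ker_outside[OF d(1)] in auto)
         (rule integrable_conv_kernel[OF IG continuous_ker(2), of d], use ker_outside[OF d(1)] in auto)
    have Ikf: "integrable lborel (\<lambda>y. ker d (x - y) *\<^sub>R f y)"
      by (rule integrable_conv_kernel[OF If continuous_ker(1), of d]) (use ker_outside[OF d(1)] in auto)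
    have u'm: "AE y in lborel. u' y $ m = indicator ?K y *\<^sub>R (u y $ m)" for m
      using u'(2) by eventually_elim simp
    have G'm: "AE y in lborel. G' y $ m = indicator ?K y *\<^sub>R (?Gw y $ m)" for m
      using G'(2) by eventually_elim simp
    have f'm: "AE y in lborel. f' y $ m = indicator ?K y *\<^sub>R (grad V (u y) $ m)" for m
      using f'(2) by eventually_elim simp
    have bsc: "bounded_bilinear (\<lambda>(k::real^2) (g::real). g *\<^sub>R k)"
      by (rule bounded_bilinear.flip[OF bounded_bilinear_scaleR])
    have T1: "integrable lborel (\<lambda>y. (u' y $ m) *\<^sub>R g\<phi> y)"
      "(LINT y|lebesgue_on \<Omega>. (u y $ m) *\<^sub>R g\<phi> y) = (LINT y|lborel. (u' y $ m) *\<^sub>R g\<phi> y)" for m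
      by (rule integral_representative(2,3)[OF bsc cg\<phi> _ K(1) sub op set_integrable_component[OF su blm] integrable_bounded_linear[OF blm u'(1)] u'm];
        fact \<phi>0(2))+
    have T2: "integrable lborel (\<lambda>y. \<phi> y *\<^sub>R (G' y $ m))"
      "(LINT y|lebesgue_on \<Omega>. \<phi> y *\<^sub>R (?Gw y $ m)) = (LINT y|lborel. \<phi> y *\<^sub>R (G' y $ m))" for m
      by (rule integral_representative(2,3)[OF bounded_bilinear_scaleR c\<phi> _ K(1) sub op set_integrable_component[OF sG blM] integrable_bounded_linear[OF blM G'(1)] G'm];
        fact \<phi>0(1))+
    have T3: "(LINT y|lebesgue_on \<Omega>. g\<phi> y \<bullet> (?Gw y $ m)) = (LINT y|lborel. g\<phi> y \<bullet> (G' y $ m))" for m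
      by (rule integral_representative(3)[OF bounded_bilinear_inner cg\<phi> _ K(1) sub op set_integrable_component[OF sG blM] integrable_bounded_linear[OF blM G'(1)] G'm];
        fact \<phi>0(2))
    have T4: "(LINT y|lebesgue_on \<Omega>. \<phi> y * (grad V (u y) $ m)) = (LINT y|lborel. \<phi> y * (f' y $ m))" for m
      by (rule integral_representative(3)[OF bounded_bilinear_mult c\<phi> _ K(1) sub op set_integrable_component[OF sf blm] integrable_bounded_linear[OF blm f'(1)] f'm];
        fact \<phi>0(1))
    show "conv (ker' d i) u' x = conv (ker d) (G i) x" for i
    proof (rule vec_eq_iff[THEN iffD2], rule allI)
      fix m
      have "(LINT y|lebesgue_on \<Omega>. (u y $ m) *\<^sub>R grad \<phi> y) = - (LINT y|lebesgue_on \<Omega>. \<phi> y *\<^sub>R (?Gw y $ m))"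
        using wg test unfolding has_weak_gradient_def by blast
      then have eq: "(LINT y|lborel. (u' y $ m) *\<^sub>R g\<phi> y) = - (LINT y|lborel. \<phi> y *\<^sub>R (G' y $ m))"
        unfolding grad\<phi> T1(2) T2(2) .
      have "(LINT y|lborel. (u' y $ m) *\<^sub>R g\<phi> y) $ i = (LINT y|lborel. ((u' y $ m) *\<^sub>R g\<phi> y) $ i)"
        by (rule integral_bounded_linear[OF bounded_linear_vec_nth T1(1), symmetric])
      also have "\<dots> = (LINT y|lborel. - (ker' d i (x - y) * u' y $ m))"
        by (intro Bochner_Integration.integral_cong refl) (simp add: g\<phi>_def)
      also have "\<dots> = - (conv (ker' d i) u' x $ m)" by (simp add: conv_component[OF Iu])
      finally have l: "(LINT y|lborel. (u' y $ m) *\<^sub>R g\<phi> y) $ i = - (conv (ker' d i) u' x $ m)" .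
      have "(LINT y|lborel. \<phi> y *\<^sub>R (G' y $ m)) $ i = (LINT y|lborel. (\<phi> y *\<^sub>R (G' y $ m)) $ i)"
        by (rule integral_bounded_linear[OF bounded_linear_vec_nth T2(1), symmetric])
      also have "\<dots> = (LINT y|lborel. ker d (x - y) * G i y $ m)"
        by (intro Bochner_Integration.integral_cong refl) (simp add: \<phi>_def G_def)
      also have "\<dots> = conv (ker d) (G i) x $ m" by (simp add: conv_component[OF IkG(1)])
      finally have rr: "(LINT y|lborel. \<phi> y *\<^sub>R (G' y $ m)) $ i = conv (ker d) (G i) x $ m" .
      show "conv (ker' d i) u' x $ m = conv (ker d) (G i) x $ m"
        using arg_cong[OF eq, of "\<lambda>v. v $ i"] l rr by simp
    qed
    show "conv (ker' d 1) (G 1) x + conv (ker' d 2) (G 2) x = conv (ker d) f x"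
    proof (rule vec_eq_iff[THEN iffD2], rule allI)
      fix m
      have "(LINT y|lebesgue_on \<Omega>. (?Gw y $ m) \<bullet> grad \<phi> y) = - (1 / \<epsilon>\<^sup>2) * (LINT y|lebesgue_on \<Omega>. (grad V (u y) $ m) * \<phi> y)"
        using ws test unfolding weak_solution_def by blast
      then have eq: "(LINT y|lborel. g\<phi> y \<bullet> (G' y $ m)) = - (1 / \<epsilon>\<^sup>2) * (LINT y|lborel. \<phi> y * f' y $ m)"
        unfolding T3[symmetric] T4[symmetric] grad\<phi> by (simp add: inner_commute mult.commute)
      have I1: "integrable lborel (\<lambda>y. ker' d j (x - y) * G i y $ m)" for i j
        using integrable_bounded_linear[OF blm IkG(2)] by simp
      have "(LINT y|lborel. g\<phi> y \<bullet> (G' y $ m)) = (LINT y|lborel. - (ker' d 1 (x - y) * G 1 y $ m + ker' d 2 (x - y) * G 2 y $ m))"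
        by (intro Bochner_Integration.integral_cong refl) (simp add: g\<phi>_def G_def inner_real2)
      also have "\<dots> = - (conv (ker' d 1) (G 1) x $ m + conv (ker' d 2) (G 2) x $ m)"
        using I1 by (simp add: conv_component[OF IkG(2)] del: minus_add_distrib)
      finally have l: "(LINT y|lborel. g\<phi> y \<bullet> (G' y $ m)) = - (conv (ker' d 1) (G 1) x $ m + conv (ker' d 2) (G 2) x $ m)" .
      have "conv (ker d) f x $ m = (LINT y|lborel. (1 / \<epsilon>\<^sup>2) * (\<phi> y * f' y $ m))"
        unfolding conv_component[OF Ikf] by (intro Bochner_Integration.integral_cong refl) (simp add: f_def \<phi>_def)
      then have "conv (ker d) f x $ m = (1 / \<epsilon>\<^sup>2) * (LINT y|lborel. \<phi> y * f' y $ m)" by simp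
      then show "(conv (ker' d 1) (G 1) x + conv (ker' d 2) (G 2) x) $ m = conv (ker d) f x $ m"
        using eq l by simp
    qed
  qed
  have "AE x in lborel. x \<in> ?K \<longrightarrow> u' x = u x \<and> (\<forall>i m. G i x $ m = ?Gw x $ m $ i) \<and> f x = (1 / \<epsilon>\<^sup>2) *\<^sub>R grad V (u' x)"
    using u'(2) G'(2) f'(2) by eventually_elim (auto simp: G_def f_def)
  with wp show ?thesis by (rule that)
qed

section \<open>Energy integrals of weak solutions and the conclusion\<close>

lemma weak_poisson_mono:
  "weak_poisson p R u G f \<Longrightarrow> R' \<le> R \<Longrightarrow> weak_poisson p R' u G f"
  unfolding weak_poisson_def by (meson order_less_le_trans)

lemma norm_matrix_sq: "(norm (A::real^2^'k))\<^sup>2 = (norm (\<chi> m. A $ m $ 1))\<^sup>2 + (norm (\<chi> m. A $ m $ 2))\<^sup>2"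
  unfolding power2_norm_eq_inner inner_vec_def sum_2 by (simp add: sum.distrib)

text \<open>This carries weighted energies from the chosen weak gradient and Lebesgue measure on
  \<open>\<Omega>\<close> to the Borel representatives; the Frobenius norm splits into the two
  columns.\<close>

lemma integral_energy_density:
  fixes u :: "real^2 \<Rightarrow> real^'k"
  assumes ws: "weak_solution \<Omega> V \<epsilon> u" and op: "open \<Omega>" and sub: "cball p b \<subseteq> \<Omega>" and cV: "continuous_on UNIV V"
    and k: "continuous_on UNIV k" "\<And>x. x \<notin> cball p b \<Longrightarrow> k x = 0"
    and ae: "AE x in lborel. x \<in> cball p b \<longrightarrow> u' x = u x \<and> (\<forall>i m. G i x $ m = weak_gradient \<Omega> u x $ m $ i)"
    and meas: "u' \<in> borel_measurable borel" "\<And>i. G i \<in> borel_measurable borel"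
  shows "(LINT x|lebesgue_on \<Omega>. k x * energy_density \<Omega> V \<epsilon> u x)
    = (LINT x|lborel. k x * (\<epsilon> * (((norm (G 1 x))\<^sup>2 + (norm (G 2 x))\<^sup>2) / 2) + (1 / \<epsilon>) * V (u' x)))"
proof -
  let ?K = "cball p b" and ?Gw = "weak_gradient \<Omega> u"
  let ?e = "\<lambda>x. \<epsilon> * (((norm (G 1 x))\<^sup>2 + (norm (G 2 x))\<^sup>2) / 2) + (1 / \<epsilon>) * V (u' x)"
  have sO: "\<Omega> \<inter> space lebesgue \<in> sets lebesgue" using op by auto
  note si = weak_solution_set_integrable[OF ws compact_cball sub]
  have [measurable]: "u' \<in> borel_measurable borel" "\<And>i. G i \<in> borel_measurable borel" "V \<in> borel_measurable borel" "k \<in> borel_measurable borel"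
    using meas cV k(1) by (auto intro: borel_measurable_continuous_onI)
  have um: "(\<lambda>x. indicator ?K x *\<^sub>R u x) \<in> borel_measurable lebesgue" and Gm: "(\<lambda>x. indicator ?K x *\<^sub>R ?Gw x) \<in> borel_measurable lebesgue"
    using si unfolding set_integrable_def by auto
  have Gn: "(\<lambda>x. norm (indicator ?K x *\<^sub>R ?Gw x)) \<in> borel_measurable lebesgue"
    by (rule measurable_compose[OF Gm borel_measurable_norm])
  have Vm: "(\<lambda>x. V (indicator ?K x *\<^sub>R u x)) \<in> borel_measurable lebesgue"
    by (rule measurable_compose[OF um]) measurable
  have km: "k \<in> borel_measurable lebesgue" by (rule measurable_completion) simp
  have fm: "(\<lambda>x. k x * (\<epsilon> * ((norm (indicator ?K x *\<^sub>R ?Gw x))\<^sup>2 / 2) + (1 / \<epsilon>) * V (indicator ?K x *\<^sub>R u x))) \<in> borel_measurable lebesgue"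
    by (intro borel_measurable_times borel_measurable_add borel_measurable_divide borel_measurable_power Gn km Vm borel_measurable_const)
  have f'm: "(\<lambda>x. k x * ?e x) \<in> borel_measurable lborel" by measurable
  have "(LINT x|lebesgue_on \<Omega>. k x * energy_density \<Omega> V \<epsilon> u x) = (LINT x|lebesgue. indicator \<Omega> x *\<^sub>R (k x * energy_density \<Omega> V \<epsilon> u x))"
    by (rule integral_restrict_space[OF sO])
  also have "\<dots> = (LINT x|lebesgue. k x * (\<epsilon> * ((norm (indicator ?K x *\<^sub>R ?Gw x))\<^sup>2 / 2) + (1 / \<epsilon>) * V (indicator ?K x *\<^sub>R u x)))"
  proof (intro Bochner_Integration.integral_cong refl)
    fix x
    show "indicator \<Omega> x *\<^sub>R (k x * energy_density \<Omega> V \<epsilon> u x)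
      = k x * (\<epsilon> * ((norm (indicator ?K x *\<^sub>R ?Gw x))\<^sup>2 / 2) + (1 / \<epsilon>) * V (indicator ?K x *\<^sub>R u x))"
      using k(2)[of x] subsetD[OF sub, of x] by (cases "x \<in> ?K") (simp_all add: energy_density_def del: mem_cball)
  qed
  also have "\<dots> = (LINT x|lebesgue. k x * ?e x)"
  proof (rule integral_cong_AE[OF fm])
    show "(\<lambda>x. k x * ?e x) \<in> borel_measurable lebesgue" using f'm by (rule measurable_completion)
    have "AE x in lborel. k x * (\<epsilon> * ((norm (indicator ?K x *\<^sub>R ?Gw x))\<^sup>2 / 2) + (1 / \<epsilon>) * V (indicator ?K x *\<^sub>R u x)) = k x * ?e x"
      using ae
    proof eventually_elim
      case (elim x)
      show ?case
      proof (cases "x \<in> ?K")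
        case True
        have "G i x = (\<chi> m. ?Gw x $ m $ i)" for i using elim True by (simp add: vec_eq_iff)
        then have "(norm (?Gw x))\<^sup>2 = (norm (G 1 x))\<^sup>2 + (norm (G 2 x))\<^sup>2" by (simp add: norm_matrix_sq)
        then show ?thesis using elim True by simp
      qed (simp add: k(2))
    qed
    then show "AE x in lebesgue. k x * (\<epsilon> * ((norm (indicator ?K x *\<^sub>R ?Gw x))\<^sup>2 / 2) + (1 / \<epsilon>) * V (indicator ?K x *\<^sub>R u x)) = k x * ?e x"
      by (rule AE_completion)
  qed
  also have "\<dots> = (LINT x|lborel. k x * ?e x)" by (rule integral_completion[OF f'm])
  finally show ?thesis .
qed

text \<open>As \<open>\<epsilon> \<le> 1\<close>, the potential lies below its share of the energy
  density, so the energy bounds the integral of \<open>V (u' x)\<close> over the disc. The linear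
  growth of \<open>V\<close> converts this into an L^1 bound for \<open>u'\<close>.\<close>

lemma energy_bounds_L1:
  fixes u :: "real^2 \<Rightarrow> real^'k"
  assumes op: "open \<Omega>" and sub: "cball p R \<subseteq> \<Omega>" and V: "\<And>y. 0 \<le> V y" "continuous_on UNIV V"
    and eps: "0 < \<epsilon>" "\<epsilon> \<le> 1" and en: "energy \<Omega> V \<epsilon> u \<le> ennreal M" and M: "0 \<le> M"
    and u': "integrable lborel u'" "AE x in lborel. x \<in> cball p R \<longrightarrow> u' x = u x"
    and growth: "\<And>y. norm y \<le> R1 + c * V y" "0 \<le> c" "0 \<le> R1"
  shows "(LINT x|lborel. indicator (ball p R) x * norm (u' x)) \<le> R1 * measure lborel (ball p R) + c * M"
proof -
  let ?i = "\<lambda>x. indicator (ball p R) x :: real"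
  have sO: "\<Omega> \<inter> space lebesgue \<in> sets lebesgue" using op by auto
  have [measurable]: "u' \<in> borel_measurable borel" "V \<in> borel_measurable borel"
    using u' V(2) by (auto intro: borel_measurable_continuous_onI)
  have Vm: "(\<lambda>x. ?i x * V (u' x)) \<in> borel_measurable lborel"
    by (intro borel_measurable_times borel_measurable_indicator) auto
  have fin: "emeasure lborel (ball p R) < \<infinity>" by (rule emeasure_bounded_finite) simp
  have "(\<integral>\<^sup>+x. ennreal (?i x * V (u' x)) \<partial>lborel) \<le> (\<integral>\<^sup>+x. ennreal (energy_density \<Omega> V \<epsilon> u x) * indicator \<Omega> x \<partial>lborel)"
  proof (rule nn_integral_mono_AE)
    show "AE x in lborel. ennreal (?i x * V (u' x)) \<le> ennreal (energy_density \<Omega> V \<epsilon> u x) * indicator \<Omega> x"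
      using u'(2)
    proof eventually_elim
      case (elim x)
      show ?case
      proof (cases "x \<in> ball p R")
        case True
        then have x: "x \<in> cball p R" "x \<in> \<Omega>" using sub ball_subset_cball by blast+
        have "V (u x) \<le> (1 / \<epsilon>) * V (u x)"
          using mult_right_mono[of 1 "1 / \<epsilon>" "V (u x)"] eps V(1) by simp
        also have "\<dots> \<le> energy_density \<Omega> V \<epsilon> u x" unfolding energy_density_def using eps by simp
        finally show ?thesis using elim x True by (simp add: ennreal_leI)
      qed simp
    qed
  qed
  also have "\<dots> = (\<integral>\<^sup>+x. ennreal (energy_density \<Omega> V \<epsilon> u x) * indicator \<Omega> x \<partial>lebesgue)"
    by (rule nn_integral_completion[symmetric])
  also have "\<dots> = energy \<Omega> V \<epsilon> u"
    unfolding energy_def by (rule nn_integral_restrict_space[OF sO, symmetric])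
  finally have nn: "(\<integral>\<^sup>+x. ennreal (?i x * V (u' x)) \<partial>lborel) \<le> ennreal M" using en by simp
  have V0: "0 \<le> ?i x * V (u' x)" for x using V(1) by simp
  have IV: "integrable lborel (\<lambda>x. ?i x * V (u' x))"
    using nn V0 by (intro integrableI_nonneg Vm) (auto intro: le_less_trans)
  have intV: "(LINT x|lborel. ?i x * V (u' x)) \<le> M"
    using nn nn_integral_eq_integral[OF IV] V0 M by simp
  have Ii: "integrable lborel ?i" using fin by (intro integrable_real_indicator) auto
  have "(LINT x|lborel. ?i x * norm (u' x)) \<le> (LINT x|lborel. R1 * ?i x + c * (?i x * V (u' x)))"
  proof (rule integral_mono)
    show "integrable lborel (\<lambda>x. ?i x * norm (u' x))"
      using integrable_real_mult_indicator[of "ball p R" lborel "\<lambda>x. norm (u' x)"] u'(1) by (simp add: mult.commute)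
    show "integrable lborel (\<lambda>x. R1 * ?i x + c * (?i x * V (u' x)))" using Ii IV by simp
    show "?i x * norm (u' x) \<le> R1 * ?i x + c * (?i x * V (u' x))" for x
      using growth(1)[of "u' x"] by (auto simp: indicator_def)
  qed
  also have "\<dots> = R1 * measure lborel (ball p R) + c * (LINT x|lborel. ?i x * V (u' x))"
    using Ii IV by simp
  also have "\<dots> \<le> R1 * measure lborel (ball p R) + c * M"
    using intV growth(2) by (intro add_left_mono mult_left_mono)
  finally show ?thesis .
qed

text \<open>The order of choices is the point: \<open>K\<close>, and with it \<open>B\<close>,
  \<open>l\<close> and \<open>C\<close>, depend on the potential, the discs and \<open>M\<close>,
  and are fixed before \<open>\<epsilon>\<close> and \<open>u\<close> are introduced.\<close>

lemma local_energy_estimate: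
  fixes V :: "real^'k \<Rightarrow> real"
  assumes adm: "admissible_potential V" and op: "open \<Omega>" and sub: "cball p R \<subseteq> \<Omega>" and bR: "0 < b" "b < R"
    and ct: "has_partials ct (\<lambda>i x. - (cc x * (x$i - p$i)))" and ccc: "continuous_on UNIV cc"
    and supp: "\<And>x. x \<notin> cball p b \<Longrightarrow> ct x = 0" "\<And>x. x \<notin> cball p b \<Longrightarrow> cc x = 0"
    and nonneg: "\<And>x. 0 \<le> ct x" "\<And>x. 0 \<le> cc x" and M: "0 \<le> M"
  obtains \<epsilon>\<^sub>0 C1 C2 C3 where "0 < \<epsilon>\<^sub>0" "\<And>\<epsilon> u. 0 < \<epsilon> \<Longrightarrow> \<epsilon> < \<epsilon>\<^sub>0 \<Longrightarrow> \<epsilon> \<le> 1 \<Longrightarrow> weak_solution \<Omega> V \<epsilon> u \<Longrightarrow>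
     energy \<Omega> V \<epsilon> u \<le> ennreal M \<Longrightarrow>
     (LINT x|lebesgue_on \<Omega>. ct x * energy_density \<Omega> V \<epsilon> u x) \<le>
       C1 * (LINT x|lebesgue_on \<Omega>. cc x * energy_density \<Omega> V \<epsilon> u x)
       + C2 * sqrt \<epsilon> * (C3 + (LINT x|lebesgue_on \<Omega>. cc x * energy_density \<Omega> V \<epsilon> u x))"
proof -
  \<comment> \<open>The gap between the radii is split into three: one third for the mean value
    inequality, one as an upper bound for \<open>\<epsilon>\<close> in the gradient estimate, one in
    reserve for the strict inequalities.\<close>
  define t where "t = (R - b) / 3"
  have t: "0 < t" "b + 3 * t = R"
  proof -
    show "0 < t" using bR by (simp add: t_def)
    have "3 * t = R - b" by (simp add: t_def)
    then show "b + 3 * t = R" by simp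
  qed
  obtain R1 c where g: "0 < R1" "0 \<le> c" "\<And>y. norm y > R1 \<Longrightarrow> 0 \<le> y \<bullet> grad V y" "\<And>y. norm y \<le> R1 + c * V y"
    by (rule potential_growth[OF adm]) blast
  define A where "A = R1 * measure lborel (ball p R) + c * M"
  have A0: "0 \<le> A" unfolding A_def using g M by simp
  define K where "K = sqrt (1 + R1\<^sup>2) + 2 + A / (t\<^sup>2 * eta_mass)"
  have K: "0 \<le> K" unfolding K_def using A0 t eta_mass_pos by (intro add_nonneg_nonneg) auto
  obtain B where B: "\<And>y. norm y \<le> K \<Longrightarrow> norm (grad V y) \<le> B" by (rule potential_bounded_gradient[OF adm]) blast
  obtain l C where lC: "0 < l" "0 \<le> C"
    "\<And>y h. norm y \<le> K \<Longrightarrow> h \<bullet> frechet_derivative (grad V) (at y) h \<ge> (l - C * V y) * (norm h)\<^sup>2"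
    by (rule potential_coercive[OF adm]) blast
  note pn = potential_nonneg[OF adm]
  note C2 = potential_C2[OF adm]
  have cct: "continuous_on UNIV ct" by (rule has_partials_continuous[OF ct])
  let ?c1 = "4 * mcut_mass / eta_mass * K + B"
  show ?thesis
  proof (rule that[OF t(1)])
    fix \<epsilon> and u :: "real^2 \<Rightarrow> real^'k"
    assume eps: "0 < \<epsilon>" "\<epsilon> < t" "\<epsilon> \<le> 1" and ws: "weak_solution \<Omega> V \<epsilon> u" and en: "energy \<Omega> V \<epsilon> u \<le> ennreal M"
    obtain u' G f where wp: "weak_poisson p R u' G f" and ae: "AE x in lborel. x \<in> cball p R \<longrightarrow> u' x = u x \<and>
        (\<forall>i m. G i x $ m = weak_gradient \<Omega> u x $ m $ i) \<and> f x = (1 / \<epsilon>\<^sup>2) *\<^sub>R grad V (u' x)"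
      by (rule weak_solution_weak_poisson[OF ws op sub]) blast
    have I: "integrable lborel u'" "\<And>i. integrable lborel (G i)" using wp unfolding weak_poisson_def by blast+
    have meas: "u' \<in> borel_measurable borel" "\<And>i. G i \<in> borel_measurable borel" using I by auto
    have ff: "AE x in lborel. x \<in> ball p R \<longrightarrow> f x = (1 / \<epsilon>\<^sup>2) *\<^sub>R grad V (u' x)"
      using ae by eventually_elim auto
    have ae1: "AE x in lborel. x \<in> cball p R \<longrightarrow> u' x = u x" using ae by eventually_elim auto
    have ae2: "AE x in lborel. x \<in> cball p b \<longrightarrow> u' x = u x \<and> (\<forall>i m. G i x $ m = weak_gradient \<Omega> u x $ m $ i)"
      using ae by eventually_elim (use bR in auto)
    have subb: "cball p b \<subseteq> \<Omega>" using sub bR by (meson less_imp_le order_trans subset_cball)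
    have AA: "(LINT x|lborel. indicator (ball p R) x * norm (u' x)) \<le> A"
      unfolding A_def
      by (rule energy_bounds_L1[OF op sub pn potential_continuous(1)[OF adm] eps(1,3) en M I(1) ae1 g(4,2) less_imp_le[OF g(1)]])
    have "AE x in lborel. dist p x + t < R \<longrightarrow> norm (u' x) \<le> K"
      unfolding K_def by (rule sup_bound[OF wp _ ff g(3) less_imp_le[OF g(1)] t(1) AA]) simp
    then have bu: "AE x in lborel. x \<in> ball p (R - t) \<longrightarrow> norm (u' x) \<le> K"
      by eventually_elim auto
    have ff': "AE x in lborel. x \<in> ball p (R - t) \<longrightarrow> f x = (1 / \<epsilon>\<^sup>2) *\<^sub>R grad V (u' x)"
      using ff by eventually_elim (use t in auto)
    have bt: "b + \<epsilon> < R - t" using eps t by simp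
    have est: "(LINT x|lborel. ct x * (\<epsilon> * (((norm (G 1 x))\<^sup>2 + (norm (G 2 x))\<^sup>2) / 2) + (1 / \<epsilon>) * V (u' x)))
       \<le> ((C * ?c1\<^sup>2 / l + 1) * b\<^sup>2 / 2) * (LINT x|lborel. cc x * (\<epsilon> * (((norm (G 1 x))\<^sup>2 + (norm (G 2 x))\<^sup>2) / 2) + (1 / \<epsilon>) * V (u' x)))
       + B * b / (2 * l) * sqrt \<epsilon> * ((LINT x|lborel. cc x) + (LINT x|lborel. cc x * (\<epsilon> * (((norm (G 1 x))\<^sup>2 + (norm (G 2 x))\<^sup>2) / 2) + (1 / \<epsilon>) * V (u' x))))"
      by (rule energy_estimate(3)[OF weak_poisson_mono[OF wp] eps(1) bt bR(1) bu K ff' grad_eq_sum(2)[OF C2] pn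
           grad_differentiable(1)[OF C2] grad_differentiable(2)[OF C2] B lC(3) lC(1,2) ct ccc]; (fact supp nonneg | use t in simp))
    then show "(LINT x|lebesgue_on \<Omega>. ct x * energy_density \<Omega> V \<epsilon> u x) \<le>
       ((C * ?c1\<^sup>2 / l + 1) * b\<^sup>2 / 2) * (LINT x|lebesgue_on \<Omega>. cc x * energy_density \<Omega> V \<epsilon> u x)
       + B * b / (2 * l) * sqrt \<epsilon> * ((LINT x|lborel. cc x) + (LINT x|lebesgue_on \<Omega>. cc x * energy_density \<Omega> V \<epsilon> u x))"
      using integral_energy_density[OF ws op subb potential_continuous(1)[OF adm] cct supp(1) ae2 meas]
        integral_energy_density[OF ws op subb potential_continuous(1)[OF adm] ccc supp(2) ae2 meas]
      by simp
  qed
qed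

text \<open>The weight \<open>cc\<close> is zero outside the null annulus, so the energy it sees
  tends to zero along the sequence, and the estimate forces the same on the energy seen by
  \<open>ct\<close>. Since \<open>ct\<close> is 1 on the inner disc, the limit measure gives no mass
  to it.\<close>

lemma isolated_energy_vanishes:
  fixes V :: "real^'k \<Rightarrow> real"
  assumes adm: "admissible_potential V" and op: "open \<Omega>" and M: "0 \<le> M"
    and eps: "\<And>n. 0 < \<epsilon> n \<and> \<epsilon> n \<le> 1" "\<epsilon> \<longlonglongrightarrow> 0"
    and ws: "\<And>n. weak_solution \<Omega> V (\<epsilon> n) (u n)" and en: "\<And>n. energy \<Omega> V (\<epsilon> n) (u n) \<le> ennreal M"
    and conv: "densities_converge_weakly \<Omega> (\<lambda>n. energy_density \<Omega> V (\<epsilon> n) (u n)) \<nu>"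
    and ab: "0 < a" "a < b" and sub: "cball p b \<subseteq> \<Omega>" and ann: "emeasure \<nu> (cball p b - ball p a) = 0"
  shows "emeasure \<nu> (ball p a) = 0"
proof -
  have sets: "sets \<nu> = sets (restrict_space borel \<Omega>)" and fin: "\<And>K. compact K \<Longrightarrow> K \<subseteq> \<Omega> \<Longrightarrow> emeasure \<nu> K < \<infinity>"
    using conv unfolding densities_converge_weakly_def radon_measure_on_def by blast+
  have inS: "S \<in> sets \<nu>" if "S \<in> sets borel" "S \<subseteq> \<Omega>" for S
    unfolding sets sets_restrict_space using that by (intro image_eqI[of _ _ S]) auto
  obtain ct cc :: "real^2 \<Rightarrow> real" where cut: "has_partials ct (\<lambda>i x. - (cc x * (x$i - p$i)))" "continuous_on UNIV cc"
    "\<And>x. x \<notin> cball p b \<Longrightarrow> ct x = 0" "\<And>x. x \<notin> cball p b \<Longrightarrow> cc x = 0" "\<And>x. x \<in> ball p a \<Longrightarrow> cc x = 0"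
    "\<And>x. x \<in> ball p a \<Longrightarrow> ct x = 1" "\<And>x. 0 \<le> ct x" "\<And>x. 0 \<le> cc x"
    by (rule radial_cutoff[OF ab, of p]) blast
  have cct: "continuous_on UNIV ct" by (rule has_partials_continuous[OF cut(1)])
  \<comment> \<open>The estimate needs a slightly larger disc inside \<open>\<Omega>\<close>. A
    point beyond radius \<open>b\<close> is compared with its radial projection to the circle of
    radius \<open>b\<close>, from which it has distance at most \<open>d\<close>.\<close>
  obtain R where R: "b < R" "cball p R \<subseteq> \<Omega>"
  proof -
    obtain d where d: "d > 0" "(\<Union>x\<in>cball p b. cball x d) \<subseteq> \<Omega>"
      using compact_subset_open_imp_cball_epsilon_subset[OF compact_cball op sub] by metis
    have "cball p (b + d) \<subseteq> \<Omega>"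
    proof
      fix y assume y: "y \<in> cball p (b + d)"
      show "y \<in> \<Omega>"
      proof (cases "y \<in> cball p b")
        case False
        define s where "s = b / dist p y"
        have dp: "dist p y > b" using False by simp
        then have dp0: "0 < dist p y" using ab by linarith
        then have s: "0 < s" "s < 1" using ab dp by (simp_all add: s_def)
        define x where "x = p + s *\<^sub>R (y - p)"
        have "dist p x = s * dist p y" using s by (simp add: x_def dist_norm norm_minus_commute)
        then have "dist p x = b" using dp0 by (simp add: s_def)
        have "y - x = (1 - s) *\<^sub>R (y - p)" by (simp add: x_def algebra_simps)
        then have "norm (y - x) = (1 - s) * norm (y - p)" using s by simp
        then have "dist x y = (1 - s) * dist p y" by (metis dist_commute dist_norm)
        then have "dist x y = dist p y - b" using dp0 by (simp add: s_def field_simps)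
        then have "dist x y \<le> d" using y by simp
        then have "y \<in> cball x d" by simp
        moreover have "x \<in> cball p b" using \<open>dist p x = b\<close> by simp
        ultimately show ?thesis using d(2) by blast
      qed (use sub in auto)
    qed
    then show ?thesis using that[of "b + d"] d by simp
  qed
  have b0: "0 < b" using ab by simp
  have "\<exists>\<epsilon>\<^sub>0 C1 C2 C3. 0 < \<epsilon>\<^sub>0 \<and> (\<forall>\<epsilon> u. 0 < \<epsilon> \<and> \<epsilon> < \<epsilon>\<^sub>0 \<and> \<epsilon> \<le> 1 \<and> weak_solution \<Omega> V \<epsilon> u \<and>
     energy \<Omega> V \<epsilon> u \<le> ennreal M \<longrightarrow>
     (LINT x|lebesgue_on \<Omega>. ct x * energy_density \<Omega> V \<epsilon> u x) \<le>
       C1 * (LINT x|lebesgue_on \<Omega>. cc x * energy_density \<Omega> V \<epsilon> u x)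
       + C2 * sqrt \<epsilon> * (C3 + (LINT x|lebesgue_on \<Omega>. cc x * energy_density \<Omega> V \<epsilon> u x)))" (is ?ex)
  proof (rule local_energy_estimate[OF adm op R(2) b0 R(1) cut(1,2) _ _ _ _ M])
    show "x \<notin> cball p b \<Longrightarrow> ct x = 0" "x \<notin> cball p b \<Longrightarrow> cc x = 0" for x by (fact cut)+
    show "0 \<le> ct x" "0 \<le> cc x" for x by (fact cut)+
    fix \<epsilon>\<^sub>0 C1 C2 C3
    assume "0 < \<epsilon>\<^sub>0" "\<And>\<epsilon> u. 0 < \<epsilon> \<Longrightarrow> \<epsilon> < \<epsilon>\<^sub>0 \<Longrightarrow> \<epsilon> \<le> 1 \<Longrightarrow> weak_solution \<Omega> V \<epsilon> u \<Longrightarrow>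
     energy \<Omega> V \<epsilon> u \<le> ennreal M \<Longrightarrow>
     (LINT x|lebesgue_on \<Omega>. ct x * energy_density \<Omega> V \<epsilon> u x) \<le>
       C1 * (LINT x|lebesgue_on \<Omega>. cc x * energy_density \<Omega> V \<epsilon> u x)
       + C2 * sqrt \<epsilon> * (C3 + (LINT x|lebesgue_on \<Omega>. cc x * energy_density \<Omega> V \<epsilon> u x))"
    then show ?ex by (intro exI[of _ \<epsilon>\<^sub>0] exI[of _ C1] exI[of _ C2] exI[of _ C3]) simp
  qed
  then obtain \<epsilon>\<^sub>0 C1 C2 C3 where e0: "0 < \<epsilon>\<^sub>0" and est: "\<And>\<epsilon> u. 0 < \<epsilon> \<and> \<epsilon> < \<epsilon>\<^sub>0 \<and> \<epsilon> \<le> 1 \<and> weak_solution \<Omega> V \<epsilon> u \<and>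
     energy \<Omega> V \<epsilon> u \<le> ennreal M \<Longrightarrow>
     (LINT x|lebesgue_on \<Omega>. ct x * energy_density \<Omega> V \<epsilon> u x) \<le>
       C1 * (LINT x|lebesgue_on \<Omega>. cc x * energy_density \<Omega> V \<epsilon> u x)
       + C2 * sqrt \<epsilon> * (C3 + (LINT x|lebesgue_on \<Omega>. cc x * energy_density \<Omega> V \<epsilon> u x))"
    by auto
  have cs: "compact_support_in \<Omega> k" if "\<And>x. x \<notin> cball p b \<Longrightarrow> k x = 0" for k :: "real^2 \<Rightarrow> real"
  proof -
    have "{x. k x \<noteq> 0} \<subseteq> cball p b" using that by blast
    then have cl: "closure {x. k x \<noteq> 0} \<subseteq> cball p b" by (simp add: closure_minimal)
    then have "compact (closure {x. k x \<noteq> 0})"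
      by (meson bounded_cball bounded_subset closed_closure compact_eq_bounded_closed)
    then show ?thesis unfolding compact_support_in_def using cl sub by blast
  qed
  have cst: "compact_support_in \<Omega> ct" by (rule cs) (fact cut(3))
  have csc: "compact_support_in \<Omega> cc" by (rule cs) (fact cut(4))
  define X where "X n = (LINT x|lebesgue_on \<Omega>. ct x * energy_density \<Omega> V (\<epsilon> n) (u n) x)" for n
  define Y where "Y n = (LINT x|lebesgue_on \<Omega>. cc x * energy_density \<Omega> V (\<epsilon> n) (u n) x)" for n
  have limX: "X \<longlonglongrightarrow> (LINT x|\<nu>. ct x)" unfolding X_def
    using conv cct cst unfolding densities_converge_weakly_def by blast
  have limY: "Y \<longlonglongrightarrow> (LINT x|\<nu>. cc x)" unfolding Y_def
    using conv cut(2) csc unfolding densities_converge_weakly_def by blast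
  have "(LINT x|\<nu>. cc x) = 0"
  proof (rule integral_eq_zero_AE)
    have "cball p b - ball p a \<in> null_sets \<nu>"
      using ann sub by (auto simp: null_sets_def intro!: inS)
    then show "AE x in \<nu>. cc x = 0" by (rule AE_I') (use cut(4,5) in blast)
  qed
  with limY have limY: "Y \<longlonglongrightarrow> 0" by simp
  have "(\<lambda>n. C1 * Y n + C2 * sqrt (\<epsilon> n) * (C3 + Y n)) \<longlonglongrightarrow> C1 * 0 + C2 * sqrt 0 * (C3 + 0)"
    by (intro tendsto_intros limY eps(2))
  moreover have "\<forall>\<^sub>F n in sequentially. \<epsilon> n < \<epsilon>\<^sub>0" using eps(2) e0 by (rule order_tendstoD(2))
  then have "\<forall>\<^sub>F n in sequentially. X n \<le> C1 * Y n + C2 * sqrt (\<epsilon> n) * (C3 + Y n)"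
    by eventually_elim (unfold X_def Y_def, rule est, use eps(1) ws en in auto)
  ultimately have "(LINT x|\<nu>. ct x) \<le> C1 * 0 + C2 * sqrt 0 * (C3 + 0)"
    using limX by (intro tendsto_le[OF sequentially_bot])
  then have ct0: "(LINT x|\<nu>. ct x) \<le> 0" by simp
  have ctm: "ct \<in> borel_measurable \<nu>"
  proof -
    have "ct \<in> borel_measurable (restrict_space borel \<Omega>)"
      by (rule measurable_restrict_space1) (rule borel_measurable_continuous_onI[OF cct])
    then show ?thesis using measurable_cong_sets[OF sets refl] by blast
  qed
  obtain Mt where Mt: "\<And>x. norm (ct x) \<le> Mt" "0 \<le> Mt" using bounded_compact_support[OF cct cut(3)] by metis
  \<comment> \<open>The measure \<open>\<nu>\<close> is finite on \<open>cball p b\<close>.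
    Integrability is what identifies the limit of the sequence \<open>X\<close> with the nonnegative
    integral that bounds the mass of the inner disc.\<close>
  have ctI: "integrable \<nu> ct"
  proof (rule Bochner_Integration.integrable_bound[OF _ ctm])
    show "integrable \<nu> (\<lambda>x. indicator (cball p b) x *\<^sub>R Mt)"
      using fin[OF compact_cball sub] inS[OF _ sub] by (intro integrable_scaleR_left integrable_real_indicator) auto
    show "AE x in \<nu>. norm (ct x) \<le> norm (indicator (cball p b) x *\<^sub>R Mt)"
      using Mt cut(3) by (intro AE_I2) (auto simp: indicator_def)
  qed
  have "ball p a \<subseteq> \<Omega>" using sub ab by (meson ball_subset_cball less_imp_le order_trans subset_cball)
  then have "emeasure \<nu> (ball p a) = (\<integral>\<^sup>+x. indicator (ball p a) x \<partial>\<nu>)" using inS by simp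
  also have "\<dots> \<le> (\<integral>\<^sup>+x. ennreal (ct x) \<partial>\<nu>)"
    using cut(6,7) by (intro nn_integral_mono) (auto simp: indicator_def)
  also have "\<dots> = ennreal (LINT x|\<nu>. ct x)" using cut(7) by (intro nn_integral_eq_integral ctI) auto
  also have "\<dots> = 0" using ct0 by (simp add: ennreal_neg)
  finally show ?thesis by simp
qed

theorem proposition4:
  fixes \<Omega> :: "(real^2) set"
    and V :: "real^'k \<Rightarrow> real"
    and M\<^sub>0 \<eta>\<^sub>1 \<theta> :: real
    and \<epsilon> :: "nat \<Rightarrow> real"
    and u :: "nat \<Rightarrow> real^2 \<Rightarrow> real^'k"
    and \<nu> :: "(real^2) measure"
    and x\<^sub>0 e :: "real^2"
  assumes "smooth_bounded_domain \<Omega>"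
    and "admissible_potential V"
    and "M\<^sub>0 > 0"
    and "\<And>n. 0 < \<epsilon> n \<and> \<epsilon> n \<le> 1"
    and "\<epsilon> \<longlonglongrightarrow> 0"
    and "\<And>n. weak_solution \<Omega> V (\<epsilon> n) (u n)"
    and "\<And>n. energy \<Omega> V (\<epsilon> n) (u n) \<le> ennreal M\<^sub>0"
    and "densities_converge_weakly \<Omega> (\<lambda>n. energy_density \<Omega> V (\<epsilon> n) (u n)) \<nu>"
    and "clearing_out_constant \<Omega> V \<eta>\<^sub>1"
    and "regular_point (concentration_set \<Omega> \<nu> \<eta>\<^sub>1) x\<^sub>0"
    and "tangent_vector (concentration_set \<Omega> \<nu> \<eta>\<^sub>1) x\<^sub>0 e"
    and "0 < \<theta>" and "\<theta> < pi / 2"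
  shows "\<exists>R>0. \<forall>r. 0 < r \<and> r \<le> R \<longrightarrow>
           concentration_set \<Omega> \<nu> \<eta>\<^sub>1 \<inter> ball x\<^sub>0 r \<subseteq> double_cone x\<^sub>0 e \<theta>"
proof (rule cone_containment)
  show eta: "\<eta>\<^sub>1 > 0" using assms(9) by (simp add: clearing_out_constant_def)
  show op: "open \<Omega>" using assms(1) by (simp add: smooth_bounded_domain_def)
  show "sets \<nu> = sets (restrict_space borel \<Omega>)"
    using assms(8) unfolding densities_converge_weakly_def radon_measure_on_def by blast
  \<comment> \<open>The uniform energy bound is brought into the form of a finite supremum, because
    the clearing-out property is applied to the given sequence itself.\<close>
  have "(SUP n. energy \<Omega> V (\<epsilon> n) (u n)) \<le> ennreal M\<^sub>0" by (intro SUP_least assms(7))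
  then have sup: "(SUP n. energy \<Omega> V (\<epsilon> n) (u n)) < \<infinity>" by (rule le_less_trans) simp
  show "emeasure \<nu> (cball y (r / 2) \<inter> \<Omega>) = 0"
    if "0 < r" "ball y r \<subseteq> \<Omega>" "emeasure \<nu> (cball y r \<inter> \<Omega>) < ennreal (\<eta>\<^sub>1 * r)" for y r
    using assms(9)[unfolded clearing_out_constant_def, THEN conjunct2, rule_format, of \<epsilon> u \<nu> r y]
      assms(4,5,6,8) sup that by blast
  show "emeasure \<nu> (ball p a) = 0"
    if "0 < a" "a < b" "cball p b \<subseteq> \<Omega>" "emeasure \<nu> (cball p b - ball p a) = 0" for p a b
    by (rule isolated_energy_vanishes[OF assms(2) op less_imp_le[OF assms(3)] assms(4-8) that])
  show "tangent_vector (concentration_set \<Omega> \<nu> \<eta>\<^sub>1) x\<^sub>0 e" by fact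
  show "x\<^sub>0 \<in> \<Omega>" using assms(10) by (simp add: regular_point_def concentration_set_def)
  show "0 < \<theta>" "\<theta> < pi / 2" by fact+
qed

end
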